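(* Let $F$ be a distribution function on $\mathbb{R}$ with finite negative mean, whose right tail $\overline F=1-F$ is regularly varying of index $-\alpha$. Let $W$ be the distribution function of the global maximum $M=\max_{n\ge 0}S_n$ of the random walk with step distribution $F$, let $F_+$ and $F_-$ be its strict ascending and weak descending ladder height distributions, and let $p=P\{\tau<\infty\}$, where $\tau=\min\{n\ge 1: S_n>0\}$. Let $$\kappa=\sup\Bigl\{r\ge 0:\int_{-\infty}^0|x|^r\,dF(x)<\infty\Bigr\}$$ and assume $\kappa>1$. Suppose that $\overline F$ is smoothly varying of index $-\alpha$ and order $\omega>0$. Then, for any integer $m$ with $m\ge 1$ and $m<\min(\omega,\alpha,\kappa)$, the moments $\mu_{F_-,m}$ and $\mu_{F_+,m-1}$ are finite and, as $x\to\infty$, $$\overline W(x)=(1-p)\,\bigl(\mathrm{Id}-\mathsf L_{F_+,m-1}\bigr)^{-2}\bigl(\mathsf S\,\mathsf L_{F_-,m}\bigr)^{-1}(\mathrm D^{-1}\overline F)(x)+o\bigl(x^{-m+2}\,\overline F(x)\bigr),$$ where the inverses and the product are taken in the ring $\mathbb{R}_{m-1}[\mathrm D]$ and the resulting polynomial in $\mathrm D$ is applied to the function $\mathrm D^{-1}\overline F$.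
   Context: Random walk: $(X_n)_{n\ge1}$ are i.i.d. with distribution function $F$, $S_0=0$, $S_n=X_1+\cdots+X_n$, $M=\max_{n\ge0}S_n$ (a.s. finite since the mean is negative), $W(x)=P\{M\le x\}$. Ladder heights: with $\tau=\min\{n\ge1:S_n>0\}$ ($\min\emptyset=+\infty$), $F_+(x)=P\{S_\tau\le x,\ \tau<\infty\}$ is the (defective) strict ascending ladder height distribution, of total mass $p=P\{\tau<\infty\}<1$. With $\tau_-=\min\{n\ge1:S_n\le 0\}$, $F_-(x)=P\{S_{\tau_-}\le x\}$ is the weak descending ladder height distribution. Equivalently, $F=F_++F_--F_+\star F_-$ is the Wiener-Hopf factorization, $F_-$ concentrated on $(-\infty,0]$ and $F_+$ on $(0,\infty)$. Tails and moments: for a possibly defective distribution function $G$, $\overline G(x)=\lim_{t\to\infty}G(t)-G(x)$, and $\mu_{G,k}=\int x^k\,dG(x)$ is its $k$-th moment ($\mu_{G,0}$ is its total mass). Regular variation: a measurable function $f$, ultimately nonzero and of constant sign, is regularly varying of index $\rho$ if $f(\lambda t)/f(t)\to\lambda^\rho$ as $t\to\infty$ for every $\lambda>0$. Smooth variation: for a nonnegative integer $m$, $h$ is smoothly varying of index $-\alpha$ and order $m$ if it is ultimately $m$ times continuously differentiable and $h^{(m)}$ is regularly varying of index $-\alpha-m$; the set of such functions is $SR_{-\alpha,m}$. For a real $\omega>0$, write $\omega=m+r$ with $m$ the integer part of $\omega$ and $r\in[0,1)$. Then $h$ is smoothly varying of index $-\alpha$ and order $\omega$ if $h\in SR_{-\alpha,m}$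 and $$\lim_{\delta\to0}\limsup_{t\to\infty}\sup_{0<|x|\le\delta}\bigl|\Delta^r_{t,x}(h^{(m)})\bigr|=0,\qquad \Delta^r_{t,x}(g)=\mathrm{sign}(x)\,\frac{g(t(1-x))-g(t)}{|x|^r\,g(t)}.$$ Algebra: $\mathbb{R}_m[\mathrm D]$ is the ring of real polynomials in $\mathrm D$ modulo the ideal generated by $\mathrm D^{m+1}$; $\mathrm{Id}=\mathrm D^0$ is its unit. Elements act on sufficiently differentiable functions by letting $\mathrm D^k$ act as $k$-fold differentiation, the representative being the one of degree at most $m$. For a possibly defective distribution $G$ with finite $m$-th moment, its Laplace character of order $m$ is $\mathsf L_{G,m}=\sum_{0\le k\le m}\frac{(-1)^k}{k!}\mu_{G,k}\mathrm D^k\in\mathbb{R}_m[\mathrm D]$. The backward signed shift $\mathsf S$ is the linear map with $\mathsf S\,\mathrm D^0=0$ and $\mathsf S\,\mathrm D^j=-\mathrm D^{j-1}$ for $j\ge1$; it maps $\mathbb{R}_m[\mathrm D]$ to $\mathbb{R}_{m-1}[\mathrm D]$. For $f$ regularly varying of index less than $-1$, $\mathrm D^{-1}f(t)=-\int_t^\infty f(x)\,dx$, so that $\mathrm D^k\mathrm D^{-1}f=f^{(k-1)}$ for $k\ge1$. *)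

theory Defs
  imports
    "HOL-Probability.Probability"
    "HOL-Algebra.QuotRing"
    "HOL-Computational_Algebra.Polynomial"
    "HOL-Library.Landau_Symbols"
begin

section \<open>The random walk and its ladder heights\<close>

text \<open>The steps are \<open>X 1, X 2, \<dots>\<close>; the value \<open>X 0\<close> is never used.\<close>

definition walk :: "(nat \<Rightarrow> 'a \<Rightarrow> real) \<Rightarrow> nat \<Rightarrow> 'a \<Rightarrow> real" where
  "walk X n s = (\<Sum>i=1..n. X i s)"

text \<open>The maximum is taken in the extended reals, as a supremum: it is attained almost surely
  when the steps have negative mean, but not necessarily on all of the sample space.\<close>

definition walk_max :: "(nat \<Rightarrow> 'a \<Rightarrow> real) \<Rightarrow> 'a \<Rightarrow> ereal" where
  "walk_max X s = (SUP n. ereal (walk X n s))"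

definition max_cdf :: "'a measure \<Rightarrow> (nat \<Rightarrow> 'a \<Rightarrow> real) \<Rightarrow> real \<Rightarrow> real" where
  "max_cdf P X x = measure P {s \<in> space P. walk_max X s \<le> ereal x}"

text \<open>In \<^typ>\<open>enat\<close> the infimum of the empty set is \<open>\<infinity>\<close>.\<close>

definition ascending_time :: "(nat \<Rightarrow> 'a \<Rightarrow> real) \<Rightarrow> 'a \<Rightarrow> enat" where
  "ascending_time X s = Inf (enat ` {n. 1 \<le> n \<and> 0 < walk X n s})"

definition descending_time :: "(nat \<Rightarrow> 'a \<Rightarrow> real) \<Rightarrow> 'a \<Rightarrow> enat" where
  "descending_time X s = Inf (enat ` {n. 1 \<le> n \<and> walk X n s \<le> 0})"

definition ascending_prob :: "'a measure \<Rightarrow> (nat \<Rightarrow> 'a \<Rightarrow> real) \<Rightarrow> real" where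
  "ascending_prob P X = measure P {s \<in> space P. ascending_time X s < \<infinity>}"

definition ascending_ladder_cdf ::
    "'a measure \<Rightarrow> (nat \<Rightarrow> 'a \<Rightarrow> real) \<Rightarrow> real \<Rightarrow> real" where
  "ascending_ladder_cdf P X x =
     measure P {s \<in> space P. ascending_time X s < \<infinity> \<and>
       walk X (the_enat (ascending_time X s)) s \<le> x}"

definition descending_ladder_cdf ::
    "'a measure \<Rightarrow> (nat \<Rightarrow> 'a \<Rightarrow> real) \<Rightarrow> real \<Rightarrow> real" where
  "descending_ladder_cdf P X x =
     measure P {s \<in> space P. descending_time X s < \<infinity> \<and>
       walk X (the_enat (descending_time X s)) s \<le> x}"

section \<open>Tails and moments of possibly defective distribution functions\<close>

definition tail :: "(real \<Rightarrow> real) \<Rightarrow> real \<Rightarrow> real" where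
  "tail G x = Lim at_top G - G x"

definition finite_moment :: "(real \<Rightarrow> real) \<Rightarrow> nat \<Rightarrow> bool" where
  "finite_moment G k \<longleftrightarrow> integrable (interval_measure G) (\<lambda>x. x ^ k)"

definition moment :: "(real \<Rightarrow> real) \<Rightarrow> nat \<Rightarrow> real" where
  "moment G k = (\<integral>x. x ^ k \<partial>interval_measure G)"

definition left_moment_index :: "(real \<Rightarrow> real) \<Rightarrow> ereal" where
  "left_moment_index F =
     Sup (ereal ` {r. 0 \<le> r \<and>
       (\<integral>\<^sup>+x\<in>{..0}. ennreal (\<bar>x\<bar> powr r) \<partial>interval_measure F) < \<infinity>})"

section \<open>Regular and smooth variation\<close>

text \<open>Only the behaviour at infinity matters, so measurability is required on a half-line;
  this makes the notion applicable to derivatives which exist only ultimately.\<close>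

definition regularly_varying :: "(real \<Rightarrow> real) \<Rightarrow> real \<Rightarrow> bool" where
  "regularly_varying f \<rho> \<longleftrightarrow>
     (\<exists>t0. f \<in> borel_measurable (restrict_space borel {t0..})) \<and>
     ((\<forall>\<^sub>F t in at_top. f t > 0) \<or> (\<forall>\<^sub>F t in at_top. f t < 0)) \<and>
     (\<forall>c>0. ((\<lambda>t. f (c * t) / f t) \<longlongrightarrow> c powr \<rho>) at_top)"

definition ultimately_C :: "nat \<Rightarrow> (real \<Rightarrow> real) \<Rightarrow> bool" where
  "ultimately_C m h \<longleftrightarrow>
     (\<exists>t0. (\<forall>k<m. \<forall>t>t0. (deriv ^^ k) h differentiable (at t)) \<and>
           continuous_on {t0<..} ((deriv ^^ m) h))"

text \<open>\<open>SR \<rho> m\<close> is indexed by the index of variation itself, so smooth variation of index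
  \<open>-\<alpha>\<close> is membership in \<open>SR (-\<alpha>) m\<close>.\<close>

definition SR :: "real \<Rightarrow> nat \<Rightarrow> (real \<Rightarrow> real) set" where
  "SR \<rho> m = {h. ultimately_C m h \<and> regularly_varying ((deriv ^^ m) h) (\<rho> - real m)}"

definition SR_Delta :: "real \<Rightarrow> real \<Rightarrow> real \<Rightarrow> (real \<Rightarrow> real) \<Rightarrow> real" where
  "SR_Delta r t x g = sgn x * ((g (t * (1 - x)) - g t) / (\<bar>x\<bar> powr r * g t))"

definition smoothly_varying :: "(real \<Rightarrow> real) \<Rightarrow> real \<Rightarrow> real \<Rightarrow> bool" where
  "smoothly_varying h \<rho> \<omega> \<longleftrightarrow>
     (let m = nat \<lfloor>\<omega>\<rfloor>; r = frac \<omega> in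
       h \<in> SR \<rho> m \<and>
       ((\<lambda>\<delta>. Limsup at_top (\<lambda>t. SUP x\<in>{x. 0 < \<bar>x\<bar> \<and> \<bar>x\<bar> \<le> \<delta>}.
            ereal \<bar>SR_Delta r t x ((deriv ^^ m) h)\<bar>)) \<longlongrightarrow> 0) (at_right 0))"

section \<open>The ring of truncated differential operators\<close>

text \<open>The indeterminate of \<^typ>\<open>real poly\<close> plays the role of \<open>D\<close>. The ring of polynomials
  modulo the ideal generated by \<open>D^(m+1)\<close> is realised on the representatives of degree at
  most \<open>m\<close>; lemma \<open>D_ring_quotient\<close> below identifies it with the quotient ring.\<close>

definition D_ring :: "nat \<Rightarrow> real poly ring" where
  "D_ring m = \<lparr>carrier = {p. degree p \<le> m}, mult = (\<lambda>p q. (p * q) mod monom 1 (Suc m)),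
     one = 1, zero = 0, add = (+)\<rparr>"

definition real_poly_ring :: "real poly ring" where
  "real_poly_ring = \<lparr>carrier = UNIV, mult = (*), one = 1, zero = 0, add = (+)\<rparr>"

lemma mod_monom_eq_iff_degree:
  "p mod monom 1 (Suc m) = p \<longleftrightarrow> degree p \<le> m" for p :: "real poly"
proof
  assume "p mod monom 1 (Suc m) = p"
  moreover have "monom 1 (Suc m) \<noteq> (0 :: real poly)"
    by simp
  ultimately show "degree p \<le> m"
    using degree_mod_less[of "monom 1 (Suc m)" p] by (auto simp: degree_monom_eq)
qed (simp add: mod_poly_less degree_monom_eq)

lemma degree_mod_monom: "degree (p mod monom 1 (Suc m)) \<le> m" for p :: "real poly"
  by (subst mod_monom_eq_iff_degree[symmetric]) simp

lemma cring_real_poly_ring: "cring real_poly_ring"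
proof (rule cringI)
  show "abelian_group real_poly_ring"
  proof (rule abelian_groupI)
    fix p assume "p \<in> carrier real_poly_ring"
    show "\<exists>q\<in>carrier real_poly_ring. q \<oplus>\<^bsub>real_poly_ring\<^esub> p = \<zero>\<^bsub>real_poly_ring\<^esub>"
      by (rule bexI[of _ "- p"]) (simp_all add: real_poly_ring_def)
  qed (simp_all add: real_poly_ring_def)
  show "comm_monoid real_poly_ring"
    by (rule comm_monoidI) (simp_all add: real_poly_ring_def)
qed (simp_all add: real_poly_ring_def distrib_right)

lemma cring_D_ring: "cring (D_ring m)"
proof (rule cringI)
  show "abelian_group (D_ring m)"
  proof (rule abelian_groupI)
    fix p assume "p \<in> carrier (D_ring m)"
    then show "\<exists>q\<in>carrier (D_ring m). q \<oplus>\<^bsub>D_ring m\<^esub> p = \<zero>\<^bsub>D_ring m\<^esub>"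
      by (intro bexI[of _ "- p"]) (simp_all add: D_ring_def)
  qed (simp_all add: D_ring_def degree_add_le)
  show "comm_monoid (D_ring m)"
  proof (rule comm_monoidI)
    fix p q r
    show "p \<otimes>\<^bsub>D_ring m\<^esub> q \<otimes>\<^bsub>D_ring m\<^esub> r = p \<otimes>\<^bsub>D_ring m\<^esub> (q \<otimes>\<^bsub>D_ring m\<^esub> r)"
      by (simp add: D_ring_def mod_mult_left_eq mod_mult_right_eq mult.assoc)
    show "p \<otimes>\<^bsub>D_ring m\<^esub> q = q \<otimes>\<^bsub>D_ring m\<^esub> p"
      by (simp add: D_ring_def mult.commute)
  qed (simp_all add: D_ring_def degree_mod_monom mod_monom_eq_iff_degree)
qed (simp add: D_ring_def distrib_right poly_mod_add_left)

lemma D_ring_quotient: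
  "real_poly_ring Quot (PIdl\<^bsub>real_poly_ring\<^esub> (monom 1 (Suc m))) \<simeq> D_ring m"
proof -
  let ?h = "\<lambda>p :: real poly. p mod monom 1 (Suc m)"
  have "?h 1 = 1"
    by (simp add: mod_monom_eq_iff_degree)
  then have hom: "?h \<in> ring_hom real_poly_ring (D_ring m)"
    by (intro ring_hom_memI)
      (simp_all add: D_ring_def real_poly_ring_def degree_mod_monom poly_mod_add_left mod_mult_eq)
  interpret ring_hom_ring real_poly_ring "D_ring m" ?h
    by (rule ring_hom_ringI2)
      (use hom cring_real_poly_ring cring_D_ring in \<open>simp_all add: cring_def\<close>)
  have "?h ` carrier real_poly_ring = carrier (D_ring m)"
  proof
    show "?h ` carrier real_poly_ring \<subseteq> carrier (D_ring m)"
      by (auto simp: D_ring_def degree_mod_monom)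
    show "carrier (D_ring m) \<subseteq> ?h ` carrier real_poly_ring"
    proof
      fix p assume "p \<in> carrier (D_ring m)"
      then have "?h p = p"
        by (simp add: D_ring_def mod_monom_eq_iff_degree)
      then show "p \<in> ?h ` carrier real_poly_ring"
        by (intro image_eqI[OF sym]) (simp_all add: real_poly_ring_def)
    qed
  qed
  moreover have "a_kernel real_poly_ring (D_ring m) ?h = PIdl\<^bsub>real_poly_ring\<^esub> (monom 1 (Suc m))"
    unfolding a_kernel_def' cgenideal_def
    by (simp add: D_ring_def real_poly_ring_def mod_eq_0_iff_dvd dvd_def mult.commute)
  ultimately show ?thesis
    using FactRing_iso by simp
qed

definition D_act :: "real poly \<Rightarrow> (real \<Rightarrow> real) \<Rightarrow> real \<Rightarrow> real" where
  "D_act p f x = (\<Sum>k\<le>degree p. coeff p k * (deriv ^^ k) f x)"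

definition laplace_character :: "(real \<Rightarrow> real) \<Rightarrow> nat \<Rightarrow> real poly" where
  "laplace_character G m = (\<Sum>k\<le>m. monom ((-1) ^ k / fact k * moment G k) k)"

definition signed_shift :: "real poly \<Rightarrow> real poly" where
  "signed_shift p = - poly_shift 1 p"

lemma signed_shift_monom:
  "signed_shift (monom c 0) = 0"
  "signed_shift (monom c (Suc j)) = - monom c j"
  by (simp_all add: signed_shift_def poly_shift_monom)

lemma signed_shift_linear:
  "signed_shift (p + q) = signed_shift p + signed_shift q"
  "signed_shift (smult c p) = smult c (signed_shift p)"
  by (simp_all add: signed_shift_def poly_eq_iff coeff_poly_shift)

definition D_inv :: "(real \<Rightarrow> real) \<Rightarrow> real \<Rightarrow> real" where
  "D_inv f t = - (LBINT x:{t..}. f x)"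

end

theory Submission
  imports Defs "HOL-Computational_Algebra.Polynomial_FPS"
begin

text \<open>Write \<open>h\<close> for the tail of \<open>F\<close>, \<open>T\<close> for the tail of the law \<open>W\<close> of the maximum \<open>M\<close>, and \<open>X\<close> for a step that
is independent of \<open>M\<close>. Since \<open>M\<close> has the law of \<open>max 0 (X + M)\<close>, splitting the event \<open>X + M > x\<close>
according to which of the two summands is at most \<open>x / 2\<close> gives
\<open>T x = E[T (x - X); X \<le> x/2] + E[h (x - M); M \<le> x/2] + T (x/2) * h (x/2)\<close>
(lemma \<open>Lindley_tail\<close>). The theorem is obtained by solving this equation asymptotically.

Smooth variation says that \<open>h\<close> and its derivatives behave like those of a power
(\<open>smoothly_varying_derivative_bounds\<close>), so that an expectation \<open>E[g (x - Y); Y \<le> x/2]\<close>, where \<open>g\<close> is a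
derivative of \<open>D\<^sup>-\<^sup>1 h\<close>, may be replaced by the Taylor polynomial \<open>L\<^sub>Y(D) g\<close>, with \<open>L\<^sub>Y\<close> the Laplace character
of \<open>Y\<close>; the error is negligible as soon as the matching moment of \<open>Y\<close> is finite
(\<open>Taylor_expectation\<close>). If \<open>p(D)\<close> is a polynomial in \<open>D\<close>, then \<open>v = p(D) D\<^sup>-\<^sup>1 h\<close> satisfies the same equation as \<open>T\<close>
up to \<open>o(x\<^sup>1\<^sup>-\<^sup>m h x)\<close> when \<open>p * S L\<^sub>F = L\<^sub>W\<close> modulo \<open>D\<^sup>m\<close>. The difference \<open>u = T - v\<close> then
satisfies \<open>\<bar>u x\<bar> \<le> E[\<bar>u (x - X)\<bar>; X \<le> x/2] + o(x\<^sup>1\<^sup>-\<^sup>m h x)\<close>. Because the steps have negative mean, the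
functions \<open>x\<^sup>-\<^sup>r * (\<integral>t\<ge>x. h t)\<close> are strict supersolutions of this inequality, with a gain of order
\<open>x\<^sup>-\<^sup>r h x\<close> (\<open>barrier_supersolution\<close>), and a maximum principle yields
\<open>u x = o(x\<^sup>2\<^sup>-\<^sup>m h x)\<close> (\<open>small_solution\<close>, \<open>tail_expansion\<close>). The same barriers show beforehand that \<open>M\<close>
is almost surely finite with \<open>T x = O(x h x)\<close>, hence that \<open>M\<close> has \<open>m - 1\<close> moments.

It remains to express \<open>p = L\<^sub>W / S L\<^sub>F\<close> by ladder heights. At the first ascending ladder epoch the walk
starts afresh, which gives \<open>L\<^sub>W (Id - L\<^sub>F\<^sub>+) = 1 - p\<^sub>+\<close> with \<open>p\<^sub>+\<close> the total mass of \<open>F\<^sub>+\<close>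
(\<open>ladder_decomposition\<close>). Solving Lindley's equation by iteration shows that \<open>W\<close> is \<open>1 - p\<^sub>+\<close> times the expected number of
visits of the walk before it first returns to \<open>(-\<infinity>, 0]\<close> (\<open>max_law_eq_visits\<close>); so \<open>(1 - p\<^sub>+) F\<^sub>-\<close> is
the law of \<open>M + X\<close> restricted to \<open>(-\<infinity>, 0]\<close>, and comparing moments gives
\<open>L\<^sub>W * S L\<^sub>F = (1 - p\<^sub>+) S L\<^sub>F\<^sub>-\<close> (\<open>desc_law_moment\<close>). Eliminating \<open>L\<^sub>W\<close> and \<open>S L\<^sub>F\<close> produces the operator
\<open>(1 - p\<^sub>+) (Id - L\<^sub>F\<^sub>+)\<^sup>-\<^sup>2 (S L\<^sub>F\<^sub>-)\<^sup>-\<^sup>1\<close> of the theorem.\<close>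

section \<open>Regularly varying tails\<close>

lemma borel_measurable_antimono:
  fixes h :: "real \<Rightarrow> real"
  assumes "antimono h"
  shows "h \<in> borel_measurable borel"
proof -
  have "(\<lambda>x. - h x) \<in> borel_measurable borel"
    using assms by (intro borel_measurable_mono) (simp add: monotone_def)
  from borel_measurable_uminus[OF this] show ?thesis by simp
qed

lemma regularly_varying_half:
  assumes "regularly_varying h \<rho>" "\<And>x. 0 < h x"
  shows "\<exists>C\<ge>1. \<forall>\<^sub>F x in at_top. h (x / 2) \<le> C * h x"
proof -
  have "((\<lambda>t. h (1/2 * t) / h t) \<longlongrightarrow> (1/2) powr \<rho>) at_top"
    using assms(1) unfolding regularly_varying_def by (metis half_gt_zero_iff zero_less_one)
  then have "\<forall>\<^sub>F t in at_top. h (1/2 * t) / h t < max 1 ((1/2) powr \<rho>) + 1"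
    by (rule order_tendstoD) linarith
  then have "\<forall>\<^sub>F t in at_top. h (t / 2) \<le> (max 1 ((1/2) powr \<rho>) + 1) * h t"
    by eventually_elim (use assms(2) in \<open>simp add: field_simps\<close>)
  then show ?thesis by (intro exI[of _ "max 1 ((1/2) powr \<rho>) + 1"]) auto
qed

text \<open>A Potter bound. For a monotone function it follows from the limit along the single ratio 2: each
doubling of the argument costs a factor \<open>2 powr (-\<gamma>)\<close>, and monotonicity bridges the gap to the next
power of 2 at the price of the constant.\<close>

lemma regularly_varying_power_bound:
  assumes rv: "regularly_varying h (- \<alpha>)" and pos: "\<And>x. 0 < h x" and anti: "antimono h"
    and \<gamma>: "\<gamma> < \<alpha>" "0 < \<gamma>"
  shows "\<exists>b\<ge>1. \<forall>x\<ge>b. \<forall>t\<ge>x. h t \<le> 2 powr \<gamma> * (x / t) powr \<gamma> * h x"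
proof -
  have "((\<lambda>t. h (2 * t) / h t) \<longlongrightarrow> 2 powr (- \<alpha>)) at_top"
    using rv unfolding regularly_varying_def by (metis zero_less_numeral)
  then have "\<forall>\<^sub>F t in at_top. h (2 * t) / h t < 2 powr (- \<gamma>)"
    by (rule order_tendstoD) (use \<gamma> in simp)
  then obtain b0 where b0: "\<And>t. b0 \<le> t \<Longrightarrow> h (2 * t) / h t < 2 powr (- \<gamma>)"
    unfolding eventually_at_top_linorder by blast
  have dbl: "h (2 ^ n * x) \<le> (2 powr (- \<gamma>)) ^ n * h x" if "max 1 b0 \<le> x" for n x
  proof (induction n)
    case (Suc n)
    have "1 * x \<le> 2 ^ n * x" using that by (intro mult_right_mono) auto
    then have "h (2 * (2 ^ n * x)) / h (2 ^ n * x) < 2 powr (- \<gamma>)"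
      using that by (intro b0) linarith
    then have "h (2 * (2 ^ n * x)) \<le> 2 powr (- \<gamma>) * h (2 ^ n * x)"
      using pos[of "2 ^ n * x"] by (simp add: divide_less_eq)
    also have "\<dots> \<le> 2 powr (- \<gamma>) * ((2 powr (- \<gamma>)) ^ n * h x)"
      using Suc by (intro mult_left_mono) auto
    finally show ?case by (simp add: mult.assoc)
  qed simp
  have "h t \<le> 2 powr \<gamma> * (x / t) powr \<gamma> * h x" if "max 1 b0 \<le> x" "x \<le> t" for x t
  proof -
    have x: "0 < x" "0 < t" using that by auto
    define n where "n = nat \<lfloor>log 2 (t / x)\<rfloor>"
    have l0: "0 \<le> log 2 (t / x)" using x that by (simp add: zero_le_log_cancel_iff)
    have n: "real n \<le> log 2 (t / x)" "log 2 (t / x) < real n + 1"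
      using l0 unfolding n_def by linarith+
    have "2 powr real n \<le> t / x" using n x by (subst le_log_iff[symmetric]) auto
    then have "2 ^ n * x \<le> t" using x by (simp add: field_simps powr_realpow)
    then have "h t \<le> h (2 ^ n * x)" by (rule antimonoD[OF anti])
    also have "\<dots> \<le> (2 powr (- \<gamma>)) ^ n * h x" using dbl that by simp
    also have "(2 powr (- \<gamma>)) ^ n = (2 powr real n) powr (- \<gamma>)"
      by (simp add: powr_powr powr_realpow[symmetric] mult.commute)
    also have "\<dots> \<le> (t / x / 2) powr (- \<gamma>)"
    proof (rule powr_mono2')
      have "t / x < 2 powr (real n + 1)" using n x by (subst log_less_iff[symmetric]) auto
      then show "t / x / 2 \<le> 2 powr real n" by (simp add: powr_add)
    qed (use x \<gamma> in auto)
    also have "\<dots> = 2 powr \<gamma> * (x / t) powr \<gamma>"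
      using x by (simp add: powr_divide powr_minus powr_mult field_simps)
    finally show ?thesis using pos[of x] by (simp add: mult_right_mono)
  qed
  then show ?thesis by (intro exI[of _ "max 1 b0"]) auto
qed

text \<open>The half of Karamata's theorem that only needs orders of magnitude: the integrated tail is
comparable to \<open>x * h x\<close>.\<close>

lemma tail_integral_bounds:
  assumes anti: "antimono h" and pos: "\<And>x::real. 0 < (h x :: real)"
    and \<gamma>: "1 < \<gamma>" and b: "1 \<le> b"
    and bound: "\<And>x t. b \<le> x \<Longrightarrow> x \<le> t \<Longrightarrow> h t \<le> 2 powr \<gamma> * (x / t) powr \<gamma> * h x"
    and x: "b \<le> x"
  shows "set_integrable lborel {x..} h"
    and "(LBINT t:{x..}. h t) \<le> 2 powr \<gamma> / (\<gamma> - 1) * x * h x"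
    and "x * h (2 * x) \<le> (LBINT t:{x..}. h t)"
proof -
  have [measurable]: "h \<in> borel_measurable borel"
    using anti by (rule borel_measurable_antimono)
  have x0: "0 < x" using x b by simp
  have nn: "(\<integral>\<^sup>+t. ennreal (t powr (- \<gamma>)) * indicator {x..} t \<partial>lborel) = ennreal (0 - - (x powr (1 - \<gamma>) / (\<gamma> - 1)))"
  proof (rule nn_integral_FTC_atLeast)
    show "((\<lambda>t. - (t powr (1 - \<gamma>) / (\<gamma> - 1))) has_real_derivative t powr (- \<gamma>)) (at t)" if "x \<le> t" for t
    proof -
      have "((\<lambda>t. t powr (1 - \<gamma>)) has_real_derivative (1 - \<gamma>) * t powr (1 - \<gamma> - 1)) (at t)"
        using that x0 by (intro has_real_derivative_powr) simp
      from DERIV_minus[OF DERIV_cdivide[OF this, of "\<gamma> - 1"]]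
      have "((\<lambda>t. - (t powr (1 - \<gamma>) / (\<gamma> - 1))) has_real_derivative - ((1 - \<gamma>) * t powr (1 - \<gamma> - 1) / (\<gamma> - 1))) (at t)" .
      moreover have "- ((1 - \<gamma>) * t powr (1 - \<gamma> - 1) / (\<gamma> - 1)) = t powr (- \<gamma>)"
      proof -
        have "(1 - \<gamma>) * c = - c * (\<gamma> - 1)" for c by (simp add: algebra_simps)
        then show ?thesis using \<gamma> by simp
      qed
      ultimately show ?thesis by simp
    qed
    have "((\<lambda>t. - (t powr (1 - \<gamma>) / (\<gamma> - 1))) \<longlongrightarrow> - (0 / (\<gamma> - 1))) at_top"
      by (intro tendsto_intros tendsto_neg_powr filterlim_ident) (use \<gamma> in auto)
    then show "((\<lambda>t. - (t powr (1 - \<gamma>) / (\<gamma> - 1))) \<longlongrightarrow> 0) at_top" by simp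
  qed auto
  have hb: "h t \<le> 2 powr \<gamma> * x powr \<gamma> * h x * t powr (- \<gamma>)" if "x \<le> t" for t
    using bound[OF x that] x0 that by (simp add: powr_divide powr_minus field_simps)
  have "(\<integral>\<^sup>+t. ennreal (h t) * indicator {x..} t \<partial>lborel) \<le>
      (\<integral>\<^sup>+t. ennreal (2 powr \<gamma> * x powr \<gamma> * h x) * (ennreal (t powr (- \<gamma>)) * indicator {x..} t) \<partial>lborel)"
    using pos[of x] by (intro nn_integral_mono)
      (auto split: split_indicator simp flip: ennreal_mult intro!: ennreal_leI hb)
  also have "\<dots> = ennreal (2 powr \<gamma> * x powr \<gamma> * h x) * ennreal (x powr (1 - \<gamma>) / (\<gamma> - 1))"
    by (subst nn_integral_cmult) (auto simp: nn)
  also have "\<dots> = ennreal (2 powr \<gamma> / (\<gamma> - 1) * x * h x)"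
    using pos[of x] x0 \<gamma> by (simp flip: ennreal_mult) (simp add: powr_diff field_simps)
  finally have le: "(\<integral>\<^sup>+t. ennreal (h t) * indicator {x..} t \<partial>lborel) \<le> ennreal (2 powr \<gamma> / (\<gamma> - 1) * x * h x)" .
  have eq: "(\<integral>\<^sup>+t. ennreal (h t) * indicator {x..} t \<partial>lborel) = (\<integral>\<^sup>+t. ennreal (norm (indicator {x..} t *\<^sub>R h t)) \<partial>lborel)"
    using pos by (intro nn_integral_cong) (auto split: split_indicator simp: less_imp_le)
  show int: "set_integrable lborel {x..} h"
    unfolding set_integrable_def
    by (rule integrableI_bounded) (use le eq in \<open>auto simp: less_top[symmetric] top_unique\<close>)
  have "ennreal (LBINT t:{x..}. h t) = (\<integral>\<^sup>+t. ennreal (h t) * indicator {x..} t \<partial>lborel)"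
    using int pos unfolding set_lebesgue_integral_def set_integrable_def
    by (subst nn_integral_eq_integral[symmetric])
      (auto split: split_indicator simp: less_imp_le intro!: nn_integral_cong)
  with le have "ennreal (LBINT t:{x..}. h t) \<le> ennreal (2 powr \<gamma> / (\<gamma> - 1) * x * h x)" by simp
  then show "(LBINT t:{x..}. h t) \<le> 2 powr \<gamma> / (\<gamma> - 1) * x * h x"
    using pos[of x] x0 \<gamma> by (subst (asm) ennreal_le_iff) auto
  have "x * h (2 * x) = (LBINT t:{x..2*x}. h (2 * x))"
    using x0 by (simp add: set_lebesgue_integral_def)
  also have "\<dots> \<le> (LBINT t:{x..2*x}. h t)"
  proof (rule set_integral_mono)
    show "set_integrable lborel {x..2*x} (\<lambda>_. h (2 * x))"
      using x0 by (auto simp: set_integrable_def intro!: integrable_real_indicator)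
    show "set_integrable lborel {x..2*x} h" by (rule set_integrable_subset[OF int]) auto
    show "h (2 * x) \<le> h t" if "t \<in> {x..2*x}" for t using that by (intro antimonoD[OF anti]) simp
  qed
  also have "\<dots> \<le> (LBINT t:{x..}. h t)"
    using int set_integrable_subset[OF int, of "{x..2*x}"] pos
    unfolding set_lebesgue_integral_def set_integrable_def
    by (intro integral_mono) (auto split: split_indicator simp: less_imp_le)
  finally show "x * h (2 * x) \<le> (LBINT t:{x..}. h t)" .
qed

section \<open>Derivatives of a smoothly varying function\<close>

text \<open>Smooth variation makes only the top derivative regularly varying, without monotonicity. After
rescaling, \<open>G (2 x) - G x\<close> divided by \<open>x * g x\<close> is the integral over \<open>{1..2}\<close> of functions that converge
pointwise to a positive power; by Fatou's lemma its lower limit is positive. This replaces the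
uniform convergence theorem.\<close>

lemma regularly_varying_le_integral:
  fixes g G :: "real \<Rightarrow> real"
  assumes lim: "\<And>c. 0 < c \<Longrightarrow> ((\<lambda>t. g (c * t) / g t) \<longlongrightarrow> c powr \<rho>) at_top"
    and pos: "\<And>x. a < x \<Longrightarrow> 0 < g x" and cont: "continuous_on {a<..} g"
    and G: "\<And>x. a < x \<Longrightarrow> (G has_real_derivative g x) (at x)"
  shows "\<exists>C. \<forall>\<^sub>F x in at_top. x * g x \<le> C * (G (2 * x) - G x)"
proof (rule ccontr)
  assume "\<nexists>C. \<forall>\<^sub>F x in at_top. x * g x \<le> C * (G (2 * x) - G x)"
  then have "\<exists>x\<ge>max (real n) (max a 0 + 1). x * g x > real n * (G (2 * x) - G x)" for n
    unfolding eventually_at_top_linorder by (metis not_le)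
  then obtain X where X: "\<And>n. max (real n) (max a 0 + 1) \<le> X n"
    "\<And>n. real n * (G (2 * X n) - G (X n)) < X n * g (X n)" by metis
  have Xpos: "0 < X n" "a < X n" for n using X(1)[of n] by auto
  have Xlim: "filterlim X at_top sequentially"
    by (rule filterlim_at_top_mono[OF filterlim_real_sequentially]) (use X(1) in auto)
  define u where "u n s = ennreal (g (s * X n) / g (X n)) * indicator {1..2} s" for n s
  have aX: "a < s * X n" if "1 \<le> s" for s n
  proof -
    have "1 * X n \<le> s * X n" using that Xpos[of n] by (intro mult_right_mono) auto
    then show ?thesis using Xpos(2)[of n] by linarith
  qed
  have fund: "has_bochner_integral lborel (\<lambda>s. g (s * X n) / g (X n) * indicator {1..2} s)
      (G (2 * X n) / (X n * g (X n)) - G (1 * X n) / (X n * g (X n)))" for n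
  proof (rule has_bochner_integral_FTC_Icc_real)
    fix s :: real assume s: "1 \<le> s" "s \<le> 2"
    have "((\<lambda>s. G (s * X n)) has_real_derivative g (s * X n) * X n) (at s)"
      by (rule DERIV_chain2[where f=G and g="\<lambda>s. s * X n"]) (use G aX s in \<open>auto intro!: derivative_eq_intros\<close>)
    from DERIV_cdivide[OF this, of "X n * g (X n)"]
    show "((\<lambda>s. G (s * X n) / (X n * g (X n))) has_real_derivative g (s * X n) / g (X n)) (at s)"
      using Xpos[of n] by simp
    have "isCont g (s * X n)"
      using cont aX[OF s(1), of n] by (simp add: continuous_on_eq_continuous_at)
    then have "isCont (\<lambda>s. g (s * X n)) s"
      by (rule isCont_o2[rotated]) (intro continuous_intros)
    then show "isCont (\<lambda>s. g (s * X n) / g (X n)) s"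
      by (intro continuous_intros) (use pos[OF Xpos(2)[of n]] in auto)
  qed simp
  have u_eq: "u n s = ennreal (g (s * X n) / g (X n) * indicator {1..2} s)" for n s
    by (auto simp: u_def split: split_indicator)
  have unn: "0 \<le> g (s * X n) / g (X n) * indicator {1..2} s" for n s
    using pos[OF aX[of s n]] pos[OF Xpos(2)[of n]] by (auto split: split_indicator)
  have meas: "u n \<in> borel_measurable lborel" for n
    unfolding u_eq[abs_def] using fund[of n] by (auto simp: has_bochner_integral_iff)
  have "(\<integral>\<^sup>+s. u n s \<partial>lborel) = ennreal ((G (2 * X n) - G (X n)) / (X n * g (X n)))" for n
    unfolding u_eq using fund[of n] unn[of _ n]
    by (subst nn_integral_eq_integral) (auto simp: has_bochner_integral_iff diff_divide_distrib)
  moreover have "(G (2 * X n) - G (X n)) / (X n * g (X n)) \<le> 1 / real n" if "0 < n" for n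
    using X(2)[of n] Xpos[of n] pos[OF Xpos(2)[of n]] that by (simp add: field_simps)
  ultimately have ub: "(\<integral>\<^sup>+s. u n s \<partial>lborel) \<le> ennreal (1 / real n)" if "0 < n" for n
    using that by (simp add: ennreal_leI)
  have "(\<lambda>n. ennreal (1 / real n)) \<longlonglongrightarrow> ennreal 0"
    by (intro tendsto_ennrealI lim_const_over_n)
  then have "(\<lambda>n. \<integral>\<^sup>+s. u n s \<partial>lborel) \<longlonglongrightarrow> 0"
    using tendsto_sandwich[OF always_eventually[OF allI, OF zero_le] eventually_sequentiallyI[of 1, OF ub] tendsto_const]
    by simp
  then have lim0: "liminf (\<lambda>n. \<integral>\<^sup>+s. u n s \<partial>lborel) = 0"
    by (intro lim_imp_Liminf) auto
  have ulim: "liminf (\<lambda>n. u n s) = ennreal (s powr \<rho>) * indicator {1..2} s" for s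
  proof (rule lim_imp_Liminf)
    show "(\<lambda>n. u n s) \<longlonglongrightarrow> ennreal (s powr \<rho>) * indicator {1..2} s"
    proof (cases "s \<in> {1..2}")
      case True
      then have "(\<lambda>n. g (s * X n) / g (X n)) \<longlonglongrightarrow> s powr \<rho>"
        by (intro filterlim_compose[OF lim Xlim]) auto
      then show ?thesis using True by (auto simp: u_def intro: tendsto_ennrealI)
    qed (simp add: u_def)
  qed simp
  have "(\<integral>\<^sup>+s. ennreal (s powr \<rho>) * indicator {1..2} s \<partial>lborel) \<le> liminf (\<lambda>n. \<integral>\<^sup>+s. u n s \<partial>lborel)"
    using nn_integral_liminf[of u lborel] meas by (simp only: ulim)
  then have "(\<integral>\<^sup>+s. ennreal (s powr \<rho>) * indicator {1..2} s \<partial>lborel) = 0" using lim0 by simp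
  moreover have "(\<integral>\<^sup>+s. ennreal (min 1 (2 powr \<rho>)) * indicator {1..2::real} s \<partial>lborel) \<le>
      (\<integral>\<^sup>+s. ennreal (s powr \<rho>) * indicator {1..2::real} s \<partial>lborel)"
  proof (rule nn_integral_mono)
    fix s :: real
    show "ennreal (min 1 (2 powr \<rho>)) * indicator {1..2} s \<le> ennreal (s powr \<rho>) * indicator {1..2} s"
    proof (cases "s \<in> {1..2}")
      case True
      have "min 1 (2 powr \<rho>) \<le> s powr \<rho>"
      proof (cases "0 \<le> \<rho>")
        case True
        then show ?thesis using \<open>s \<in> {1..2}\<close> by (auto intro!: min.coboundedI1 ge_one_powr_ge_zero)
      next
        case False
        then show ?thesis using \<open>s \<in> {1..2}\<close> by (intro min.coboundedI2 powr_mono2') auto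
      qed
      then show ?thesis using True by (auto intro: ennreal_leI)
    qed simp
  qed
  ultimately show False by (auto simp: nn_integral_cmult_indicator min_def split: if_splits)
qed

lemma eventually_one_sign_antiderivative:
  fixes f f' :: "real \<Rightarrow> real"
  assumes "\<And>x. a < x \<Longrightarrow> (f has_real_derivative f' x) (at x)"
    and "(\<forall>x>a. 0 \<le> f' x) \<or> (\<forall>x>a. f' x \<le> 0)"
  shows "mono_on {a<..} f \<or> antimono_on {a<..} f"
    and "\<exists>b\<ge>a. (\<forall>x>b. 0 \<le> f x) \<or> (\<forall>x>b. f x \<le> 0)"
proof -
  have up: "f x \<le> f y" if "a < x" "x \<le> y" "\<forall>x>a. 0 \<le> f' x" for x y
    by (rule DERIV_nonneg_imp_nondecreasing[OF that(2)]) (use assms(1) that in \<open>meson less_le_trans\<close>)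
  have down: "f y \<le> f x" if "a < x" "x \<le> y" "\<forall>x>a. f' x \<le> 0" for x y
    by (rule DERIV_nonpos_imp_nonincreasing[OF that(2)]) (use assms(1) that in \<open>meson less_le_trans\<close>)
  show 1: "mono_on {a<..} f \<or> antimono_on {a<..} f"
    using assms(2) up down by (auto simp: monotone_on_def)
  then show "\<exists>b\<ge>a. (\<forall>x>b. 0 \<le> f x) \<or> (\<forall>x>b. f x \<le> 0)"
  proof
    assume m: "mono_on {a<..} f"
    show ?thesis
    proof (cases "\<exists>c>a. 0 \<le> f c")
      case True
      then obtain c where c: "a < c" "0 \<le> f c" by blast
      have "0 \<le> f x" if "c < x" for x
        using monotone_onD[OF m, of c x] c that by simp
      then show ?thesis using c by (intro exI[of _ c]) simp
    next
      case False
      then show ?thesis by (intro exI[of _ a]) (auto simp: not_le less_imp_le)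
    qed
  next
    assume m: "antimono_on {a<..} f"
    show ?thesis
    proof (cases "\<exists>c>a. f c \<le> 0")
      case True
      then obtain c where c: "a < c" "f c \<le> 0" by blast
      have "f x \<le> 0" if "c < x" for x
        using monotone_onD[OF m, of c x] c that by simp
      then show ?thesis using c by (intro exI[of _ c]) simp
    next
      case False
      then show ?thesis by (intro exI[of _ a]) (auto simp: not_le less_imp_le)
    qed
  qed
qed

text \<open>Below the top order the derivatives are ultimately monotone, because the next one has a constant
sign. By the mean value theorem \<open>f'\<close> takes a controlled value on either side of \<open>x\<close>, and by
monotonicity \<open>f' x\<close> lies between the two.\<close>

lemma monotone_derivative_bound:
  fixes f f' :: "real \<Rightarrow> real"
  assumes d: "\<And>x. a < x \<Longrightarrow> (f has_real_derivative f' x) (at x)"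
    and m: "mono_on {a<..} f' \<or> antimono_on {a<..} f'"
    and x: "a < x / 2" "0 < x"
  shows "x * \<bar>f' x\<bar> \<le> 3 * (\<bar>f (2 * x)\<bar> + \<bar>f x\<bar> + \<bar>f (x / 2)\<bar>)"
proof -
  obtain z where z: "x < z" "z < 2 * x" "f (2 * x) - f x = (2 * x - x) * f' z"
    using MVT2[of x "2 * x" f f'] d x by auto
  obtain y where y: "x / 2 < y" "y < x" "f x - f (x / 2) = (x - x / 2) * f' y"
    using MVT2[of "x / 2" x f f'] d x by auto
  have "f' y \<le> f' x \<and> f' x \<le> f' z \<or> f' z \<le> f' x \<and> f' x \<le> f' y"
    using m x y z by (auto simp: monotone_on_def)
  then have "\<bar>f' x\<bar> \<le> \<bar>f' y\<bar> + \<bar>f' z\<bar>" by linarith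
  then have "x * \<bar>f' x\<bar> \<le> x * (\<bar>f' y\<bar> + \<bar>f' z\<bar>)" using x by (intro mult_left_mono) auto
  also have "\<dots> = 2 * \<bar>f x - f (x / 2)\<bar> + \<bar>f (2 * x) - f x\<bar>"
    unfolding z(3) y(3) using x by (simp add: abs_mult algebra_simps)
  also have "\<dots> \<le> 3 * (\<bar>f (2 * x)\<bar> + \<bar>f x\<bar> + \<bar>f (x / 2)\<bar>)"
  proof -
    have "2 * \<bar>u - v\<bar> + \<bar>w - u\<bar> \<le> 3 * (\<bar>w\<bar> + \<bar>u\<bar> + \<bar>v\<bar>)" for u v w :: real by (smt (verit))
    then show ?thesis .
  qed
  finally show ?thesis .
qed

lemma derivative_scale_step:
  assumes anti: "antimono h" and pos: "\<And>x. 0 < (h x :: real)"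
    and half: "\<forall>\<^sub>F x in at_top. h (x / 2) \<le> C * h x"
    and f: "\<forall>\<^sub>F x in at_top. \<bar>f x\<bar> \<le> B * h x / x ^ k"
    and f': "\<forall>\<^sub>F x in at_top. x * \<bar>f' x\<bar> \<le> A * (\<bar>f (2 * x)\<bar> + \<bar>f x\<bar> + \<bar>f (x / 2)\<bar>)"
  shows "\<exists>K. \<forall>\<^sub>F x in at_top. \<bar>f' x\<bar> \<le> K * h x / x ^ Suc k"
proof -
  obtain b where b: "\<And>x. b \<le> x \<Longrightarrow> \<bar>f x\<bar> \<le> B * h x / x ^ k"
    "\<And>x. b \<le> x \<Longrightarrow> h (x / 2) \<le> C * h x"
    "\<And>x. b \<le> x \<Longrightarrow> x * \<bar>f' x\<bar> \<le> A * (\<bar>f (2 * x)\<bar> + \<bar>f x\<bar> + \<bar>f (x / 2)\<bar>)"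
    using eventually_conj[OF f eventually_conj[OF half f']] unfolding eventually_at_top_linorder by blast
  have "\<bar>f' x\<bar> \<le> (\<bar>A\<bar> * \<bar>B\<bar> * (2 + 2 ^ k * \<bar>C\<bar>)) * h x / x ^ Suc k" if x: "max 1 (2 * \<bar>b\<bar>) \<le> x" for x
  proof -
    have x0: "0 < x" "1 \<le> x" "b \<le> x" "b \<le> 2 * x" "b \<le> x / 2" using x by linarith+
    have B: "\<bar>f y\<bar> \<le> \<bar>B\<bar> * h y / y ^ k" if "b \<le> y" "0 < y" for y
    proof -
      have "B * h y / y ^ k \<le> \<bar>B\<bar> * h y / y ^ k"
        using pos[of y] that by (intro divide_right_mono mult_right_mono) auto
      then show ?thesis using b(1)[OF that(1)] by linarith
    qed
    have "\<bar>f (2 * x)\<bar> \<le> \<bar>B\<bar> * h (2 * x) / (2 * x) ^ k" by (rule B) (use x0 in auto)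
    also have "\<dots> \<le> \<bar>B\<bar> * h x / x ^ k"
      using pos[of "2 * x"] pos[of x] x0 by (intro frac_le mult_left_mono antimonoD[OF anti] power_mono) auto
    finally have 1: "\<bar>f (2 * x)\<bar> \<le> \<bar>B\<bar> * h x / x ^ k" .
    have "\<bar>f (x / 2)\<bar> \<le> \<bar>B\<bar> * h (x / 2) / (x / 2) ^ k" using B x0 by simp
    also have "\<dots> \<le> \<bar>B\<bar> * (\<bar>C\<bar> * h x) / (x / 2) ^ k"
    proof (intro divide_right_mono mult_left_mono)
      have "h (x / 2) \<le> C * h x" using b(2) x0 by simp
      also have "\<dots> \<le> \<bar>C\<bar> * h x" using pos[of x] by (intro mult_right_mono) auto
      finally show "h (x / 2) \<le> \<bar>C\<bar> * h x" .
    qed (use x0 in auto)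
    also have "\<dots> = 2 ^ k * \<bar>C\<bar> * (\<bar>B\<bar> * h x / x ^ k)" by (simp add: power_divide)
    finally have 2: "\<bar>f (x / 2)\<bar> \<le> 2 ^ k * \<bar>C\<bar> * (\<bar>B\<bar> * h x / x ^ k)" .
    have 3: "\<bar>f x\<bar> \<le> \<bar>B\<bar> * h x / x ^ k" using B x0 by simp
    have "x * \<bar>f' x\<bar> \<le> A * (\<bar>f (2 * x)\<bar> + \<bar>f x\<bar> + \<bar>f (x / 2)\<bar>)" using b(3) x0 by simp
    also have "\<dots> \<le> \<bar>A\<bar> * (\<bar>f (2 * x)\<bar> + \<bar>f x\<bar> + \<bar>f (x / 2)\<bar>)" by (intro mult_right_mono) auto
    also have "\<dots> \<le> \<bar>A\<bar> * (\<bar>B\<bar> * h x / x ^ k + \<bar>B\<bar> * h x / x ^ k + 2 ^ k * \<bar>C\<bar> * (\<bar>B\<bar> * h x / x ^ k))"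
      by (intro mult_left_mono add_mono 1 2 3) auto
    also have "\<dots> = x * ((\<bar>A\<bar> * \<bar>B\<bar> * (2 + 2 ^ k * \<bar>C\<bar>)) * h x / x ^ Suc k)"
      using x0 by (simp add: field_simps)
    finally show ?thesis using x0(1) by (rule mult_left_le_imp_le)
  qed
  then show ?thesis
    unfolding eventually_at_top_linorder by blast
qed

text \<open>Upward induction on \<open>k\<close>, in which \<open>x\<close> times a derivative is bounded by the function below it at \<open>2 x\<close>,
\<open>x\<close> and \<open>x / 2\<close>. The sign of the top derivative is propagated downwards first, since it is what makes
the intermediate derivatives monotone.\<close>

lemma smoothly_varying_derivative_bounds:
  fixes h :: "real \<Rightarrow> real"
  assumes anti: "antimono h" and pos: "\<And>x. 0 < h x"
    and half: "\<forall>\<^sub>F x in at_top. h (x / 2) \<le> C * h x"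
    and SR: "h \<in> SR \<rho> M" and k: "k \<le> M"
  shows "\<exists>K. \<forall>\<^sub>F x in at_top. \<bar>(deriv ^^ k) h x\<bar> \<le> K * h x / x ^ k"
proof -
  let ?h = "\<lambda>k. (deriv ^^ k) h"
  from SR obtain t0 where diff: "\<And>k t. k < M \<Longrightarrow> t0 < t \<Longrightarrow> ?h k differentiable (at t)"
    and cont: "continuous_on {t0<..} (?h M)"
    and sgn: "(\<forall>\<^sub>F t in at_top. ?h M t > 0) \<or> (\<forall>\<^sub>F t in at_top. ?h M t < 0)"
    and lim: "\<And>c. 0 < c \<Longrightarrow> ((\<lambda>t. ?h M (c * t) / ?h M t) \<longlongrightarrow> c powr (\<rho> - real M)) at_top"
    unfolding SR_def ultimately_C_def regularly_varying_def by blast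
  have deriv: "(?h k has_real_derivative ?h (Suc k) t) (at t)" if "k < M" "t0 < t" for k t
    using diff[OF that] by (simp add: DERIV_deriv_iff_real_differentiable)
  obtain t1 where t1: "t0 \<le> t1" and sgn1: "(\<forall>t>t1. ?h M t > 0) \<or> (\<forall>t>t1. ?h M t < 0)"
  proof -
    obtain s where "(\<forall>t>s. ?h M t > 0) \<or> (\<forall>t>s. ?h M t < 0)"
      using sgn unfolding eventually_at_top_dense by blast
    then show ?thesis by (intro that[of "max t0 s"]) auto
  qed
  have sign: "\<exists>b\<ge>t1. (\<forall>x>b. 0 \<le> ?h (M - j) x) \<or> (\<forall>x>b. ?h (M - j) x \<le> 0)" if "j \<le> M" for j
    using that
  proof (induction j)
    case 0
    then show ?case using sgn1 by (intro exI[of _ t1]) (auto intro: less_imp_le)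
  next
    case (Suc j)
    then obtain b where b: "t1 \<le> b" "(\<forall>x>b. 0 \<le> ?h (M - j) x) \<or> (\<forall>x>b. ?h (M - j) x \<le> 0)" by auto
    have s: "Suc (M - Suc j) = M - j" using Suc.prems by simp
    obtain c where c: "b \<le> c" "(\<forall>x>c. 0 \<le> ?h (M - Suc j) x) \<or> (\<forall>x>c. ?h (M - Suc j) x \<le> 0)"
    proof (rule exE)
      show "\<exists>c\<ge>b. (\<forall>x>c. 0 \<le> ?h (M - Suc j) x) \<or> (\<forall>x>c. ?h (M - Suc j) x \<le> 0)"
    proof (rule eventually_one_sign_antiderivative(2))
      show "(?h (M - Suc j) has_real_derivative ?h (M - j) x) (at x)" if "b < x" for x
        using deriv[of "M - Suc j" x] Suc.prems b(1) t1 that unfolding s by simp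
    qed (rule b)
    qed blast
    show ?case by (rule exI[of _ c]) (use b(1) c in simp)
  qed
  show ?thesis using k
  proof (induction k)
    case 0
    show ?case using pos by (intro exI[of _ 1]) (simp add: abs_of_pos)
  next
    case (Suc k)
    then obtain B where B: "\<forall>\<^sub>F x in at_top. \<bar>?h k x\<bar> \<le> B * h x / x ^ k" by auto
    have "\<exists>A. \<forall>\<^sub>F x in at_top. x * \<bar>?h (Suc k) x\<bar> \<le> A * (\<bar>?h k (2 * x)\<bar> + \<bar>?h k x\<bar> + \<bar>?h k (x / 2)\<bar>)"
    proof (cases "Suc k < M")
      case True
      then obtain b where b: "t1 \<le> b" "(\<forall>x>b. 0 \<le> ?h (Suc (Suc k)) x) \<or> (\<forall>x>b. ?h (Suc (Suc k)) x \<le> 0)"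
        using sign[of "M - Suc (Suc k)"] by auto
      have m: "mono_on {b<..} (?h (Suc k)) \<or> antimono_on {b<..} (?h (Suc k))"
        by (rule eventually_one_sign_antiderivative(1)[OF _ b(2)])
          (use deriv[of "Suc k"] True b(1) t1 in simp)
      have "x * \<bar>?h (Suc k) x\<bar> \<le> 3 * (\<bar>?h k (2 * x)\<bar> + \<bar>?h k x\<bar> + \<bar>?h k (x / 2)\<bar>)" if "max 1 (2 * \<bar>b\<bar> + 1) \<le> x" for x
        by (rule monotone_derivative_bound[OF _ m]) (use deriv[of k] Suc.prems b(1) t1 that in auto)
      then show ?thesis unfolding eventually_at_top_linorder by blast
    next
      case False
      then have M: "M = Suc k" using Suc.prems by simp
      \<comment> \<open>the top derivative may be ultimately negative; \<open>\<sigma>\<close> normalises its sign\<close>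
      define \<sigma> :: real where "\<sigma> = (if \<forall>t>t1. ?h M t > 0 then 1 else -1)"
      have \<sigma>: "0 < \<sigma> * ?h M x" if "t1 < x" for x using sgn1 that by (auto simp: \<sigma>_def)
      have \<sigma>1: "\<bar>\<sigma>\<bar> = 1" by (simp add: \<sigma>_def)
      have "\<exists>C. \<forall>\<^sub>F x in at_top. x * (\<sigma> * ?h M x) \<le> C * (\<sigma> * ?h k (2 * x) - \<sigma> * ?h k x)"
      proof (rule regularly_varying_le_integral)
        show "((\<lambda>t. \<sigma> * ?h M (c * t) / (\<sigma> * ?h M t)) \<longlongrightarrow> c powr (\<rho> - real M)) at_top" if "0 < c" for c
          using lim[OF that] by (simp add: \<sigma>_def)
        show "continuous_on {t1<..} (\<lambda>x. \<sigma> * ?h M x)"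
          using t1 by (intro continuous_intros continuous_on_subset[OF cont]) auto
        show "((\<lambda>x. \<sigma> * ?h k x) has_real_derivative \<sigma> * ?h M x) (at x)" if "t1 < x" for x
          using deriv[of k x] that t1 unfolding M by (intro DERIV_cmult) auto
      qed (rule \<sigma>)
      then obtain A where "\<forall>\<^sub>F x in at_top. x * (\<sigma> * ?h M x) \<le> A * (\<sigma> * ?h k (2 * x) - \<sigma> * ?h k x)" by blast
      moreover have "\<forall>\<^sub>F x in at_top. max 1 t1 < x" by (rule eventually_gt_at_top)
      ultimately have "\<forall>\<^sub>F x in at_top. x * \<bar>?h (Suc k) x\<bar> \<le> \<bar>A\<bar> * (\<bar>?h k (2 * x)\<bar> + \<bar>?h k x\<bar> + \<bar>?h k (x / 2)\<bar>)"
      proof eventually_elim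
        case (elim x)
        have "\<bar>?h M x\<bar> = \<bar>\<sigma> * ?h M x\<bar>" using \<sigma>1 by (simp add: abs_mult)
        also have "\<dots> = \<sigma> * ?h M x" using \<sigma>[of x] elim by simp
        finally have "x * \<bar>?h M x\<bar> \<le> A * (\<sigma> * ?h k (2 * x) - \<sigma> * ?h k x)" using elim by simp
        also have "\<dots> \<le> \<bar>A\<bar> * \<bar>\<sigma> * ?h k (2 * x) - \<sigma> * ?h k x\<bar>"
          by (metis abs_ge_self abs_mult)
        also have "\<bar>\<sigma> * ?h k (2 * x) - \<sigma> * ?h k x\<bar> = \<bar>?h k (2 * x) - ?h k x\<bar>"
          using \<sigma>1 by (simp add: abs_mult flip: right_diff_distrib)
        also have "\<bar>A\<bar> * \<bar>?h k (2 * x) - ?h k x\<bar> \<le> \<bar>A\<bar> * (\<bar>?h k (2 * x)\<bar> + \<bar>?h k x\<bar> + \<bar>?h k (x / 2)\<bar>)"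
          by (intro mult_left_mono) auto
        finally show ?case unfolding M .
      qed
      then show ?thesis by blast
    qed
    then obtain A where "\<forall>\<^sub>F x in at_top. x * \<bar>?h (Suc k) x\<bar> \<le> A * (\<bar>?h k (2 * x)\<bar> + \<bar>?h k x\<bar> + \<bar>?h k (x / 2)\<bar>)" by blast
    then show ?case by (rule derivative_scale_step[OF anti pos half B])
  qed
qed

section \<open>Taylor expansion of truncated expectations\<close>

lemma abs_divide_fact_le: "\<bar>z / fact k\<bar> \<le> \<bar>z\<bar>" for z :: real
  using mult_left_mono[OF fact_ge_1[of k, where 'a=real], of "\<bar>z\<bar>"]
  by (simp add: abs_divide divide_le_eq)

text \<open>Two Taylor expansions of the same remainder: stopping at order \<open>n - 1\<close> gives a bound of order \<open>\<bar>y\<bar> ^ n\<close>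
which is integrable when the \<open>n\<close>-th moment is finite, and going to order \<open>n\<close> gives the additional factor
\<open>\<bar>y\<bar> / x\<close> which tends to 0.\<close>

lemma Taylor_remainder_bounds:
  fixes g :: "nat \<Rightarrow> real \<Rightarrow> real"
  assumes deriv: "\<And>i z. i \<le> n \<Longrightarrow> x / 2 \<le> z \<Longrightarrow> (g i has_real_derivative g (Suc i) z) (at z)"
    and bN: "\<And>z. x / 2 \<le> z \<Longrightarrow> \<bar>g n z\<bar> \<le> B"
    and bS: "\<And>z. x / 2 \<le> z \<Longrightarrow> \<bar>g (Suc n) z\<bar> \<le> B / x"
    and x: "0 < x" and y: "y \<le> x / 2"
  shows "\<bar>g 0 (x - y) - (\<Sum>j\<le>n. (- y) ^ j / fact j * g j x)\<bar> \<le> 2 * B * \<bar>y\<bar> ^ n * min 1 (\<bar>y\<bar> / x)"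
proof (cases "y = 0")
  case True
  have "(\<Sum>j\<le>n. (- y) ^ j / fact j * g j x) = (\<Sum>j\<le>n. if j = 0 then g 0 x else 0)"
    by (rule sum.cong) (auto simp: True)
  then show ?thesis by (simp add: True)
next
  case False
  let ?R = "g 0 (x - y) - (\<Sum>j\<le>n. (- y) ^ j / fact j * g j x)"
  have B: "0 \<le> B" using bN[of x] x by simp
  define a where "a = min x (x - y)"
  define b where "b = max x (x - y)"
  have ab: "x / 2 \<le> a" using x y by (simp add: a_def)
  have expand: "\<exists>t. x / 2 \<le> t \<and> g 0 (x - y) = (\<Sum>j<k. (- y) ^ j / fact j * g j x) + g k t / fact k * (- y) ^ k"
    if k: "0 < k" "k \<le> Suc n" for k
  proof -
    have "\<exists>t. (if x - y < x then x - y < t \<and> t < x else x < t \<and> t < x - y) \<and>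
        g 0 (x - y) = (\<Sum>m<k. g m x / fact m * (x - y - x) ^ m) + g k t / fact k * (x - y - x) ^ k"
    proof (rule Taylor[where a=a and b=b])
      show "\<forall>i t. i < k \<and> a \<le> t \<and> t \<le> b \<longrightarrow> DERIV (g i) t :> g (Suc i) t"
      proof (intro allI impI deriv)
        fix i t assume "i < k \<and> a \<le> t \<and> t \<le> b"
        then show "i \<le> n" "x / 2 \<le> t" using k ab by linarith+
      qed
    qed (use k False in \<open>simp_all add: a_def b_def\<close>)
    then obtain t where t: "if x - y < x then x - y < t \<and> t < x else x < t \<and> t < x - y"
        "g 0 (x - y) = (\<Sum>m<k. g m x / fact m * (x - y - x) ^ m) + g k t / fact k * (x - y - x) ^ k" by blast
    have "x / 2 \<le> t" using t(1) x y by (auto split: if_splits)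
    moreover have "(\<Sum>m<k. g m x / fact m * (x - y - x) ^ m) = (\<Sum>m<k. (- y) ^ m / fact m * g m x)"
      by (intro sum.cong refl) simp
    ultimately show ?thesis using t(2) by (intro exI[of _ t]) simp
  qed
  have r1: "\<bar>?R\<bar> \<le> \<bar>y\<bar> ^ n * (\<bar>y\<bar> / x) * B"
  proof -
    obtain t where t: "x / 2 \<le> t" "g 0 (x - y) = (\<Sum>j<Suc n. (- y) ^ j / fact j * g j x) + g (Suc n) t / fact (Suc n) * (- y) ^ Suc n"
      using expand[of "Suc n"] by auto
    then have "\<bar>?R\<bar> = \<bar>g (Suc n) t / fact (Suc n)\<bar> * \<bar>y\<bar> ^ Suc n"
      by (simp add: lessThan_Suc_atMost abs_mult power_abs del: fact_Suc power_Suc)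
    also have "\<dots> \<le> (B / x) * \<bar>y\<bar> ^ Suc n"
      by (intro mult_right_mono order_trans[OF abs_divide_fact_le bS[OF t(1)]]) auto
    finally show ?thesis by (simp add: mult.commute)
  qed
  have r2: "\<bar>?R\<bar> \<le> 2 * B * \<bar>y\<bar> ^ n"
  proof (cases "n = 0")
    case True
    have "\<bar>g 0 (x - y)\<bar> \<le> B" "\<bar>g 0 x\<bar> \<le> B" using bN[of "x - y"] bN[of x] x y True by auto
    then show ?thesis by (simp add: True)
  next
    case n: False
    then obtain t where t: "x / 2 \<le> t" "g 0 (x - y) = (\<Sum>j<n. (- y) ^ j / fact j * g j x) + g n t / fact n * (- y) ^ n"
      using expand[of n] by auto
    have "?R = g n t / fact n * (- y) ^ n - (- y) ^ n / fact n * g n x"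
      unfolding t(2) by (simp flip: lessThan_Suc_atMost)
    also have "\<bar>\<dots>\<bar> \<le> \<bar>g n t / fact n * (- y) ^ n\<bar> + \<bar>(- y) ^ n / fact n * g n x\<bar>" by (rule abs_triangle_ineq4)
    also have "\<dots> = (\<bar>g n t / fact n\<bar> + \<bar>g n x / fact n\<bar>) * \<bar>y\<bar> ^ n"
      by (simp add: abs_mult power_abs algebra_simps)
    also have "\<dots> \<le> (B + B) * \<bar>y\<bar> ^ n"
      by (intro mult_right_mono add_mono order_trans[OF abs_divide_fact_le bN] t(1)) (use x in auto)
    finally show ?thesis by simp
  qed
  have "\<bar>y\<bar> ^ n * (\<bar>y\<bar> / x) * B \<le> 2 * B * \<bar>y\<bar> ^ n * (\<bar>y\<bar> / x)"
  proof -
    have "0 \<le> \<bar>y\<bar> ^ n * (\<bar>y\<bar> / x) * B" using B x by simp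
    moreover have "2 * B * \<bar>y\<bar> ^ n * (\<bar>y\<bar> / x) = 2 * (\<bar>y\<bar> ^ n * (\<bar>y\<bar> / x) * B)" by (simp add: ac_simps)
    ultimately show ?thesis by linarith
  qed
  then show ?thesis using r1 r2 by (auto simp: min_def)
qed

lemma integrable_power_le:
  fixes n j :: nat and M :: "real measure"
  assumes "finite_measure M" and [measurable_cong]: "sets M = sets borel"
    and mom: "integrable M (\<lambda>y. \<bar>y\<bar> ^ n)" and j: "j \<le> n"
  shows "integrable M (\<lambda>y. y ^ j)"
proof (rule Bochner_Integration.integrable_bound[where f="\<lambda>y. 1 + \<bar>y\<bar> ^ n"])
  show "AE y in M. norm (y ^ j) \<le> norm (1 + \<bar>y\<bar> ^ n)"
  proof (rule AE_I2)
    fix y :: real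
    have "\<bar>y\<bar> ^ j \<le> 1 + \<bar>y\<bar> ^ n"
    proof (cases "\<bar>y\<bar> \<le> 1")
      case True
      then have "\<bar>y\<bar> ^ j \<le> 1" by (intro power_le_one) auto
      then show ?thesis by (smt (verit) zero_le_power abs_ge_zero)
    next
      case False
      then have "1 \<le> \<bar>y\<bar>" by linarith
      from power_increasing[OF j this] show ?thesis by linarith
    qed
    then show "norm (y ^ j) \<le> norm (1 + \<bar>y\<bar> ^ n)" by (simp add: power_abs)
  qed
qed (use mom assms(1) in \<open>auto simp: finite_measure.integrable_const\<close>)

text \<open>Dominated convergence with the two bounds above: the \<open>n\<close>-th moment suffices for an expansion of order
\<open>n\<close> with error \<open>o(w x)\<close>. The polynomial is integrated over the whole line although \<open>y\<close> is restricted to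
\<open>y \<le> x/2\<close>; on \<open>y > x/2\<close> it is itself \<open>O(\<bar>y\<bar> ^ n * w x)\<close>.\<close>

lemma Taylor_expectation:
  fixes g :: "nat \<Rightarrow> real \<Rightarrow> real" and \<mu> :: "real measure"
  assumes \<mu>: "prob_space \<mu>" and sets [measurable_cong]: "sets \<mu> = sets borel"
    and mom: "integrable \<mu> (\<lambda>y. \<bar>y\<bar> ^ n)"
    and deriv: "\<And>i z. i \<le> n \<Longrightarrow> b \<le> 2 * z \<Longrightarrow> (g i has_real_derivative g (Suc i) z) (at z)"
    and bN: "\<And>x z. b \<le> x \<Longrightarrow> x / 2 \<le> z \<Longrightarrow> \<bar>g n z\<bar> \<le> C * w x"
    and bS: "\<And>x z. b \<le> x \<Longrightarrow> x / 2 \<le> z \<Longrightarrow> \<bar>g (Suc n) z\<bar> \<le> C * w x / x"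
    and bj: "\<And>x j. b \<le> x \<Longrightarrow> j \<le> n \<Longrightarrow> \<bar>g j x\<bar> \<le> C * x ^ (n - j) * w x"
    and b: "0 < b" and w: "\<And>x. b \<le> x \<Longrightarrow> 0 < w x"
  shows "\<And>x. b \<le> x \<Longrightarrow> set_integrable \<mu> {..x/2} (\<lambda>y. g 0 (x - y))"
    and "((\<lambda>x. ((LINT y:{..x/2}|\<mu>. g 0 (x - y)) -
        (\<Sum>j\<le>n. (- 1) ^ j / fact j * (\<integral>y. y ^ j \<partial>\<mu>) * g j x)) / w x) \<longlongrightarrow> 0) at_top"
proof -
  interpret \<mu>: prob_space \<mu> by (rule \<mu>)
  note momj = integrable_power_le[OF \<mu>.finite_measure_axioms sets mom]
  define P where "P x y = (\<Sum>j\<le>n. (- y) ^ j / fact j * g j x)" for x y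
  have P_eq: "P x = (\<lambda>y. \<Sum>j\<le>n. (- 1) ^ j / fact j * g j x * y ^ j)" for x
    unfolding P_def by (intro ext sum.cong refl) (subst power_minus, simp)
  have Pint: "integrable \<mu> (P x)" for x
    unfolding P_eq using momj by (intro Bochner_Integration.integrable_sum integrable_mult_right) auto
  have PE: "(\<integral>y. P x y \<partial>\<mu>) = (\<Sum>j\<le>n. (- 1) ^ j / fact j * (\<integral>y. y ^ j \<partial>\<mu>) * g j x)" for x
    unfolding P_eq using momj
    by (subst Bochner_Integration.integral_sum) (auto intro!: integrable_mult_right sum.cong)
  have [measurable]: "(\<lambda>y. indicat_real {..x/2} y * g 0 (x - y)) \<in> borel_measurable borel" if "b \<le> x" for x
  proof -
    have "continuous_on {..x/2} (\<lambda>y. g 0 (x - y))"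
    proof (rule continuous_on_compose2[of "{x/2..}" "g 0"])
      show "continuous_on {x/2..} (g 0)"
        using that by (intro continuous_at_imp_continuous_on ballI DERIV_isCont[OF deriv]) auto
    qed (auto intro!: continuous_intros)
    from borel_measurable_continuous_on_indicator[OF _ this] show ?thesis by simp
  qed
  define D where "D x y = indicat_real {..x/2} y * g 0 (x - y) - P x y" for x y
  define K where "K = 2 * C + (\<Sum>j\<le>n. C * 2 ^ (n - j))"
  have C: "0 \<le> C"
  proof -
    have "0 \<le> C * w b" using bN[of b b] b by (simp add: order_trans[OF abs_ge_zero])
    then show ?thesis using w[of b] by (simp add: zero_le_mult_iff)
  qed
  have K: "0 \<le> K" using C unfolding K_def by (intro add_nonneg_nonneg sum_nonneg) auto
  have D_small: "\<bar>D x y\<bar> \<le> 2 * C * w x * \<bar>y\<bar> ^ n * min 1 (\<bar>y\<bar> / x)" if "b \<le> x" "y \<le> x / 2" for x y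
  proof -
    have "\<bar>g 0 (x - y) - P x y\<bar> \<le> 2 * (C * w x) * \<bar>y\<bar> ^ n * min 1 (\<bar>y\<bar> / x)"
      unfolding P_def by (rule Taylor_remainder_bounds[OF deriv bN bS]) (use that b in linarith)+
    then show ?thesis using that by (simp add: D_def)
  qed
  have D_large: "\<bar>D x y\<bar> \<le> (\<Sum>j\<le>n. C * 2 ^ (n - j)) * w x * \<bar>y\<bar> ^ n" if "b \<le> x" "x / 2 < y" for x y
  proof -
    have y: "0 < x" "0 < y" using that b by linarith+
    have "\<bar>P x y\<bar> \<le> (\<Sum>j\<le>n. \<bar>(- y) ^ j / fact j * g j x\<bar>)" unfolding P_def by (rule sum_abs)
    also have "\<dots> \<le> (\<Sum>j\<le>n. C * 2 ^ (n - j) * (w x * \<bar>y\<bar> ^ n))"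
    proof (rule sum_mono)
      fix j assume "j \<in> {..n}"
      then have j: "j \<le> n" by simp
      have "\<bar>(- y) ^ j / fact j * g j x\<bar> = \<bar>y\<bar> ^ j / fact j * \<bar>g j x\<bar>"
        by (simp add: abs_mult power_abs)
      also have "\<dots> \<le> \<bar>y\<bar> ^ j * (C * x ^ (n - j) * w x)"
        using abs_divide_fact_le[of "\<bar>y\<bar> ^ j" j] bj[OF that(1) j] by (intro mult_mono) auto
      also have "\<dots> \<le> \<bar>y\<bar> ^ j * (C * (2 * y) ^ (n - j) * w x)"
        using that y C w[OF that(1)] by (intro mult_left_mono mult_right_mono power_mono) auto
      also have "\<dots> = C * 2 ^ (n - j) * (w x * (\<bar>y\<bar> ^ j * \<bar>y\<bar> ^ (n - j)))"
        using y by (simp add: power_mult_distrib)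
      also have "\<bar>y\<bar> ^ j * \<bar>y\<bar> ^ (n - j) = \<bar>y\<bar> ^ n" using j by (simp flip: power_add)
      finally show "\<bar>(- y) ^ j / fact j * g j x\<bar> \<le> C * 2 ^ (n - j) * (w x * \<bar>y\<bar> ^ n)" .
    qed
    also have "\<dots> = (\<Sum>j\<le>n. C * 2 ^ (n - j)) * w x * \<bar>y\<bar> ^ n" by (simp add: sum_distrib_right mult.assoc)
    finally show ?thesis using that by (simp add: D_def)
  qed
  have D_bound: "\<bar>D x y\<bar> \<le> K * \<bar>y\<bar> ^ n * w x" if "b \<le> x" for x y
  proof (cases "y \<le> x / 2")
    case True
    have "\<bar>D x y\<bar> \<le> 2 * C * w x * \<bar>y\<bar> ^ n * 1"
      using C w[OF that] by (intro order_trans[OF D_small[OF that True] mult_left_mono]) auto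
    also have "\<dots> \<le> K * \<bar>y\<bar> ^ n * w x"
    proof -
      have "2 * C * (w x * \<bar>y\<bar> ^ n) \<le> K * (w x * \<bar>y\<bar> ^ n)"
        using C w[OF that] unfolding K_def by (intro mult_right_mono) (auto intro!: sum_nonneg)
      then show ?thesis by (simp add: ac_simps)
    qed
    finally show ?thesis .
  next
    case False
    have "\<bar>D x y\<bar> \<le> (\<Sum>j\<le>n. C * 2 ^ (n - j)) * (w x * \<bar>y\<bar> ^ n)"
      using D_large[OF that] False by (simp add: mult.assoc)
    also have "\<dots> \<le> K * (w x * \<bar>y\<bar> ^ n)"
      using C w[OF that] unfolding K_def by (intro mult_right_mono) auto
    finally show ?thesis by (simp add: ac_simps)
  qed
  have Dmeas: "D x \<in> borel_measurable \<mu>" if "b \<le> x" for x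
    using that Pint[of x] unfolding D_def by (intro borel_measurable_diff) auto
  have Dint: "integrable \<mu> (D x)" if "b \<le> x" for x
  proof (rule Bochner_Integration.integrable_bound[where f="\<lambda>y. K * \<bar>y\<bar> ^ n * w x"])
    show "integrable \<mu> (\<lambda>y. K * \<bar>y\<bar> ^ n * w x)" using mom by simp
    show "AE y in \<mu>. norm (D x y) \<le> norm (K * \<bar>y\<bar> ^ n * w x)"
      using D_bound[OF that] by (intro AE_I2) (simp add: order_trans[OF _ abs_ge_self])
  qed (rule Dmeas[OF that])
  have gint: "integrable \<mu> (\<lambda>y. indicat_real {..x/2} y * g 0 (x - y))" if "b \<le> x" for x
  proof -
    have "(\<lambda>y. indicat_real {..x/2} y * g 0 (x - y)) = (\<lambda>y. D x y + P x y)" by (simp add: D_def)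
    then show ?thesis using Dint[OF that] Pint[of x] by simp
  qed
  then show "\<And>x. b \<le> x \<Longrightarrow> set_integrable \<mu> {..x/2} (\<lambda>y. g 0 (x - y))"
    by (simp add: set_integrable_def)
  \<comment> \<open>measurability is needed at every argument, hence the cut-off at \<open>b\<close>\<close>
  define E where "E x y = D (max b x) y / w (max b x)" for x y
  have "((\<lambda>x. integral\<^sup>L \<mu> (E x)) \<longlongrightarrow> integral\<^sup>L \<mu> (\<lambda>_. 0)) at_top"
  proof (rule integral_dominated_convergence_at_top[where w="\<lambda>y. K * \<bar>y\<bar> ^ n"])
    show "integrable \<mu> (\<lambda>y. K * \<bar>y\<bar> ^ n)" using mom by simp
    show "\<forall>\<^sub>F x in at_top. AE y in \<mu>. norm (E x y) \<le> K * \<bar>y\<bar> ^ n"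
    proof (intro always_eventually allI AE_I2)
      fix x y :: real
      show "norm (E x y) \<le> K * \<bar>y\<bar> ^ n"
        using D_bound[of "max b x" y] w[of "max b x"] unfolding E_def by (simp add: divide_le_eq abs_of_pos)
    qed
    show "AE y in \<mu>. ((\<lambda>x. E x y) \<longlongrightarrow> 0) at_top"
    proof (rule AE_I2)
      fix y
      have lim: "((\<lambda>x. 2 * C * \<bar>y\<bar> ^ n * (\<bar>y\<bar> / x)) \<longlongrightarrow> 0) at_top"
        by (rule tendsto_mult_right_zero[OF real_tendsto_divide_at_top[OF tendsto_const filterlim_ident]])
      have "\<forall>\<^sub>F x in at_top. norm (E x y) \<le> 2 * C * \<bar>y\<bar> ^ n * (\<bar>y\<bar> / x)"
        using eventually_ge_at_top[of "max b (2 * y)"]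
      proof eventually_elim
        case (elim x)
        then have x: "b \<le> x" "y \<le> x / 2" "max b x = x" by auto
        have "\<bar>D x y\<bar> \<le> 2 * C * w x * \<bar>y\<bar> ^ n * min 1 (\<bar>y\<bar> / x)" by (rule D_small) (use x in auto)
        also have "\<dots> \<le> 2 * C * w x * \<bar>y\<bar> ^ n * (\<bar>y\<bar> / x)"
          using C w[OF x(1)] by (intro mult_left_mono) auto
        finally have "\<bar>D x y\<bar> / w x \<le> 2 * C * w x * \<bar>y\<bar> ^ n * (\<bar>y\<bar> / x) / w x"
          using w[OF x(1)] by (intro divide_right_mono) auto
        also have "2 * C * w x * \<bar>y\<bar> ^ n * (\<bar>y\<bar> / x) / w x = 2 * C * \<bar>y\<bar> ^ n * (\<bar>y\<bar> / x)"
          using less_imp_neq[OF w[OF x(1)]] by (simp del: times_divide_eq_right times_divide_eq_left)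
        finally have "norm (D x y / w x) \<le> 2 * C * \<bar>y\<bar> ^ n * (\<bar>y\<bar> / x)"
          by (simp only: real_norm_def abs_divide abs_of_pos[OF w[OF x(1)]])
        then show ?case by (simp only: E_def x(3))
      qed
      then show "((\<lambda>x. E x y) \<longlongrightarrow> 0) at_top" using lim by (rule Lim_null_comparison)
    qed
    show "E x \<in> borel_measurable \<mu>" for x
      unfolding E_def by (rule borel_measurable_divide[OF Dmeas borel_measurable_const]) simp
    show "(\<lambda>_. 0) \<in> borel_measurable \<mu>" by (rule borel_measurable_const)
  qed
  then have lim: "((\<lambda>x. \<integral>y. E x y \<partial>\<mu>) \<longlongrightarrow> 0) at_top"
    by (simp only: Bochner_Integration.integral_zero)
  have "\<forall>\<^sub>F x in at_top. (\<integral>y. E x y \<partial>\<mu>) = ((LINT y:{..x/2}|\<mu>. g 0 (x - y)) -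
        (\<Sum>j\<le>n. (- 1) ^ j / fact j * (\<integral>y. y ^ j \<partial>\<mu>) * g j x)) / w x"
    using eventually_ge_at_top[of b]
  proof eventually_elim
    case (elim x)
    have "(\<integral>y. D x y \<partial>\<mu>) = (\<integral>y. indicat_real {..x/2} y * g 0 (x - y) \<partial>\<mu>) - (\<integral>y. P x y \<partial>\<mu>)"
      unfolding D_def using gint[OF elim] Pint by (rule Bochner_Integration.integral_diff)
    then show ?case using elim by (simp add: E_def PE set_lebesgue_integral_def max_absorb2)
  qed
  from lim this show "((\<lambda>x. ((LINT y:{..x/2}|\<mu>. g 0 (x - y)) -
        (\<Sum>j\<le>n. (- 1) ^ j / fact j * (\<integral>y. y ^ j \<partial>\<mu>) * g j x)) / w x) \<longlongrightarrow> 0) at_top"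
    by (rule Lim_transform_eventually)
qed

section \<open>Barriers and the maximum principle\<close>

text \<open>If \<open>D\<close> had a positive supremum \<open>K\<close>, it would be nearly attained in a bounded interval, where averaging
cannot exceed \<open>K\<close> and the slack \<open>s\<close> is bounded away from 0. The supremum itself need not be attained,
as \<open>D\<close> is not assumed continuous.\<close>

lemma maximum_principle:
  fixes D :: "real \<Rightarrow> real" and \<mu> :: "real measure"
  assumes \<mu>: "prob_space \<mu>" and sets [measurable_cong]: "sets \<mu> = sets borel" and a: "0 < a"
    and sub: "\<And>x. a \<le> x \<Longrightarrow> D x \<le> (LINT y:{..x/2}|\<mu>. D (x - y)) - s x"
    and int: "\<And>x. a \<le> x \<Longrightarrow> set_integrable \<mu> {..x/2} (\<lambda>y. D (x - y))"
    and start: "\<And>x. a / 2 \<le> x \<Longrightarrow> x \<le> a \<Longrightarrow> D x \<le> 0"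
    and inf: "\<And>e. 0 < e \<Longrightarrow> \<forall>\<^sub>F x in at_top. D x < e"
    and bdd: "\<And>x. a / 2 \<le> x \<Longrightarrow> D x \<le> B"
    and s: "\<And>b. a \<le> b \<Longrightarrow> \<exists>\<delta>>0. \<forall>x\<in>{a..b}. \<delta> \<le> s x"
    and x: "a / 2 \<le> x"
  shows "D x \<le> 0"
proof (rule ccontr)
  assume "\<not> D x \<le> 0"
  interpret \<mu>: prob_space \<mu> by (rule \<mu>)
  define K where "K = Sup (D ` {a/2..})"
  have bdda: "bdd_above (D ` {a/2..})" using bdd by (intro bdd_aboveI2[of _ _ B]) auto
  have DK: "D z \<le> K" if "a / 2 \<le> z" for z
    unfolding K_def using that by (intro cSup_upper bdda) auto
  have K: "0 < K" using DK[OF x] \<open>\<not> D x \<le> 0\<close> by simp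
  obtain b0 where b0: "\<And>z. b0 \<le> z \<Longrightarrow> D z < K / 2"
    using inf[of "K / 2"] K unfolding eventually_at_top_linorder by auto
  define b where "b = max a b0"
  obtain \<delta> where \<delta>: "0 < \<delta>" "\<And>z. z \<in> {a..b} \<Longrightarrow> \<delta> \<le> s z" using s[of b] by (auto simp: b_def)
  have "K - min \<delta> (K / 2) < Sup (D ` {a/2..})" using K \<delta> by (simp add: K_def[symmetric])
  then obtain z where z: "a / 2 \<le> z" "K - min \<delta> (K / 2) < D z"
    using less_cSup_iff[OF _ bdda] by auto
  then have "a < z" using start[of z] K \<delta> by (cases "z \<le> a") auto
  moreover have "z < b0" using b0[of z] z by (cases "b0 \<le> z") auto
  ultimately have zb: "z \<in> {a..b}" by (simp add: b_def)
  have "D z \<le> (LINT y:{..z/2}|\<mu>. D (z - y)) - s z" using sub \<open>a < z\<close> by simp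
  also have "(LINT y:{..z/2}|\<mu>. D (z - y)) \<le> (LINT y|\<mu>. K)"
    unfolding set_lebesgue_integral_def
  proof (rule integral_mono)
    show "integrable \<mu> (\<lambda>y. indicat_real {..z/2} y *\<^sub>R D (z - y))"
      using int[of z] \<open>a < z\<close> by (simp add: set_integrable_def)
    show "indicat_real {..z/2} y *\<^sub>R D (z - y) \<le> K" for y
      using DK[of "z - y"] K \<open>a < z\<close> by (auto split: split_indicator)
  qed simp
  finally have "D z \<le> K - \<delta>" using \<delta>(2)[OF zb] \<mu>.prob_space by simp
  then show False using z by simp
qed

text \<open>In the application \<open>h\<close> is the tail of the step law and \<open>g k\<close> is the \<open>k\<close>-th derivative of \<open>D_inv h\<close>, so
that \<open>g 0\<close> is minus the integrated tail. The bounds on \<open>g\<close> hold on \<open>b / 2 \<le> x\<close> because they are used at the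
points \<open>x - y\<close> with \<open>b \<le> x\<close> and \<open>y \<le> x / 2\<close>.\<close>

locale tail_derivatives =
  fixes h :: "real \<Rightarrow> real" and g :: "nat \<Rightarrow> real \<Rightarrow> real" and m :: nat and b C :: real
  assumes m: "1 \<le> m" and b: "1 \<le> b" and C: "1 \<le> C"
    and anti: "antimono h" and pos: "\<And>x. 0 < h x"
    and half: "\<And>x. b \<le> x \<Longrightarrow> h (x / 2) \<le> C * h x"
    and g_1: "\<And>x. b \<le> 2 * x \<Longrightarrow> g 1 x = h x"
    and deriv: "\<And>i x. i \<le> m \<Longrightarrow> b \<le> 2 * x \<Longrightarrow> (g i has_real_derivative g (Suc i) x) (at x)"
    and scale: "\<And>i x. i \<le> Suc m \<Longrightarrow> b \<le> 2 * x \<Longrightarrow> \<bar>g i x\<bar> \<le> C * (x * h x / x ^ i)"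
    and lower: "\<And>x. b \<le> 2 * x \<Longrightarrow> x * h x \<le> C * (- g 0 x)"
    and measurable_g_0 [measurable]: "g 0 \<in> borel_measurable borel"
begin

lemma weight_le:
  assumes "b \<le> x" "x / 2 \<le> z"
  shows "h z / z ^ k \<le> C * 2 ^ k * (h x / x ^ k)"
proof -
  have x: "0 < x" using assms b by simp
  have "h z / z ^ k \<le> h (x / 2) / (x / 2) ^ k"
    using assms x pos[of "x / 2"] by (intro frac_le antimonoD[OF anti] power_mono) (auto intro: less_imp_le)
  also have "\<dots> \<le> (C * h x) / (x / 2) ^ k"
    using half[OF assms(1)] x by (intro divide_right_mono) auto
  also have "\<dots> = C * 2 ^ k * (h x / x ^ k)" by (simp add: power_divide)
  finally show ?thesis .
qed

lemma scale_Suc: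
  assumes "i \<le> m" "b \<le> 2 * z"
  shows "\<bar>g (Suc i) z\<bar> \<le> C * (h z / z ^ i)"
  using scale[of "Suc i" z] assms b by simp

lemma Taylor_g:
  fixes \<mu> :: "real measure"
  assumes \<mu>: "prob_space \<mu>" "sets \<mu> = sets borel"
    and k: "k \<le> m" and mom: "integrable \<mu> (\<lambda>y. \<bar>y\<bar> ^ (m - k))"
  shows "\<And>x. b \<le> x \<Longrightarrow> set_integrable \<mu> {..x/2} (\<lambda>y. g k (x - y))"
    and "((\<lambda>x. ((LINT y:{..x/2}|\<mu>. g k (x - y)) -
        (\<Sum>j\<le>m - k. (- 1) ^ j / fact j * (\<integral>y. y ^ j \<partial>\<mu>) * g (k + j) x)) / (h x / x ^ (m - 1))) \<longlongrightarrow> 0) at_top"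
proof -
  define K where "K = C * (C * 2 ^ m)"
  have CK: "C \<le> K" "0 \<le> K"
  proof -
    have "1 * 1 \<le> C * 2 ^ m" using C by (intro mult_mono) auto
    then have "C * 1 \<le> C * (C * 2 ^ m)" using C by (intro mult_left_mono) auto
    then show "C \<le> K" "0 \<le> K" using C by (auto simp: K_def)
  qed
  have w: "\<bar>g (Suc i) z\<bar> \<le> K * (h x / x ^ i)" if "i \<le> m" "b \<le> x" "x / 2 \<le> z" for i x z
  proof -
    have x: "0 < x" using that b by simp
    have "\<bar>g (Suc i) z\<bar> \<le> C * (h z / z ^ i)" using that by (intro scale_Suc) auto
    also have "\<dots> \<le> C * (C * 2 ^ i * (h x / x ^ i))" using C that by (intro mult_left_mono weight_le) auto
    also have "\<dots> \<le> C * (C * 2 ^ m * (h x / x ^ i))"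
      using C that pos[of x] x by (intro mult_left_mono mult_right_mono power_increasing) auto
    finally show ?thesis by (simp add: K_def mult.assoc)
  qed
  have A1: "(g (k + i) has_real_derivative g (k + Suc i) z) (at z)" if "i \<le> m - k" "b \<le> 2 * z" for i z
    using deriv[of "k + i" z] that k by simp
  have A2: "\<bar>g (k + (m - k)) z\<bar> \<le> K * (h x / x ^ (m - 1))" if "b \<le> x" "x / 2 \<le> z" for x z
    using w[of "m - 1" x z] that k m by simp
  have A3: "\<bar>g (k + Suc (m - k)) z\<bar> \<le> K * (h x / x ^ (m - 1)) / x" if "b \<le> x" "x / 2 \<le> z" for x z
  proof -
    have eq: "K * (h x / x ^ m) = K * (h x / x ^ (m - 1)) / x"
      using m power_minus_mult[of m x] by (simp add: divide_divide_eq_left mult.commute)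
    have kk: "k + Suc (m - k) = Suc m" using k by simp
    show ?thesis unfolding kk eq[symmetric] using w[of m x z] that by simp
  qed
  have A4: "\<bar>g (k + j) x\<bar> \<le> K * x ^ (m - k - j) * (h x / x ^ (m - 1))" if "b \<le> x" "j \<le> m - k" for x j
  proof -
    have x: "0 < x" using that b by simp
    have "\<bar>g (k + j) x\<bar> \<le> C * (x * h x / x ^ (k + j))"
      using that k b by (intro scale) auto
    also have "\<dots> \<le> K * (x * h x / x ^ (k + j))" using CK x pos[of x] by (intro mult_right_mono) auto
    also have "x * h x / x ^ (k + j) = x ^ (m - k - j) * (h x / x ^ (m - 1))"
    proof -
      have "x * x ^ (m - 1) = x ^ (m - k - j) * x ^ (k + j)"
        using m k that by (simp flip: power_Suc power_add)
      then show ?thesis using x by (simp add: field_simps)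
    qed
    finally show ?thesis by (simp add: mult.assoc)
  qed
  have A5: "0 < h x / x ^ (m - 1)" if "b \<le> x" for x using pos[of x] that b by simp
  have A6: "0 < b" using b by simp
  note T = Taylor_expectation[where g="\<lambda>i. g (k + i)" and w="\<lambda>x. h x / x ^ (m - 1)" and n="m - k",
      OF \<mu> mom A1 A2 A3 A4 A6 A5]
  show "\<And>x. b \<le> x \<Longrightarrow> set_integrable \<mu> {..x/2} (\<lambda>y. g k (x - y))" using T(1) by simp
  show "((\<lambda>x. ((LINT y:{..x/2}|\<mu>. g k (x - y)) -
        (\<Sum>j\<le>m - k. (- 1) ^ j / fact j * (\<integral>y. y ^ j \<partial>\<mu>) * g (k + j) x)) / (h x / x ^ (m - 1))) \<longlongrightarrow> 0) at_top"
    using T(2) by simp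
qed

definition barrier :: "nat \<Rightarrow> real \<Rightarrow> real" where
  "barrier r x = - g 0 x / x ^ r"

lemma measurable_barrier [measurable]: "barrier r \<in> borel_measurable borel"
  unfolding barrier_def by measurable

lemma barrier_pos: "b \<le> 2 * x \<Longrightarrow> 0 < barrier r x"
proof -
  assume x: "b \<le> 2 * x"
  have "0 < x * h x" using x b pos[of x] by simp
  then have "0 < C * (- g 0 x)" using lower[OF x] by linarith
  then have "0 < - g 0 x" by (rule zero_less_mult_pos) (use C in linarith)
  moreover have "0 < x ^ r" using x b by simp
  ultimately show ?thesis unfolding barrier_def by (rule divide_pos_pos)
qed

lemma barrier_le: "b \<le> 2 * x \<Longrightarrow> barrier r x \<le> C * (x * h x / x ^ r)"
proof -
  assume x: "b \<le> 2 * x"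
  have "- g 0 x \<le> C * (x * h x)" using scale[of 0 x] x by simp
  then have "- g 0 x / x ^ r \<le> C * (x * h x) / x ^ r" using x b by (intro divide_right_mono) auto
  then show ?thesis by (simp add: barrier_def)
qed

lemma barrier_antimono: 
  assumes "b \<le> 2 * x" "x \<le> y"
  shows "barrier r y \<le> barrier r x"
proof -
  have "g 0 x \<le> g 0 y"
  proof (rule DERIV_nonneg_imp_nondecreasing[OF assms(2)])
    fix z assume z: "x \<le> z" "z \<le> y"
    then show "\<exists>d. (g 0 has_real_derivative d) (at z) \<and> 0 \<le> d"
      using deriv[of 0 z] g_1[of z] pos[of z] assms by (intro exI[of _ "h z"]) auto
  qed
  moreover have "0 < barrier 0 y" using assms by (intro barrier_pos) auto
  ultimately show ?thesis
    unfolding barrier_def using assms b by (intro frac_le power_mono) auto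
qed

text \<open>With \<open>\<nu> < 0\<close> the mean of \<open>\<mu>\<close>, a first order expansion gives \<open>barrier r x - \<nu> * (barrier r)' x\<close> up to
\<open>o(h x / x ^ r)\<close>, and the derivative of the decreasing function \<open>barrier r\<close> is at most \<open>- h x / x ^ r\<close>. Half of
the resulting gain absorbs the error.\<close>

lemma barrier_supersolution:
  fixes \<mu> :: "real measure"
  assumes \<mu>: "prob_space \<mu>" "sets \<mu> = sets borel"
    and mom: "integrable \<mu> (\<lambda>y. y)" and neg: "(\<integral>y. y \<partial>\<mu>) < 0"
  shows "\<And>x. b \<le> x \<Longrightarrow> set_integrable \<mu> {..x/2} (\<lambda>y. barrier r (x - y))"
    and "\<forall>\<^sub>F x in at_top. (LINT y:{..x/2}|\<mu>. barrier r (x - y)) \<le>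
      barrier r x - \<bar>\<integral>y. y \<partial>\<mu>\<bar> / 2 * (h x / x ^ r)"
proof -
  let ?r = "real r"
  \<comment> \<open>\<open>barrier r\<close> and its first two derivatives\<close>
  define G :: "nat \<Rightarrow> real \<Rightarrow> real" where "G i = (if i = 0 then barrier r
     else if i = 1 then (\<lambda>x. - g 1 x / x ^ r + ?r * g 0 x / x ^ Suc r)
     else (\<lambda>x. - g 2 x / x ^ r + 2 * ?r * g 1 x / x ^ Suc r - ?r * (?r + 1) * g 0 x / x ^ Suc (Suc r)))" for i
  define K where "K = C * ((?r + 2) * (?r + 2)) * (C * 2 ^ Suc r)"
  have x0: "0 < x" if "b \<le> 2 * x" for x using that b by simp
  have powd: "((\<lambda>x. c * f x / x ^ k) has_real_derivative (c * f' / x ^ k - real k * (c * f x) / x ^ Suc k)) (at x)"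
    if "(f has_real_derivative f') (at x)" "0 < x" for f f' x k and c :: real
  proof -
    have "((\<lambda>x. c * f x / x ^ k) has_real_derivative ((c * f') * x ^ k - (c * f x) * (real k * x ^ (k - 1))) / (x ^ k * x ^ k)) (at x)"
      using that by (auto intro!: derivative_eq_intros)
    moreover have "((c * f') * x ^ k - (c * f x) * (real k * x ^ (k - 1))) / (x ^ k * x ^ k) = c * f' / x ^ k - real k * (c * f x) / x ^ Suc k"
      using that(2) by (cases k) (simp_all add: field_simps)
    ultimately show ?thesis by simp
  qed
  have A1: "(G i has_real_derivative G (Suc i) z) (at z)" if "i \<le> 1" "b \<le> 2 * z" for i z
  proof (cases "i = 0")
    case True
    have "((\<lambda>x. -1 * g 0 x / x ^ r) has_real_derivative (-1 * g 1 z / z ^ r - ?r * (-1 * g 0 z) / z ^ Suc r)) (at z)"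
      by (rule powd) (use deriv[of 0 z] x0 that in auto)
    then show ?thesis using True by (simp add: G_def barrier_def[abs_def])
  next
    case False
    then have i: "i = 1" using that by simp
    have d: "((\<lambda>x. -1 * g 1 x / x ^ r + ?r * g 0 x / x ^ Suc r) has_real_derivative
       (-1 * g 2 z / z ^ r - ?r * (-1 * g 1 z) / z ^ Suc r) + (?r * g 1 z / z ^ Suc r - real (Suc r) * (?r * g 0 z) / z ^ Suc (Suc r))) (at z)"
      by (intro DERIV_add powd) (use deriv[of 0 z] deriv[of 1 z] x0 that m in \<open>auto simp: numeral_2_eq_2\<close>)
    have e: "(-1 * g 2 z / z ^ r - ?r * (-1 * g 1 z) / z ^ Suc r) + (?r * g 1 z / z ^ Suc r - real (Suc r) * (?r * g 0 z) / z ^ Suc (Suc r)) = G 2 z"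
      using x0[OF that(2)] by (simp add: G_def field_simps)
    have G1: "G 1 = (\<lambda>x. -1 * g 1 x / x ^ r + ?r * g 0 x / x ^ Suc r)" by (simp add: G_def)
    have s: "Suc 1 = 2" by simp
    show ?thesis using d unfolding e unfolding i s G1 .
  qed
  have S0: "\<bar>g 0 z\<bar> \<le> C * (z * h z)" "\<bar>g 1 z\<bar> \<le> C * h z" "\<bar>g 2 z\<bar> \<le> C * (h z / z)" if "b \<le> 2 * z" for z
    using scale[of 0 z] scale[of 1 z] scale[of 2 z] that m x0[OF that] by (auto simp: power2_eq_square)
  have G1: "\<bar>G 1 z\<bar> \<le> C * (1 + ?r) * (h z / z ^ r)" if "b \<le> 2 * z" for z
  proof -
    have z: "0 < z" using x0 that .
    have "\<bar>G 1 z\<bar> \<le> \<bar>g 1 z\<bar> / z ^ r + ?r * \<bar>g 0 z\<bar> / z ^ Suc r"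
      unfolding G_def using z abs_triangle_ineq[of "- g 1 z / z ^ r" "?r * g 0 z / z ^ Suc r"]
      by (simp add: abs_mult)
    also have "\<dots> \<le> C * h z / z ^ r + ?r * (C * (z * h z)) / z ^ Suc r"
      using z S0[OF that] by (intro add_mono divide_right_mono mult_left_mono) auto
    also have "\<dots> = C * (1 + ?r) * (h z / z ^ r)" using z by (simp add: field_simps)
    finally show ?thesis .
  qed
  have G2: "\<bar>G 2 z\<bar> \<le> C * (1 + 2 * ?r + ?r * (?r + 1)) * (h z / z ^ Suc r)" if "b \<le> 2 * z" for z
  proof -
    have z: "0 < z" using x0 that .
    have "\<bar>u + v - t\<bar> \<le> \<bar>u\<bar> + \<bar>v\<bar> + \<bar>t\<bar>" for u v t :: real by linarith
    from this[of "- g 2 z / z ^ r" "2 * ?r * g 1 z / z ^ Suc r" "?r * (?r + 1) * g 0 z / z ^ Suc (Suc r)"]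
    have "\<bar>G 2 z\<bar> \<le> \<bar>g 2 z\<bar> / z ^ r + 2 * ?r * \<bar>g 1 z\<bar> / z ^ Suc r + ?r * (?r + 1) * \<bar>g 0 z\<bar> / z ^ Suc (Suc r)"
      unfolding G_def using z by (simp add: abs_mult)
    also have "\<dots> \<le> C * (h z / z) / z ^ r + 2 * ?r * (C * h z) / z ^ Suc r + ?r * (?r + 1) * (C * (z * h z)) / z ^ Suc (Suc r)"
      using z S0[OF that] by (intro add_mono divide_right_mono mult_left_mono) auto
    also have "\<dots> = C * (1 + 2 * ?r + ?r * (?r + 1)) * (h z / z ^ Suc r)" using z by (simp add: field_simps)
    finally show ?thesis .
  qed
  have KK: "C * q * (h z / z ^ k) \<le> K * (h x / x ^ k)"
    if "0 \<le> q" "q \<le> (?r + 2) * (?r + 2)" "k \<le> Suc r" "b \<le> x" "x / 2 \<le> z" for q z k x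
  proof -
    have x: "0 < x" using that b by simp
    have z: "0 < z" using that x by linarith
    have "C * q * (h z / z ^ k) \<le> C * ((?r + 2) * (?r + 2)) * (C * 2 ^ Suc r * (h x / x ^ k))"
    proof (intro mult_mono)
      have "h z / z ^ k \<le> C * 2 ^ k * (h x / x ^ k)" using that by (intro weight_le)
      also have "\<dots> \<le> C * 2 ^ Suc r * (h x / x ^ k)"
        using C that pos[of x] x by (intro mult_left_mono mult_right_mono power_increasing) auto
      finally show "h z / z ^ k \<le> C * 2 ^ Suc r * (h x / x ^ k)" .
    qed (use C that pos[of z] z in auto)
    then show ?thesis by (simp add: K_def mult.assoc)
  qed
  have A2: "\<bar>G 1 z\<bar> \<le> K * (h x / x ^ r)" if "b \<le> x" "x / 2 \<le> z" for x z
    by (rule order_trans[OF G1 KK]) (use that in \<open>auto simp: algebra_simps\<close>)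
  have A3: "\<bar>G (Suc 1) z\<bar> \<le> K * (h x / x ^ r) / x" if "b \<le> x" "x / 2 \<le> z" for x z
  proof -
    have "\<bar>G 2 z\<bar> \<le> K * (h x / x ^ Suc r)"
      by (rule order_trans[OF G2 KK]) (use that in \<open>auto simp: algebra_simps\<close>)
    then show ?thesis by (simp add: numeral_2_eq_2 mult.commute)
  qed
  have CK: "C \<le> K"
  proof -
    have "1 * 1 \<le> ((?r + 2) * (?r + 2)) * (C * 2 ^ Suc r)"
    proof (rule mult_mono)
      show "1 \<le> C * 2 ^ Suc r"
        using mult_mono[OF C one_le_power[of "2::real" "Suc r"]] C by simp
    qed (auto simp: algebra_simps)
    then have "C * 1 \<le> C * (((?r + 2) * (?r + 2)) * (C * 2 ^ Suc r))" using C by (intro mult_left_mono) auto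
    then show ?thesis by (simp add: K_def mult.assoc)
  qed
  have A4: "\<bar>G j x\<bar> \<le> K * x ^ (1 - j) * (h x / x ^ r)" if "b \<le> x" "j \<le> 1" for x j
  proof (cases "j = 0")
    case True
    have x: "b \<le> 2 * x" "0 < x" using that b by auto
    have "\<bar>barrier r x\<bar> \<le> C * (x * h x / x ^ r)" using barrier_le[OF x(1)] barrier_pos[OF x(1), of r] by simp
    also have "\<dots> \<le> K * (x * h x / x ^ r)" using CK x pos[of x] by (intro mult_right_mono) auto
    finally show ?thesis using True by (simp add: G_def mult.assoc)
  next
    case False
    then have "j = 1" using that by simp
    then show ?thesis using A2[of x x] that b by simp
  qed
  have A5: "0 < h x / x ^ r" if "b \<le> x" for x using pos[of x] that b by simp
  have A6: "0 < b" using b by simp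
  have mom': "integrable \<mu> (\<lambda>y. \<bar>y\<bar> ^ 1)" using mom by simp
  note T = Taylor_expectation[where g=G and w="\<lambda>x. h x / x ^ r" and n=1, OF \<mu> mom' A1 A2 A3 A4 A6 A5]
  have G0: "G 0 = barrier r" by (simp add: G_def)
  show "\<And>x. b \<le> x \<Longrightarrow> set_integrable \<mu> {..x/2} (\<lambda>y. barrier r (x - y))" using T(1) unfolding G0 by simp
  define \<nu> where "\<nu> = (\<integral>y. y \<partial>\<mu>)"
  interpret \<mu>: prob_space \<mu> by (rule \<mu>)
  have "((\<lambda>x. ((LINT y:{..x/2}|\<mu>. barrier r (x - y)) - (barrier r x - \<nu> * G 1 x)) / (h x / x ^ r)) \<longlongrightarrow> 0) at_top"
    using T(2) by (simp add: G0 \<nu>_def \<mu>.prob_space)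
  then have "\<forall>\<^sub>F x in at_top. ((LINT y:{..x/2}|\<mu>. barrier r (x - y)) - (barrier r x - \<nu> * G 1 x)) / (h x / x ^ r) < \<bar>\<nu>\<bar> / 2"
    by (rule order_tendstoD) (use neg in \<open>simp add: \<nu>_def\<close>)
  then show "\<forall>\<^sub>F x in at_top. (LINT y:{..x/2}|\<mu>. barrier r (x - y)) \<le>
      barrier r x - \<bar>\<integral>y. y \<partial>\<mu>\<bar> / 2 * (h x / x ^ r)"
    using eventually_ge_at_top[of b]
  proof eventually_elim
    case (elim x)
    have x: "b \<le> 2 * x" "0 < x" using elim b by auto
    have "(LINT y:{..x/2}|\<mu>. barrier r (x - y)) - (barrier r x - \<nu> * G 1 x) < \<bar>\<nu>\<bar> / 2 * (h x / x ^ r)"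
      using elim A5[of x] by (simp only: pos_divide_less_eq)
    moreover have "- \<nu> * G 1 x \<le> - \<nu> * (- (h x / x ^ r))"
    proof (rule mult_left_mono)
      have "0 \<le> - (?r * g 0 x / x ^ Suc r)"
      proof -
        have "g 0 x \<le> 0" using barrier_pos[OF x(1), of 0] by (simp add: barrier_def)
        then have "?r * g 0 x / x ^ Suc r \<le> 0"
          using x(2) by (intro divide_nonpos_nonneg mult_nonneg_nonpos) auto
        then show ?thesis by simp
      qed
      then show "G 1 x \<le> - (h x / x ^ r)" using g_1[OF x(1)] by (simp add: G_def)
    qed (use neg in \<open>simp add: \<nu>_def\<close>)
    moreover have "\<bar>\<nu>\<bar> = - \<nu>" using neg by (simp add: \<nu>_def)
    ultimately show ?case unfolding \<nu>_def[symmetric] by simp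
  qed
qed

text \<open>Comparison of \<open>\<bar>u\<bar>\<close> with \<open>\<epsilon>1 * barrier (m - 1) + B' * barrier m\<close>. The first barrier, with an arbitrarily
small coefficient, absorbs the error term \<open>e\<close>; the second dominates \<open>u\<close> on the initial interval
\<open>{a/2..a}\<close> and provides the strict slack, and its large coefficient is harmless because it is smaller
than the first by a factor \<open>1 / x\<close>.\<close>

lemma small_solution:
  fixes \<mu> :: "real measure" and u e :: "real \<Rightarrow> real"
  assumes \<mu>: "prob_space \<mu>" "sets \<mu> = sets borel"
    and mom: "integrable \<mu> (\<lambda>y. y)" and neg: "(\<integral>y. y \<partial>\<mu>) < 0"
    and sub: "\<forall>\<^sub>F x in at_top. \<bar>u x\<bar> \<le> (LINT y:{..x/2}|\<mu>. \<bar>u (x - y)\<bar>) + e x"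
    and int: "\<And>x. b \<le> x \<Longrightarrow> set_integrable \<mu> {..x/2} (\<lambda>y. \<bar>u (x - y)\<bar>)"
    and e: "((\<lambda>x. e x / (h x / x ^ (m - 1))) \<longlongrightarrow> 0) at_top"
    and u0: "(u \<longlongrightarrow> 0) at_top"
    and bdd: "\<And>x. b \<le> 2 * x \<Longrightarrow> \<bar>u x\<bar> \<le> U"
  shows "((\<lambda>x. u x / (x * h x / x ^ (m - 1))) \<longlongrightarrow> 0) at_top"
proof (rule tendstoI)
  fix \<epsilon> :: real assume \<epsilon>: "0 < \<epsilon>"
  define c where "c = \<bar>\<integral>y. y \<partial>\<mu>\<bar> / 2"
  have c: "0 < c" using neg by (simp add: c_def)
  define \<epsilon>1 where "\<epsilon>1 = \<epsilon> / (3 * C)"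
  have \<epsilon>1: "0 < \<epsilon>1" using \<epsilon> C by (simp add: \<epsilon>1_def)
  let ?w = "\<lambda>x. h x / x ^ (m - 1)"
  note sup = barrier_supersolution[OF \<mu> mom neg]
  have "\<forall>\<^sub>F x in at_top. e x / ?w x < \<epsilon>1 * c"
    by (rule order_tendstoD(2)[OF e]) (use c \<epsilon>1 in simp)
  with eventually_conj[OF sup(2)[of "m - 1"] sup(2)[of m]] sub
  have "\<forall>\<^sub>F x in at_top. (LINT y:{..x/2}|\<mu>. barrier (m - 1) (x - y)) \<le> barrier (m - 1) x - c * ?w x \<and>
     (LINT y:{..x/2}|\<mu>. barrier m (x - y)) \<le> barrier m x - c * (h x / x ^ m) \<and>
     \<bar>u x\<bar> \<le> (LINT y:{..x/2}|\<mu>. \<bar>u (x - y)\<bar>) + e x \<and> e x / ?w x < \<epsilon>1 * c"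
    unfolding c_def[symmetric] by eventually_elim auto
  then obtain a0 where a0: "\<And>x. a0 \<le> x \<Longrightarrow> (LINT y:{..x/2}|\<mu>. barrier (m - 1) (x - y)) \<le> barrier (m - 1) x - c * ?w x"
     "\<And>x. a0 \<le> x \<Longrightarrow> (LINT y:{..x/2}|\<mu>. barrier m (x - y)) \<le> barrier m x - c * (h x / x ^ m)"
     "\<And>x. a0 \<le> x \<Longrightarrow> \<bar>u x\<bar> \<le> (LINT y:{..x/2}|\<mu>. \<bar>u (x - y)\<bar>) + e x"
     "\<And>x. a0 \<le> x \<Longrightarrow> e x / ?w x < \<epsilon>1 * c"
    unfolding eventually_at_top_linorder by metis
  define a where "a = max a0 b"
  have a: "a0 \<le> a" "b \<le> a" "0 < a" using b by (auto simp: a_def)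
  have wpos: "0 < h x / x ^ k" if "0 < x" for x k using pos[of x] that by simp
  define B where "B = \<bar>U\<bar> / barrier m a"
  have ba: "0 < barrier m a" using barrier_pos a b by simp
  have B: "0 \<le> B" using ba by (simp add: B_def)
  \<comment> \<open>\<open>B\<close> may vanish, but the slack has to be strict\<close>
  define B' where "B' = B + 1"
  have B': "0 < B'" using B by (simp add: B'_def)
  define D where "D x = \<bar>u x\<bar> - \<epsilon>1 * barrier (m - 1) x - B' * barrier m x" for x
  have le: "D x \<le> 0" if "a / 2 \<le> x" for x
  proof (rule maximum_principle[OF \<mu> a(3), where D=D and x=x and s="\<lambda>x. B' * c * (h x / x ^ m)" and B=U])
    show "set_integrable \<mu> {..x/2} (\<lambda>y. D (x - y))" if "a \<le> x" for x
      unfolding D_def using that a int sup(1) by (intro set_integral_diff set_integrable_mult_right) auto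
    show "D x \<le> (LINT y:{..x/2}|\<mu>. D (x - y)) - B' * c * (h x / x ^ m)" if x: "a \<le> x" for x
    proof -
      have x0: "a0 \<le> x" "b \<le> x" "0 < x" using x a by auto
      have "(LINT y:{..x/2}|\<mu>. D (x - y)) = (LINT y:{..x/2}|\<mu>. \<bar>u (x - y)\<bar>) -
          \<epsilon>1 * (LINT y:{..x/2}|\<mu>. barrier (m - 1) (x - y)) - B' * (LINT y:{..x/2}|\<mu>. barrier m (x - y))"
        unfolding D_def using int[OF x0(2)] sup(1)[OF x0(2)]
        by (simp add: set_integral_diff set_integrable_mult_right)
      moreover have "\<epsilon>1 * (LINT y:{..x/2}|\<mu>. barrier (m - 1) (x - y)) \<le> \<epsilon>1 * (barrier (m - 1) x - c * ?w x)"
        using a0(1)[OF x0(1)] \<epsilon>1 by (intro mult_left_mono) auto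
      moreover have "B' * (LINT y:{..x/2}|\<mu>. barrier m (x - y)) \<le> B' * (barrier m x - c * (h x / x ^ m))"
        using a0(2)[OF x0(1)] B' by (intro mult_left_mono) auto
      moreover have "e x \<le> \<epsilon>1 * c * ?w x"
        using a0(4)[OF x0(1)] wpos[OF x0(3), of "m - 1"] by (simp only: pos_divide_less_eq less_imp_le)
      ultimately show ?thesis using a0(3)[OF x0(1)] unfolding D_def by (simp add: algebra_simps)
    qed
    show "D x \<le> 0" if x: "a / 2 \<le> x" "x \<le> a" for x
    proof -
      have bx: "b \<le> 2 * x" using x a by simp
      have "\<bar>u x\<bar> \<le> \<bar>U\<bar>" using bdd[OF bx] by simp
      also have "\<dots> = B * barrier m a" using ba by (simp add: B_def)
      also have "\<dots> \<le> B * barrier m x" using barrier_antimono[OF bx x(2)] B by (rule mult_left_mono)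
      finally have "\<bar>u x\<bar> \<le> B * barrier m x" .
      then show ?thesis using barrier_pos[OF bx, of m] mult_pos_pos[OF \<epsilon>1 barrier_pos[OF bx, of "m - 1"]]
        by (simp add: D_def B'_def algebra_simps)
    qed
    have Du: "D x \<le> \<bar>u x\<bar>" if "b \<le> 2 * x" for x
      using mult_pos_pos[OF \<epsilon>1 barrier_pos[OF that, of "m - 1"]] mult_pos_pos[OF B' barrier_pos[OF that, of m]]
      by (simp add: D_def)
    show "D x \<le> U" if "a / 2 \<le> x" for x
      using Du[of x] bdd[of x] that a by simp
    show "\<forall>\<^sub>F x in at_top. D x < d" if "0 < d" for d
    proof -
      have "\<forall>\<^sub>F x in at_top. dist (u x) 0 < d" using u0 that by (rule tendstoD)
      with eventually_ge_at_top[of b] show ?thesis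
      proof eventually_elim
        case (elim x)
        then show ?case using Du[of x] b by simp
      qed
    qed
    show "\<exists>\<delta>>0. \<forall>x\<in>{a..d}. \<delta> \<le> B' * c * (h x / x ^ m)" if "a \<le> d" for d
    proof (intro exI[of _ "B' * c * (h d / d ^ m)"] conjI ballI)
      show "0 < B' * c * (h d / d ^ m)" using B' c wpos[of d m] that a by (intro mult_pos_pos) auto
      fix x assume x: "x \<in> {a..d}"
      have "h d / d ^ m \<le> h x / x ^ m"
        using x a pos[of x] by (intro frac_le antimonoD[OF anti] power_mono) (auto intro: less_imp_le)
      then show "B' * c * (h d / d ^ m) \<le> B' * c * (h x / x ^ m)" using B' c by (intro mult_left_mono) auto
    qed
  qed (rule that)
  have "((\<lambda>x. B' * C / x) \<longlongrightarrow> 0) at_top"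
    by (rule real_tendsto_divide_at_top[OF tendsto_const filterlim_ident])
  then have "\<forall>\<^sub>F x in at_top. B' * C / x < \<epsilon> / 3"
    by (rule order_tendstoD) (use \<epsilon> in simp)
  then show "\<forall>\<^sub>F x in at_top. dist (u x / (x * h x / x ^ (m - 1))) 0 < \<epsilon>"
    using eventually_ge_at_top[of a]
  proof eventually_elim
    case (elim x)
    have x: "0 < x" "b \<le> 2 * x" "a / 2 \<le> x" using elim a by auto
    have W: "0 < x * h x / x ^ (m - 1)" using x pos[of x] by simp
    have eq: "x * h x / x ^ m = x * h x / x ^ (m - 1) / x"
      using m power_minus_mult[of m x] by (simp add: divide_divide_eq_left)
    have "\<bar>u x\<bar> \<le> \<epsilon>1 * barrier (m - 1) x + B' * barrier m x" using le[OF x(3)] by (simp add: D_def)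
    also have "\<dots> \<le> \<epsilon>1 * (C * (x * h x / x ^ (m - 1))) + B' * (C * (x * h x / x ^ m))"
      using barrier_le[OF x(2)] \<epsilon>1 B' by (intro add_mono mult_left_mono) auto
    also have "\<dots> = (\<epsilon>1 * C + B' * C / x) * (x * h x / x ^ (m - 1))"
    proof -
      have "\<epsilon>1 * (C * W) + B' * (C * (W / x)) = (\<epsilon>1 * C + B' * C / x) * W" for W by (simp add: algebra_simps)
      then show ?thesis unfolding eq .
    qed
    also have "\<dots> < \<epsilon> * (x * h x / x ^ (m - 1))"
    proof (rule mult_strict_right_mono[OF _ W])
      have "\<epsilon>1 * C = \<epsilon> / 3" using C by (simp add: \<epsilon>1_def)
      then show "\<epsilon>1 * C + B' * C / x < \<epsilon>" using elim \<epsilon> by linarith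
    qed
    finally have "\<bar>u x\<bar> / (x * h x / x ^ (m - 1)) < \<epsilon>" using W by (simp only: pos_divide_less_eq)
    then show ?case
      unfolding dist_real_def diff_0_right abs_divide[of "u x" "x * h x / x ^ (m - 1)"] abs_of_pos[OF W] .
  qed
qed

text \<open>A function that dominates the tail of the maximum: the coefficient \<open>A\<close> makes the gain of \<open>barrier 0\<close> pay
for a single jump over \<open>x / 2\<close>, and the coefficient \<open>B\<close> makes the sum at least 1 on the initial interval.
It is stated with values in \<open>ennreal\<close>, where no integrability has to be known.\<close>

lemma finite_maximum_barrier:
  fixes \<mu> :: "real measure"
  assumes \<mu>: "prob_space \<mu>" "sets \<mu> = sets borel"
    and mom: "integrable \<mu> (\<lambda>y. y)" and neg: "(\<integral>y. y \<partial>\<mu>) < 0"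
  shows "\<exists>a \<Psi> K. b \<le> a \<and> \<Psi> \<in> borel_measurable borel \<and>
    (\<forall>x. a / 2 \<le> x \<longrightarrow> x \<le> a \<longrightarrow> 1 \<le> \<Psi> x) \<and>
    (\<forall>x. a \<le> x \<longrightarrow> (\<integral>\<^sup>+y\<in>{..x/2}. \<Psi> (x - y) \<partial>\<mu>) + ennreal (h (x / 2)) \<le> \<Psi> x) \<and>
    (\<forall>x. a \<le> x \<longrightarrow> \<Psi> x \<le> ennreal (K * (x * h x)))"
proof -
  define c where "c = \<bar>\<integral>y. y \<partial>\<mu>\<bar> / 2"
  have c: "0 < c" using neg by (simp add: c_def)
  note sup = barrier_supersolution[OF \<mu> mom neg]
  have "\<forall>\<^sub>F x in at_top. (LINT y:{..x/2}|\<mu>. barrier 0 (x - y)) \<le> barrier 0 x - c * (h x / x ^ 0) \<and>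
     (LINT y:{..x/2}|\<mu>. barrier 1 (x - y)) \<le> barrier 1 x - c * (h x / x ^ 1)"
    unfolding c_def by (rule eventually_conj[OF sup(2)[of 0] sup(2)[of 1]])
  then obtain a0 where a0: "\<And>x. a0 \<le> x \<Longrightarrow> (LINT y:{..x/2}|\<mu>. barrier 0 (x - y)) \<le> barrier 0 x - c * (h x / x ^ 0)"
     "\<And>x. a0 \<le> x \<Longrightarrow> (LINT y:{..x/2}|\<mu>. barrier 1 (x - y)) \<le> barrier 1 x - c * (h x / x ^ 1)"
    unfolding eventually_at_top_linorder by metis
  define a where "a = max a0 b"
  have a: "a0 \<le> a" "b \<le> a" "0 < a" "1 \<le> a" using b by (auto simp: a_def)
  define B where "B = 1 / barrier 1 a"
  have ba: "0 < barrier 1 a" using barrier_pos a b by simp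
  have B: "0 < B" using ba by (simp add: B_def)
  define A where "A = C / c"
  have A: "0 < A" using C c by (simp add: A_def)
  define f where "f x = A * barrier 0 x + B * barrier 1 x" for x
  have f0: "0 \<le> f x" if "b \<le> 2 * x" for x
    using barrier_pos[OF that, of 0] barrier_pos[OF that, of 1] A B
    by (auto simp: f_def intro!: add_nonneg_nonneg mult_nonneg_nonneg)
  have [measurable]: "f \<in> borel_measurable borel" unfolding f_def by measurable
  define K where "K = A * C + B * C"
  have "(\<integral>\<^sup>+y\<in>{..x/2}. ennreal (f (x - y)) \<partial>\<mu>) + ennreal (h (x / 2)) \<le> ennreal (f x)" if x: "a \<le> x" for x
  proof -
    have x0: "a0 \<le> x" "b \<le> x" "0 < x" using x a by auto
    have fi: "set_integrable \<mu> {..x/2} (\<lambda>y. f (x - y))"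
      unfolding f_def using sup(1)[OF x0(2)] by (intro set_integral_add set_integrable_mult_right) auto
    have "(\<integral>\<^sup>+y\<in>{..x/2}. ennreal (f (x - y)) \<partial>\<mu>) = (\<integral>\<^sup>+y. ennreal (indicator {..x/2} y *\<^sub>R f (x - y)) \<partial>\<mu>)"
      by (intro nn_integral_cong) (auto split: split_indicator)
    also have "\<dots> = ennreal (LINT y:{..x/2}|\<mu>. f (x - y))"
      unfolding set_lebesgue_integral_def
      by (intro nn_integral_eq_integral AE_I2) (use fi f0 x0 in \<open>auto simp: set_integrable_def split: split_indicator\<close>)
    also have "(LINT y:{..x/2}|\<mu>. f (x - y)) = A * (LINT y:{..x/2}|\<mu>. barrier 0 (x - y)) + B * (LINT y:{..x/2}|\<mu>. barrier 1 (x - y))"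
      unfolding f_def using sup(1)[OF x0(2)] by (simp add: set_integral_add set_integrable_mult_right)
    finally have eq: "(\<integral>\<^sup>+y\<in>{..x/2}. ennreal (f (x - y)) \<partial>\<mu>) = ennreal (A * (LINT y:{..x/2}|\<mu>. barrier 0 (x - y)) + B * (LINT y:{..x/2}|\<mu>. barrier 1 (x - y)))" .
    have nn: "0 \<le> (LINT y:{..x/2}|\<mu>. barrier k (x - y))" for k
      unfolding set_lebesgue_integral_def
      by (intro integral_nonneg_AE AE_I2) (use barrier_pos x0 in \<open>auto split: split_indicator intro: less_imp_le\<close>)
    have "A * (LINT y:{..x/2}|\<mu>. barrier 0 (x - y)) \<le> A * (barrier 0 x - c * (h x / x ^ 0))"
      using a0(1)[OF x0(1)] A by (intro mult_left_mono) auto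
    moreover have "A * (c * (h x / x ^ 0)) = C * h x" using c by (simp add: A_def)
    moreover have "B * (LINT y:{..x/2}|\<mu>. barrier 1 (x - y)) \<le> B * barrier 1 x"
    proof (rule mult_left_mono)
      have "0 \<le> c * (h x / x ^ 1)" using c x0 pos[of x] by simp
      then show "(LINT y:{..x/2}|\<mu>. barrier 1 (x - y)) \<le> barrier 1 x" using a0(2)[OF x0(1)] by linarith
    qed (use B in simp)
    ultimately have "A * (LINT y:{..x/2}|\<mu>. barrier 0 (x - y)) + B * (LINT y:{..x/2}|\<mu>. barrier 1 (x - y)) + h (x / 2) \<le> f x"
      using half[OF x0(2)] unfolding f_def right_diff_distrib by linarith
    then have "ennreal (A * (LINT y:{..x/2}|\<mu>. barrier 0 (x - y)) + B * (LINT y:{..x/2}|\<mu>. barrier 1 (x - y)) + h (x / 2)) \<le> ennreal (f x)"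
      by (rule ennreal_leI)
    moreover have "0 \<le> A * (LINT y:{..x/2}|\<mu>. barrier 0 (x - y)) + B * (LINT y:{..x/2}|\<mu>. barrier 1 (x - y))"
      using nn[of 0] nn[of 1] A B by (intro add_nonneg_nonneg mult_nonneg_nonneg) auto
    ultimately show ?thesis unfolding eq
      by (subst (asm) ennreal_plus) (use pos[of "x / 2"] in \<open>auto simp: less_imp_le\<close>)
  qed
  moreover have "1 \<le> ennreal (f x)" if "a / 2 \<le> x" "x \<le> a" for x
  proof -
    have bx: "b \<le> 2 * x" using that a by simp
    have "1 = B * barrier 1 a" using ba by (simp add: B_def)
    also have "\<dots> \<le> B * barrier 1 x" using barrier_antimono[OF bx that(2)] B by (intro mult_left_mono) auto
    also have "\<dots> \<le> f x" using A barrier_pos[OF bx, of 0] by (simp add: f_def)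
    finally show ?thesis by (simp add: ennreal_leI flip: ennreal_1)
  qed
  moreover have "ennreal (f x) \<le> ennreal (K * (x * h x))" if "a \<le> x" for x
  proof (rule ennreal_leI)
    have x: "b \<le> 2 * x" "1 \<le> x" using that a by auto
    have "f x \<le> A * (C * (x * h x / x ^ 0)) + B * (C * (x * h x / x ^ 1))"
      unfolding f_def by (intro add_mono mult_left_mono barrier_le x(1)) (use A B in auto)
    also have "\<dots> \<le> A * (C * (x * h x)) + B * (C * (x * h x))"
      using x pos[of x] A B C by (intro add_mono mult_left_mono) auto
    finally show "f x \<le> K * (x * h x)" by (simp add: K_def algebra_simps)
  qed
  ultimately show ?thesis using a
    by (intro exI[of _ a] exI[of _ "\<lambda>x. ennreal (f x)"] exI[of _ K]) auto
qed

end

section \<open>The walk on the space of step sequences\<close>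

text \<open>Step sequences are indexed from 0, whereas the steps of a walk are numbered from 1; the truncated
subtraction in \<open>coord\<close> only affects the step number 0, which no walk uses.\<close>

definition psum :: "(nat \<Rightarrow> real) \<Rightarrow> nat \<Rightarrow> real" where
  "psum \<omega> n = (\<Sum>i<n. \<omega> i)"

definition coord :: "nat \<Rightarrow> (nat \<Rightarrow> real) \<Rightarrow> real" where
  "coord n \<omega> = \<omega> (n - 1)"

lemma walk_coord: "walk coord n \<omega> = psum \<omega> n"
  unfolding walk_def psum_def coord_def
  by (rule sum.reindex_bij_witness[of _ Suc "\<lambda>i. i - 1"]) auto

lemma psum_simps [simp]: "psum \<omega> 0 = 0" "psum \<omega> (Suc n) = psum \<omega> n + \<omega> n"
  by (simp_all add: psum_def)

lemma psum_case_nat: "psum (case_nat y \<omega>) (Suc n) = y + psum \<omega> n"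
  unfolding psum_def by (subst sum.lessThan_Suc_shift) simp

lemma psum_comb_seq:
  "j \<le> k \<Longrightarrow> psum (comb_seq k \<omega> \<omega>') j = psum \<omega> j"
  "psum (comb_seq k \<omega> \<omega>') (k + n) = psum \<omega> k + psum \<omega>' n"
proof -
  show *: "psum (comb_seq k \<omega> \<omega>') j = psum \<omega> j" if "j \<le> k" for j
    using that unfolding psum_def by (intro sum.cong) (auto simp: comb_seq_less)
  show "psum (comb_seq k \<omega> \<omega>') (k + n) = psum \<omega> k + psum \<omega>' n"
  proof (induction n)
    case (Suc n)
    have "comb_seq k \<omega> \<omega>' (k + n) = \<omega>' n" using comb_seq_add[of k \<omega> \<omega>' n] by (simp add: add.commute)
    then show ?case using Suc by simp
  qed (simp add: *)
qed

lemma walk_max_coord: "walk_max coord \<omega> = (SUP n. ereal (psum \<omega> n))"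
  by (simp add: walk_max_def walk_coord)

lemma SUP_ereal_split_at_0: "(SUP n. f n :: ereal) = max (f 0) (SUP n. f (Suc n))"
proof -
  have "range f = insert (f 0) (range (\<lambda>n. f (Suc n)))"
    by (auto simp: image_iff) (metis not0_implies_Suc)
  then show ?thesis by (simp add: sup_max)
qed

lemma walk_max_case_nat:
  "walk_max coord (case_nat y \<omega>) = max 0 (ereal y + walk_max coord \<omega>)"
proof -
  have "(SUP n. ereal (psum (case_nat y \<omega>) (Suc n))) = (SUP n. ereal y + ereal (psum \<omega> n))"
    by (simp only: psum_case_nat plus_ereal.simps)
  also have "\<dots> = ereal y + (SUP n. ereal (psum \<omega> n))"
    by (rule SUP_ereal_add_right) auto
  finally show ?thesis
    unfolding walk_max_coord by (subst SUP_ereal_split_at_0) (simp add: zero_ereal_def del: psum_simps(2))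
qed

lemma walk_max_coord_ge: "ereal (psum \<omega> n) \<le> walk_max coord \<omega>"
  unfolding walk_max_coord by (rule SUP_upper) simp

lemma walk_max_coord_nonneg: "0 \<le> walk_max coord \<omega>"
  using walk_max_coord_ge[of \<omega> 0] by (simp add: zero_ereal_def)

definition asc_at where "asc_at \<omega> k \<longleftrightarrow> 1 \<le> k \<and> 0 < psum \<omega> k \<and> (\<forall>j. 1 \<le> j \<and> j < k \<longrightarrow> psum \<omega> j \<le> 0)"

definition desc_at where "desc_at \<omega> k \<longleftrightarrow> 1 \<le> k \<and> psum \<omega> k \<le> 0 \<and> (\<forall>j. 1 \<le> j \<and> j < k \<longrightarrow> 0 < psum \<omega> j)"

definition positive_upto where "positive_upto \<omega> n \<longleftrightarrow> (\<forall>j. 1 \<le> j \<and> j \<le> n \<longrightarrow> 0 < psum \<omega> j)"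

lemma Inf_enat_eq_iff:
  "Inf (enat ` {n. Q n}) = enat k \<longleftrightarrow> Q k \<and> (\<forall>j<k. \<not> Q j)" (is "?l = _ \<longleftrightarrow> _")
proof
  assume *: "?l = enat k"
  then have ne: "enat ` {n. Q n} \<noteq> {}"
    unfolding Inf_enat_def by (metis enat.distinct(1))
  then have "?l = (LEAST x. x \<in> enat ` {n. Q n})" unfolding Inf_enat_def by (rule if_not_P)
  moreover have "(LEAST x. x \<in> enat ` {n. Q n}) \<in> enat ` {n. Q n}"
    using ne by (metis LeastI ex_in_conv)
  ultimately have "Q k" using * by auto
  moreover have "\<not> Q j" if "j < k" for j
  proof
    assume "Q j"
    then have "?l \<le> enat j" by (intro Inf_lower) auto
    with * that show False by simp
  qed
  ultimately show "Q k \<and> (\<forall>j<k. \<not> Q j)" by blast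
next
  assume *: "Q k \<and> (\<forall>j<k. \<not> Q j)"
  show "?l = enat k"
  proof (rule antisym)
    show "?l \<le> enat k" using * by (intro Inf_lower) auto
    show "enat k \<le> ?l" using * by (intro Inf_greatest) (auto simp: not_less[symmetric])
  qed
qed

lemma ascending_time_eq: "ascending_time coord \<omega> = enat k \<longleftrightarrow> asc_at \<omega> k"
  unfolding ascending_time_def Inf_enat_eq_iff walk_coord asc_at_def
  by (auto simp: not_less)

lemma descending_time_eq: "descending_time coord \<omega> = enat k \<longleftrightarrow> desc_at \<omega> k"
  unfolding descending_time_def Inf_enat_eq_iff walk_coord desc_at_def
  by (metis leD not_le_imp_less)

lemma asc_at_unique: "asc_at \<omega> k \<Longrightarrow> asc_at \<omega> l \<Longrightarrow> k = l"
  by (metis ascending_time_eq enat.inject)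
lemma desc_at_unique: "desc_at \<omega> k \<Longrightarrow> desc_at \<omega> l \<Longrightarrow> k = l"
  by (metis descending_time_eq enat.inject)

lemma desc_at_Suc: "desc_at \<omega> (Suc n) \<longleftrightarrow> positive_upto \<omega> n \<and> psum \<omega> (Suc n) \<le> 0"
  unfolding desc_at_def positive_upto_def by (auto simp: less_Suc_eq_le)

lemma positive_upto_Suc: "positive_upto \<omega> (Suc n) \<longleftrightarrow> positive_upto \<omega> n \<and> 0 < psum \<omega> (Suc n)"
  unfolding positive_upto_def by (metis le_Suc_eq less_eq_nat.simps(1) One_nat_def Suc_le_mono)

lemma walk_max_le_0_iff: "walk_max coord \<omega> \<le> 0 \<longleftrightarrow> ascending_time coord \<omega> = \<infinity>"
proof -
  have "ascending_time coord \<omega> = \<infinity> \<longleftrightarrow> {n. 1 \<le> n \<and> 0 < psum \<omega> n} = {}"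
    unfolding ascending_time_def walk_coord
    by (metis (no_types, lifting) Inf_enat_def LeastI empty_is_image enat.distinct(1) equals0I imageE)
  also have "\<dots> \<longleftrightarrow> (\<forall>n. psum \<omega> n \<le> 0)"
  proof safe
    fix n assume "{n. 1 \<le> n \<and> 0 < psum \<omega> n} = {}"
    then show "psum \<omega> n \<le> 0" by (cases n) (auto simp: not_less[symmetric])
  qed (auto simp: not_less[symmetric])
  also have "\<dots> \<longleftrightarrow> walk_max coord \<omega> \<le> 0"
    unfolding walk_max_coord by (auto simp: SUP_le_iff)
  finally show ?thesis by simp
qed

text \<open>Until its first ascending ladder epoch \<open>k\<close> the walk stays below its value at \<open>k\<close>, so the maximum is
determined by that value and by the path after \<open>k\<close>.\<close>

lemma walk_max_comb_seq:
  assumes "asc_at \<omega> k"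
  shows "walk_max coord (comb_seq k \<omega> \<omega>') = ereal (psum \<omega> k) + walk_max coord \<omega>'"
proof (rule antisym)
  have "ereal (psum (comb_seq k \<omega> \<omega>') n) \<le> ereal (psum \<omega> k) + walk_max coord \<omega>'" for n
  proof (cases "n < k")
    case True
    then have "psum (comb_seq k \<omega> \<omega>') n \<le> psum \<omega> k"
      using assms by (cases n) (auto simp: asc_at_def psum_comb_seq(1) simp del: psum_simps(2)
          intro: order_trans[OF _ less_imp_le])
    then show ?thesis using walk_max_coord_nonneg[of \<omega>']
      by (metis add.right_neutral add_mono ereal_less_eq(3))
  next
    case False
    then obtain l where "n = k + l" using le_Suc_ex not_less by blast
    then show ?thesis
      using walk_max_coord_ge[of \<omega>' l] by (simp add: psum_comb_seq add_left_mono flip: plus_ereal.simps(1))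
  qed
  then show "walk_max coord (comb_seq k \<omega> \<omega>') \<le> ereal (psum \<omega> k) + walk_max coord \<omega>'"
    unfolding walk_max_coord[of "comb_seq k \<omega> \<omega>'"] by (auto intro: SUP_least)
  have "ereal (psum \<omega> k) + walk_max coord \<omega>' = (SUP n. ereal (psum \<omega> k) + ereal (psum \<omega>' n))"
    unfolding walk_max_coord by (rule SUP_ereal_add_right[symmetric]) auto
  also have "\<dots> \<le> walk_max coord (comb_seq k \<omega> \<omega>')"
    by (rule SUP_least) (use walk_max_coord_ge[of "comb_seq k \<omega> \<omega>'"] in \<open>simp add: psum_comb_seq(2)[symmetric]\<close>)
  finally show "ereal (psum \<omega> k) + walk_max coord \<omega>' \<le> walk_max coord (comb_seq k \<omega> \<omega>')" .
qed

lemma asc_at_comb_seq: "asc_at (comb_seq k \<omega> \<omega>') k = asc_at \<omega> k"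
  unfolding asc_at_def by (auto simp: psum_comb_seq)

lemma positive_upto_comb_seq: "positive_upto (comb_seq k \<omega> \<omega>') k = positive_upto \<omega> k"
  unfolding positive_upto_def by (auto simp: psum_comb_seq)

locale random_walk =
  fixes N :: "real measure"
  assumes step_distribution: "real_distribution N"
begin

sublocale N: real_distribution N by (rule step_distribution)
sublocale sequence_space N by unfold_locales

lemma measurable_component: "(\<lambda>\<omega>. \<omega> i) \<in> borel_measurable S"
proof -
  have "(\<lambda>\<omega>. \<omega> i) \<in> measurable S N" by (rule measurable_component_singleton) simp
  then show ?thesis by simp
qed

lemma measurable_psum [measurable]: "(\<lambda>\<omega>. psum \<omega> n) \<in> borel_measurable S"
  unfolding psum_def by (intro borel_measurable_sum measurable_component)

lemma measurable_walk_max [measurable]: "walk_max coord \<in> borel_measurable S"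
  unfolding walk_max_coord by measurable

lemma measurable_asc_at [measurable]: "Measurable.pred S (\<lambda>\<omega>. asc_at \<omega> k)"
  unfolding asc_at_def by measurable
lemma measurable_desc_at [measurable]: "Measurable.pred S (\<lambda>\<omega>. desc_at \<omega> k)"
  unfolding desc_at_def by measurable
lemma measurable_positive_upto [measurable]: "Measurable.pred S (\<lambda>\<omega>. positive_upto \<omega> k)"
  unfolding positive_upto_def by measurable

lemma space_S [simp]: "space S = UNIV"
  by (simp add: space_PiM)

lemma measurable_case_nat_S:
  "f \<in> borel_measurable L \<Longrightarrow> g \<in> measurable L S \<Longrightarrow> (\<lambda>x. case_nat (f x) (g x)) \<in> measurable L S"
  by (rule measurable_case_nat') simp_all

lemma nn_integral_first_step:
  assumes [measurable]: "f \<in> borel_measurable S"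
  shows "(\<integral>\<^sup>+\<omega>. f \<omega> \<partial>S) = (\<integral>\<^sup>+y. \<integral>\<^sup>+\<omega>. f (case_nat y \<omega>) \<partial>S \<partial>N)"
proof -
  note measurable_case_nat_S [measurable (raw)]
  have "(\<integral>\<^sup>+\<omega>. f \<omega> \<partial>S) = (\<integral>\<^sup>+\<omega>. f \<omega> \<partial>distr (N \<Otimes>\<^sub>M S) S (\<lambda>(s, \<omega>). case_nat s \<omega>))"
    by (simp add: PiM_iter)
  also have "\<dots> = (\<integral>\<^sup>+x. f (case x of (s, \<omega>) \<Rightarrow> case_nat s \<omega>) \<partial>(N \<Otimes>\<^sub>M S))"
    by (rule nn_integral_distr) measurable
  also have "\<dots> = (\<integral>\<^sup>+y. \<integral>\<^sup>+\<omega>. f (case_nat y \<omega>) \<partial>S \<partial>N)"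
    by (subst P.nn_integral_fst[symmetric]) auto
  finally show ?thesis .
qed

lemma nn_integral_split_at:
  assumes [measurable]: "f \<in> borel_measurable S"
  shows "(\<integral>\<^sup>+\<omega>. f \<omega> \<partial>S) = (\<integral>\<^sup>+\<omega>. \<integral>\<^sup>+\<omega>'. f (comb_seq k \<omega> \<omega>') \<partial>S \<partial>S)"
proof -
  have "(\<integral>\<^sup>+\<omega>. f \<omega> \<partial>S) = (\<integral>\<^sup>+\<omega>. f \<omega> \<partial>distr (S \<Otimes>\<^sub>M S) S (\<lambda>(\<omega>, \<omega>'). comb_seq k \<omega> \<omega>'))"
    by (simp only: PiM_comb_seq)
  also have "\<dots> = (\<integral>\<^sup>+x. f (case x of (\<omega>, \<omega>') \<Rightarrow> comb_seq k \<omega> \<omega>') \<partial>(S \<Otimes>\<^sub>M S))"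
    by (rule nn_integral_distr) measurable
  also have "\<dots> = (\<integral>\<^sup>+\<omega>. \<integral>\<^sup>+\<omega>'. f (comb_seq k \<omega> \<omega>') \<partial>S \<partial>S)"
    by (subst P.nn_integral_fst[symmetric]) auto
  finally show ?thesis .
qed

lemma nn_integral_component: 
  assumes "f \<in> borel_measurable borel"
  shows "(\<integral>\<^sup>+\<omega>. f (\<omega> i) \<partial>S) = (\<integral>\<^sup>+y. f y \<partial>N)"
proof -
  have "(\<integral>\<^sup>+y. f y \<partial>N) = (\<integral>\<^sup>+y. f y \<partial>distr S N (\<lambda>\<omega>. \<omega> i))"
    by (subst PiM_component) auto
  also have "\<dots> = (\<integral>\<^sup>+\<omega>. f (\<omega> i) \<partial>S)"
    by (rule nn_integral_distr) (use assms in \<open>auto intro!: measurable_component_singleton\<close>)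
  finally show ?thesis ..
qed

lemma emeasure_partial_max_Suc:
  assumes "0 \<le> x"
  shows "emeasure S {\<omega>. \<exists>k\<le>Suc n. x < psum \<omega> k} = (\<integral>\<^sup>+y. emeasure S {\<omega>. \<exists>k\<le>n. x - y < psum \<omega> k} \<partial>N)"
proof -
  have m [measurable]: "Measurable.pred S (\<lambda>\<omega>. \<exists>k\<le>n. x < psum \<omega> k)" for n x by measurable
  have *: "(\<exists>k\<le>Suc n. x < psum (case_nat y \<omega>) k) \<longleftrightarrow> (\<exists>k\<le>n. x - y < psum \<omega> k)" for y \<omega>
  proof
    assume "\<exists>k\<le>Suc n. x < psum (case_nat y \<omega>) k"
    then obtain k where k: "k \<le> Suc n" "x < psum (case_nat y \<omega>) k" by blast
    with assms obtain l where "k = Suc l" by (cases k) auto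
    with k show "\<exists>k\<le>n. x - y < psum \<omega> k" by (auto simp: psum_case_nat simp del: psum_simps(2) intro!: exI[of _ l])
  next
    assume "\<exists>k\<le>n. x - y < psum \<omega> k"
    then obtain k where "k \<le> n" "x - y < psum \<omega> k" by blast
    then show "\<exists>k\<le>Suc n. x < psum (case_nat y \<omega>) k"
      by (intro exI[of _ "Suc k"]) (auto simp: psum_case_nat simp del: psum_simps(2))
  qed
  have "emeasure S {\<omega>. \<exists>k\<le>Suc n. x < psum \<omega> k} = (\<integral>\<^sup>+\<omega>. indicator {\<omega>. \<exists>k\<le>Suc n. x < psum \<omega> k} \<omega> \<partial>S)"
    using m[of "Suc n"] by (simp add: pred_def)
  also have "\<dots> = (\<integral>\<^sup>+y. \<integral>\<^sup>+\<omega>. indicator {\<omega>. \<exists>k\<le>Suc n. x < psum \<omega> k} (case_nat y \<omega>) \<partial>S \<partial>N)"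
    by (rule nn_integral_first_step) (use m[of "Suc n"] in \<open>simp add: pred_def\<close>)
  also have "\<dots> = (\<integral>\<^sup>+y. \<integral>\<^sup>+\<omega>. indicator {\<omega>. \<exists>k\<le>n. x - y < psum \<omega> k} \<omega> \<partial>S \<partial>N)"
    by (simp only: indicator_def mem_Collect_eq *)
  also have "\<dots> = (\<integral>\<^sup>+y. emeasure S {\<omega>. \<exists>k\<le>n. x - y < psum \<omega> k} \<partial>N)"
    using m by (simp add: pred_def)
  finally show ?thesis .
qed

text \<open>Induction on the number of steps, conditioning on the first one: a first step above \<open>x / 2\<close> is paid for
separately, and otherwise the hypothesis applies at \<open>x - y \<ge> x / 2\<close>. Nothing about the finiteness of
the maximum is presupposed.\<close>

lemma emeasure_walk_max_le:
  assumes a: "0 < a" and one: "\<And>x. a / 2 \<le> x \<Longrightarrow> x \<le> a \<Longrightarrow> 1 \<le> \<Psi> x"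
    and [measurable]: "\<Psi> \<in> borel_measurable borel"
    and super: "\<And>x. a \<le> x \<Longrightarrow> (\<integral>\<^sup>+y\<in>{..x/2}. \<Psi> (x - y) \<partial>N) + emeasure N {x/2<..} \<le> \<Psi> x"
    and x: "a / 2 \<le> x"
  shows "emeasure S {\<omega>. ereal x < walk_max coord \<omega>} \<le> \<Psi> x"
proof -
  have m [measurable]: "Measurable.pred S (\<lambda>\<omega>. \<exists>k\<le>n. x < psum \<omega> k)" for n x by measurable
  have "emeasure S {\<omega>. \<exists>k\<le>n. x < psum \<omega> k} \<le> \<Psi> x" if "a / 2 \<le> x" for x n
    using that
  proof (induction n arbitrary: x)
    case 0
    then show ?case using a by simp
  next
    case (Suc n)
    show ?case
    proof (cases "x \<le> a")
      case True
      then show ?thesis using one[OF Suc.prems] emeasure_le_1 order_trans by blast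
    next
      case False
      have "emeasure S {\<omega>. \<exists>k\<le>Suc n. x < psum \<omega> k} = (\<integral>\<^sup>+y. emeasure S {\<omega>. \<exists>k\<le>n. x - y < psum \<omega> k} \<partial>N)"
        using False a by (intro emeasure_partial_max_Suc) auto
      also have "\<dots> \<le> (\<integral>\<^sup>+y. \<Psi> (x - y) * indicator {..x/2} y + indicator {x/2<..} y \<partial>N)"
      proof (rule nn_integral_mono)
        fix y
        show "emeasure S {\<omega>. \<exists>k\<le>n. x - y < psum \<omega> k} \<le> \<Psi> (x - y) * indicator {..x/2} y + indicator {x/2<..} y"
          using Suc.IH[of "x - y"] False by (cases "y \<le> x/2") (auto simp: emeasure_le_1)
      qed
      also have "\<dots> = (\<integral>\<^sup>+y\<in>{..x/2}. \<Psi> (x - y) \<partial>N) + emeasure N {x/2<..}"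
        by (subst nn_integral_add) auto
      also have "\<dots> \<le> \<Psi> x" using super False by simp
      finally show ?thesis .
    qed
  qed
  note * = this
  have "emeasure S {\<omega>. ereal x < walk_max coord \<omega>} = emeasure S (\<Union>n. {\<omega>. \<exists>k\<le>n. x < psum \<omega> k})"
    by (rule arg_cong[where f="emeasure S"]) (auto simp: walk_max_coord less_SUP_iff)
  also have "\<dots> = (SUP n. emeasure S {\<omega>. \<exists>k\<le>n. x < psum \<omega> k})"
  proof (rule SUP_emeasure_incseq[symmetric])
    show "range (\<lambda>n. {\<omega>. \<exists>k\<le>n. x < psum \<omega> k}) \<subseteq> sets S" using m by (auto simp: pred_def)
    show "incseq (\<lambda>n. {\<omega>. \<exists>k\<le>n. x < psum \<omega> k})" by (rule incseq_SucI) (auto intro: le_SucI)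
  qed
  also have "\<dots> \<le> \<Psi> x" using * x by (intro SUP_least) auto
  finally show ?thesis .
qed

end

section \<open>The laws of the maximum and of the ladder heights\<close>

locale random_walk_finite_max = random_walk +
  assumes finite_max: "AE \<omega> in S. walk_max coord \<omega> < \<infinity>"
begin

definition maxval :: "(nat \<Rightarrow> real) \<Rightarrow> real" where
  "maxval \<omega> = real_of_ereal (walk_max coord \<omega>)"

definition max_law :: "real measure" where
  "max_law = distr S borel maxval"

lemma sets_Collect_pred: "Measurable.pred S Q \<Longrightarrow> {\<omega>. Q \<omega>} \<in> sets S"
  by (simp add: pred_def)

lemma measurable_maxval [measurable]: "maxval \<in> borel_measurable S"
  unfolding maxval_def by measurable

lemma sets_max_law [measurable_cong, simp]: "sets max_law = sets borel"
  and space_max_law [simp]: "space max_law = UNIV"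
  by (simp_all add: max_law_def)

sublocale max_law: prob_space max_law
  unfolding max_law_def by (rule P.prob_space_distr) measurable

lemma AE_maxval: "AE \<omega> in S. walk_max coord \<omega> = ereal (maxval \<omega>)"
  using finite_max
proof eventually_elim
  case (elim \<omega>)
  then show ?case using walk_max_coord_nonneg[of \<omega>] unfolding maxval_def
    by (cases "walk_max coord \<omega>") auto
qed

lemma maxval_nonneg: "0 \<le> maxval \<omega>"
  unfolding maxval_def using walk_max_coord_nonneg by (rule real_of_ereal_pos)

lemma AE_max_law_nonneg: "AE z in max_law. 0 \<le> z"
  unfolding max_law_def by (subst AE_distr_iff) (auto simp: maxval_nonneg)

lemma emeasure_max_law_tail: "emeasure max_law {x<..} = emeasure S {\<omega>. ereal x < walk_max coord \<omega>}"
proof -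
  have [measurable]: "Measurable.pred S (\<lambda>\<omega>. ereal x < walk_max coord \<omega>)" by measurable
  have [measurable]: "Measurable.pred S (\<lambda>\<omega>. x < maxval \<omega>)" by measurable
  have "emeasure max_law {x<..} = emeasure S {\<omega>\<in>space S. x < maxval \<omega>}"
    unfolding max_law_def by (subst emeasure_distr) (auto intro!: arg_cong[where f="emeasure S"])
  also have "\<dots> = emeasure S {\<omega>\<in>space S. ereal x < walk_max coord \<omega>}"
  proof (rule emeasure_eq_AE)
    show "AE \<omega> in S. (\<omega> \<in> {\<omega> \<in> space S. x < maxval \<omega>}) = (\<omega> \<in> {\<omega> \<in> space S. ereal x < walk_max coord \<omega>})"
      using AE_maxval by eventually_elim simp
  qed measurable
  finally show ?thesis by simp
qed

lemma nn_integral_max_law: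
  fixes f :: "real \<Rightarrow> ennreal"
  shows "f \<in> borel_measurable borel \<Longrightarrow> (\<integral>\<^sup>+z. f z \<partial>max_law) = (\<integral>\<^sup>+\<omega>. f (maxval \<omega>) \<partial>S)"
  unfolding max_law_def by (rule nn_integral_distr) auto

text \<open>Lindley's equation: the path after the first step has the law of the whole path, so \<open>M\<close> has the law of
\<open>max 0 (X + M)\<close>.\<close>

lemma Lindley:
  fixes f :: "real \<Rightarrow> ennreal"
  assumes [measurable]: "f \<in> borel_measurable borel"
  shows "(\<integral>\<^sup>+z. f z \<partial>max_law) = (\<integral>\<^sup>+y. \<integral>\<^sup>+z. f (max 0 (y + z)) \<partial>max_law \<partial>N)"
proof -
  have "(\<integral>\<^sup>+z. f z \<partial>max_law) = (\<integral>\<^sup>+y. \<integral>\<^sup>+\<omega>. f (maxval (case_nat y \<omega>)) \<partial>S \<partial>N)"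
    by (subst nn_integral_max_law) (auto intro: nn_integral_first_step)
  also have "\<dots> = (\<integral>\<^sup>+y. \<integral>\<^sup>+\<omega>. f (max 0 (y + maxval \<omega>)) \<partial>S \<partial>N)"
  proof (rule nn_integral_cong, rule nn_integral_cong_AE)
    fix y
    show "AE \<omega> in S. f (maxval (case_nat y \<omega>)) = f (max 0 (y + maxval \<omega>))"
      using AE_maxval
    proof eventually_elim
      case (elim \<omega>)
      have "maxval (case_nat y \<omega>) = real_of_ereal (max 0 (ereal (y + maxval \<omega>)))"
        unfolding maxval_def[of "case_nat y \<omega>"] walk_max_case_nat elim by simp
      also have "max 0 (ereal (y + maxval \<omega>)) = ereal (max 0 (y + maxval \<omega>))"
        by (simp add: max_def zero_ereal_def)
      finally show ?case by (simp only: real_of_ereal.simps)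
    qed
  qed
  also have "\<dots> = (\<integral>\<^sup>+y. \<integral>\<^sup>+z. f (max 0 (y + z)) \<partial>max_law \<partial>N)"
    by (subst nn_integral_max_law) auto
  finally show ?thesis .
qed

definition never_prob :: real where
  "never_prob = measure S {\<omega>. ascending_time coord \<omega> = \<infinity>}"

lemma never_eq: "ascending_time coord \<omega> = \<infinity> \<longleftrightarrow> (\<forall>k. \<not> asc_at \<omega> k)"
  by (metis ascending_time_eq enat.exhaust enat.distinct(1))

lemma measurable_never [measurable]: "Measurable.pred S (\<lambda>\<omega>. ascending_time coord \<omega> = \<infinity>)"
  unfolding never_eq by measurable

lemma emeasure_never: "emeasure S {\<omega>. ascending_time coord \<omega> = \<infinity>} = never_prob"
  unfolding never_prob_def by (rule P.emeasure_eq_measure)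

lemma emeasure_max_law_0: "emeasure max_law {..0} = never_prob"
proof -
  have "emeasure max_law {..0} = emeasure S {\<omega>\<in>space S. maxval \<omega> \<le> 0}"
    unfolding max_law_def by (subst emeasure_distr) (auto intro!: arg_cong[where f="emeasure S"])
  also have "\<dots> = emeasure S {\<omega>\<in>space S. ascending_time coord \<omega> = \<infinity>}"
  proof (rule emeasure_eq_AE)
    show "AE \<omega> in S. (\<omega> \<in> {\<omega> \<in> space S. maxval \<omega> \<le> 0}) = (\<omega> \<in> {\<omega> \<in> space S. ascending_time coord \<omega> = \<infinity>})"
      using AE_maxval
    proof eventually_elim
      case (elim \<omega>)
      show ?case unfolding walk_max_le_0_iff[symmetric] by (simp add: elim)
    qed
  qed measurable
  finally show ?thesis by (simp add: emeasure_never)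
qed

text \<open>Lindley's equation read as a renewal equation: \<open>M\<close> vanishes with probability \<open>never_prob\<close>, and on
\<open>M > 0\<close> its law is that of \<open>M + X\<close> restricted to \<open>(0, \<infinity>)\<close>.\<close>

lemma nn_integral_Lindley_split:
  fixes f :: "real \<Rightarrow> ennreal"
  assumes [measurable]: "f \<in> borel_measurable borel"
  shows "(\<integral>\<^sup>+z. f z \<partial>max_law) = never_prob * f 0 +
    (\<integral>\<^sup>+z. \<integral>\<^sup>+y. f (z + y) * indicator {0<..} (z + y) \<partial>N \<partial>max_law)"
proof -
  interpret pair_sigma_finite max_law N ..
  have m1: "(\<lambda>z. indicator {..0} (max 0 (y + z)) :: ennreal) \<in> borel_measurable max_law" for y :: real
  proof -
    have "(\<lambda>z. indicator {..0} (max 0 (y + z)) :: ennreal) \<in> borel_measurable borel" by measurable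
    then show ?thesis by (simp cong: measurable_cong_sets)
  qed
  have m2: "(\<lambda>z. f (z + y) * indicator {0<..} (z + y)) \<in> borel_measurable max_law" for y :: real
  proof -
    have "(\<lambda>z. f (z + y) * indicator {0<..} (z + y)) \<in> borel_measurable borel" by measurable
    then show ?thesis by (simp cong: measurable_cong_sets)
  qed
  let ?Z = "\<integral>\<^sup>+y. \<integral>\<^sup>+z. indicator {..0} (max 0 (y + z)) \<partial>max_law \<partial>N :: ennreal"
  have Z: "?Z = never_prob"
    using Lindley[of "indicator {..0}"] by (simp add: emeasure_max_law_0)
  have "(\<integral>\<^sup>+z. f z \<partial>max_law) = (\<integral>\<^sup>+y. \<integral>\<^sup>+z. f (max 0 (y + z)) \<partial>max_law \<partial>N)" by (rule Lindley) fact
  also have "\<dots> = (\<integral>\<^sup>+y. \<integral>\<^sup>+z. f 0 * indicator {..0} (max 0 (y + z)) + f (z + y) * indicator {0<..} (z + y) \<partial>max_law \<partial>N)"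
    by (intro nn_integral_cong) (auto simp: max_def add.commute split: split_indicator)
  also have "\<dots> = (\<integral>\<^sup>+y. (\<integral>\<^sup>+z. f 0 * indicator {..0} (max 0 (y + z)) \<partial>max_law) +
      (\<integral>\<^sup>+z. f (z + y) * indicator {0<..} (z + y) \<partial>max_law) \<partial>N)"
    by (intro nn_integral_cong nn_integral_add borel_measurable_times_ennreal borel_measurable_const m1 m2)
  also have "\<dots> = (\<integral>\<^sup>+y. (\<integral>\<^sup>+z. f 0 * indicator {..0} (max 0 (y + z)) \<partial>max_law) \<partial>N) +
      (\<integral>\<^sup>+y. (\<integral>\<^sup>+z. f (z + y) * indicator {0<..} (z + y) \<partial>max_law) \<partial>N)"
    by (intro nn_integral_add) auto
  also have "(\<integral>\<^sup>+y. (\<integral>\<^sup>+z. f 0 * indicator {..0} (max 0 (y + z)) \<partial>max_law) \<partial>N) = f 0 * ?Z"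
    by (subst nn_integral_cmult[symmetric], measurable, intro nn_integral_cong nn_integral_cmult m1)
  also have "(\<integral>\<^sup>+y. (\<integral>\<^sup>+z. f (z + y) * indicator {0<..} (z + y) \<partial>max_law) \<partial>N) =
     (\<integral>\<^sup>+z. \<integral>\<^sup>+y. f (z + y) * indicator {0<..} (z + y) \<partial>N \<partial>max_law)"
    by (rule Fubini') measurable
  finally show ?thesis unfolding Z by (simp add: mult.commute)
qed

text \<open>A rule \<open>Q\<close> selects, on each path, at most one index; the law of the walk at that index has
  mass less than one when the rule may select none. Both ladder height laws are of this kind.\<close>

definition stopping_rule :: "((nat \<Rightarrow> real) \<Rightarrow> nat \<Rightarrow> bool) \<Rightarrow> bool" where
  "stopping_rule Q \<longleftrightarrow> (\<forall>k. Measurable.pred S (\<lambda>\<omega>. Q \<omega> k)) \<and> (\<forall>\<omega> k l. Q \<omega> k \<longrightarrow> Q \<omega> l \<longrightarrow> k = l)"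

text \<open>At most one summand is nonzero; the value 0 on paths without a selected index is cut off by
  the density in \<open>stopped_law\<close>.\<close>

definition stopped_at :: "((nat \<Rightarrow> real) \<Rightarrow> nat \<Rightarrow> bool) \<Rightarrow> (nat \<Rightarrow> real) \<Rightarrow> real" where
  "stopped_at Q \<omega> = (\<Sum>k. if Q \<omega> k then psum \<omega> k else 0)"

definition stopped_law :: "((nat \<Rightarrow> real) \<Rightarrow> nat \<Rightarrow> bool) \<Rightarrow> real measure" where
  "stopped_law Q = distr (density S (indicator {\<omega>. \<exists>k. Q \<omega> k})) borel (stopped_at Q)"

lemma stopping_ruleD:
  assumes "stopping_rule Q"
  shows "Measurable.pred S (\<lambda>\<omega>. Q \<omega> k)" "Q \<omega> k \<Longrightarrow> Q \<omega> l \<Longrightarrow> k = l"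
  using assms unfolding stopping_rule_def by blast+

lemma sets_stopped_law [simp]: "sets (stopped_law Q) = sets borel"
  and space_stopped_law [simp]: "space (stopped_law Q) = UNIV"
  by (simp_all add: stopped_law_def)

lemma stopped_at_eq:
  assumes "stopping_rule Q" "Q \<omega> k"
  shows "stopped_at Q \<omega> = psum \<omega> k"
  unfolding stopped_at_def using stopping_ruleD(2)[OF assms(1)] assms(2)
  by (subst suminf_finite[of "{k}"]) auto

lemma nn_integral_stopped_law:
  fixes f :: "real \<Rightarrow> ennreal"
  assumes Q: "stopping_rule Q" and [measurable]: "f \<in> borel_measurable borel"
  shows "(\<integral>\<^sup>+y. f y \<partial>stopped_law Q) = (\<Sum>k. \<integral>\<^sup>+\<omega>. f (psum \<omega> k) * indicator {\<omega>. Q \<omega> k} \<omega> \<partial>S)"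
proof -
  note [measurable] = stopping_ruleD(1)[OF Q]
  have [measurable]: "{\<omega>. \<exists>k. Q \<omega> k} \<in> sets S" "\<And>k. {\<omega>. Q \<omega> k} \<in> sets S"
    by (auto intro!: sets_Collect_pred)
  have [measurable]: "stopped_at Q \<in> borel_measurable S"
    unfolding stopped_at_def by measurable
  have "(\<integral>\<^sup>+y. f y \<partial>stopped_law Q) = (\<integral>\<^sup>+\<omega>. indicator {\<omega>. \<exists>k. Q \<omega> k} \<omega> * f (stopped_at Q \<omega>) \<partial>S)"
    unfolding stopped_law_def by (simp add: nn_integral_distr nn_integral_density)
  also have "\<dots> = (\<integral>\<^sup>+\<omega>. (\<Sum>k. f (psum \<omega> k) * indicator {\<omega>. Q \<omega> k} \<omega>) \<partial>S)"
  proof (rule nn_integral_cong)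
    fix \<omega>
    show "indicator {\<omega>. \<exists>k. Q \<omega> k} \<omega> * f (stopped_at Q \<omega>) = (\<Sum>k. f (psum \<omega> k) * indicator {\<omega>. Q \<omega> k} \<omega>)"
    proof (cases "\<exists>k. Q \<omega> k")
      case True
      then obtain k where k: "Q \<omega> k" by blast
      then show ?thesis using stopping_ruleD(2)[OF Q]
        by (subst suminf_finite[of "{k}"]) (auto simp: stopped_at_eq[OF Q k] split: split_indicator)
    qed simp
  qed
  also have "\<dots> = (\<Sum>k. \<integral>\<^sup>+\<omega>. f (psum \<omega> k) * indicator {\<omega>. Q \<omega> k} \<omega> \<partial>S)"
    by (rule nn_integral_suminf) measurable
  finally show ?thesis .
qed

lemma emeasure_stopped_law:
  assumes Q: "stopping_rule Q" and [measurable]: "A \<in> sets borel"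
  shows "emeasure (stopped_law Q) A = emeasure S {\<omega>. \<exists>k. Q \<omega> k \<and> psum \<omega> k \<in> A}"
proof -
  note [measurable] = stopping_ruleD(1)[OF Q]
  have "Measurable.pred S (\<lambda>\<omega>. \<exists>k. Q \<omega> k \<and> psum \<omega> k \<in> A)" by measurable
  then have [measurable]: "{\<omega>. \<exists>k. Q \<omega> k \<and> psum \<omega> k \<in> A} \<in> sets S"
    by (rule sets_Collect_pred)
  have [measurable]: "\<And>k. {\<omega>. Q \<omega> k} \<in> sets S"
    by (rule sets_Collect_pred[OF stopping_ruleD(1)[OF Q]])
  have "emeasure (stopped_law Q) A = (\<integral>\<^sup>+y. indicator A y \<partial>stopped_law Q)" by simp
  also have "\<dots> = (\<Sum>k. \<integral>\<^sup>+\<omega>. indicator A (psum \<omega> k) * indicator {\<omega>. Q \<omega> k} \<omega> \<partial>S)"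
    by (rule nn_integral_stopped_law[OF Q]) measurable
  also have "\<dots> = (\<integral>\<^sup>+\<omega>. (\<Sum>k. indicator A (psum \<omega> k) * indicator {\<omega>. Q \<omega> k} \<omega>) \<partial>S)"
    by (rule nn_integral_suminf[symmetric]) measurable
  also have "\<dots> = (\<integral>\<^sup>+\<omega>. indicator {\<omega>. \<exists>k. Q \<omega> k \<and> psum \<omega> k \<in> A} \<omega> \<partial>S)"
  proof (rule nn_integral_cong)
    fix \<omega>
    show "(\<Sum>k. indicator A (psum \<omega> k) * indicator {\<omega>. Q \<omega> k} \<omega>) =
        (indicator {\<omega>. \<exists>k. Q \<omega> k \<and> psum \<omega> k \<in> A} \<omega> :: ennreal)"
    proof (cases "\<exists>k. Q \<omega> k")
      case True
      then obtain k where k: "Q \<omega> k" by blast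
      have other: "\<not> Q \<omega> l" if "l \<noteq> k" for l
        using stopping_ruleD(2)[OF Q k, of l] that by blast
      have "(\<Sum>k. indicator A (psum \<omega> k) * indicator {\<omega>. Q \<omega> k} \<omega>) = (indicator A (psum \<omega> k) :: ennreal)"
        using k by (subst suminf_finite[of "{k}"]) (auto simp: other split: split_indicator)
      moreover have "(\<exists>l. Q \<omega> l \<and> psum \<omega> l \<in> A) \<longleftrightarrow> psum \<omega> k \<in> A"
        using stopping_ruleD(2)[OF Q k] k by blast
      ultimately show ?thesis by (simp add: indicator_def)
    qed simp
  qed
  also have "\<dots> = emeasure S {\<omega>. \<exists>k. Q \<omega> k \<and> psum \<omega> k \<in> A}" by simp
  finally show ?thesis .
qed

lemma finite_borel_measure_stopped_law:
  assumes Q: "stopping_rule Q"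
  shows "finite_borel_measure (stopped_law Q)"
proof (rule finite_borel_measure.intro)
  show "finite_measure (stopped_law Q)"
    by (rule finite_measureI) (simp add: emeasure_stopped_law[OF Q] P.emeasure_eq_measure)
qed (simp add: finite_borel_measure_axioms_def)

definition asc_law :: "real measure" where "asc_law = stopped_law asc_at"
definition desc_law :: "real measure" where "desc_law = stopped_law desc_at"

lemma sets_ladder_laws [measurable_cong, simp]:
  "sets asc_law = sets borel" "sets desc_law = sets borel"
  and space_ladder_laws [simp]: "space asc_law = UNIV" "space desc_law = UNIV"
  by (simp_all add: asc_law_def desc_law_def)

lemma stopping_rule_asc_at: "stopping_rule asc_at"
  unfolding stopping_rule_def using asc_at_unique by auto
lemma stopping_rule_desc_at: "stopping_rule desc_at"
  unfolding stopping_rule_def using desc_at_unique by auto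

lemmas nn_integral_asc_law = nn_integral_stopped_law[OF stopping_rule_asc_at, folded asc_law_def]
lemmas nn_integral_desc_law = nn_integral_stopped_law[OF stopping_rule_desc_at, folded desc_law_def]
lemmas emeasure_asc_law = emeasure_stopped_law[OF stopping_rule_asc_at, folded asc_law_def]
lemmas emeasure_desc_law = emeasure_stopped_law[OF stopping_rule_desc_at, folded desc_law_def]

lemmas finite_borel_measure_asc_law = finite_borel_measure_stopped_law[OF stopping_rule_asc_at, folded asc_law_def]
lemmas finite_borel_measure_desc_law = finite_borel_measure_stopped_law[OF stopping_rule_desc_at, folded desc_law_def]

lemma ascending_event_iff:
  "(ascending_time coord \<omega> < \<infinity> \<and> walk coord (the_enat (ascending_time coord \<omega>)) \<omega> \<le> x) \<longleftrightarrow>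
    (\<exists>k. asc_at \<omega> k \<and> psum \<omega> k \<le> x)"
  unfolding ascending_time_eq[symmetric] by (cases "ascending_time coord \<omega>") (auto simp: walk_coord)

lemma descending_event_iff:
  "(descending_time coord \<omega> < \<infinity> \<and> walk coord (the_enat (descending_time coord \<omega>)) \<omega> \<le> x) \<longleftrightarrow>
    (\<exists>k. desc_at \<omega> k \<and> psum \<omega> k \<le> x)"
  unfolding descending_time_eq[symmetric] by (cases "descending_time coord \<omega>") (auto simp: walk_coord)

lemma measurable_asc_event:
  "Measurable.pred S (\<lambda>\<omega>. ascending_time coord \<omega> < \<infinity> \<and> walk coord (the_enat (ascending_time coord \<omega>)) \<omega> \<le> x)"
  unfolding ascending_event_iff by measurable
lemma measurable_desc_event:
  "Measurable.pred S (\<lambda>\<omega>. descending_time coord \<omega> < \<infinity> \<and> walk coord (the_enat (descending_time coord \<omega>)) \<omega> \<le> x)"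
  unfolding descending_event_iff by measurable

lemma asc_law_cdf:
  "cdf asc_law x = measure S {\<omega>. ascending_time coord \<omega> < \<infinity> \<and> walk coord (the_enat (ascending_time coord \<omega>)) \<omega> \<le> x}"
  unfolding ascending_event_iff
  by (simp add: cdf_def measure_def emeasure_asc_law)
lemma desc_law_cdf:
  "cdf desc_law x = measure S {\<omega>. descending_time coord \<omega> < \<infinity> \<and> walk coord (the_enat (descending_time coord \<omega>)) \<omega> \<le> x}"
  unfolding descending_event_iff
  by (simp add: cdf_def measure_def emeasure_desc_law)

text \<open>The walk started afresh at its first ladder epoch is independent of the past and has the same
  maximum law, so \<open>M\<close> is either 0 or a ladder height plus an independent copy of \<open>M\<close>.\<close>

lemma ladder_decomposition:
  fixes f :: "real \<Rightarrow> ennreal"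
  assumes [measurable]: "f \<in> borel_measurable borel"
  shows "(\<integral>\<^sup>+z. f z \<partial>max_law) = never_prob * f 0 + (\<integral>\<^sup>+y. \<integral>\<^sup>+z. f (y + z) \<partial>max_law \<partial>asc_law)"
proof -
  have [measurable]: "{\<omega>. ascending_time coord \<omega> = \<infinity>} \<in> sets S" "\<And>k. {\<omega>. asc_at \<omega> k} \<in> sets S"
    by (auto intro!: sets_Collect_pred)
  have part: "(\<integral>\<^sup>+\<omega>. f (maxval \<omega>) * indicator {\<omega>. asc_at \<omega> k} \<omega> \<partial>S) =
      (\<integral>\<^sup>+\<omega>. (\<integral>\<^sup>+z. f (psum \<omega> k + z) \<partial>max_law) * indicator {\<omega>. asc_at \<omega> k} \<omega> \<partial>S)" for k
  proof -
    have "(\<integral>\<^sup>+\<omega>. f (maxval \<omega>) * indicator {\<omega>. asc_at \<omega> k} \<omega> \<partial>S) =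
       (\<integral>\<^sup>+\<omega>. \<integral>\<^sup>+\<omega>'. f (maxval (comb_seq k \<omega> \<omega>')) * indicator {\<omega>. asc_at \<omega> k} (comb_seq k \<omega> \<omega>') \<partial>S \<partial>S)"
      by (rule nn_integral_split_at) measurable
    also have "\<dots> = (\<integral>\<^sup>+\<omega>. \<integral>\<^sup>+\<omega>'. f (psum \<omega> k + maxval \<omega>') * indicator {\<omega>. asc_at \<omega> k} \<omega> \<partial>S \<partial>S)"
    proof (rule nn_integral_cong, rule nn_integral_cong_AE)
      fix \<omega>
      show "AE \<omega>' in S. f (maxval (comb_seq k \<omega> \<omega>')) * indicator {\<omega>. asc_at \<omega> k} (comb_seq k \<omega> \<omega>') =
         f (psum \<omega> k + maxval \<omega>') * indicator {\<omega>. asc_at \<omega> k} \<omega>"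
        using AE_maxval
      proof eventually_elim
        case (elim \<omega>')
        show ?case
        proof (cases "asc_at \<omega> k")
          case True
          then have "maxval (comb_seq k \<omega> \<omega>') = psum \<omega> k + maxval \<omega>'"
            unfolding maxval_def[of "comb_seq k \<omega> \<omega>'"] walk_max_comb_seq[OF True] elim by simp
          then show ?thesis using True by (simp add: asc_at_comb_seq)
        qed (simp add: asc_at_comb_seq)
      qed
    qed
    also have "\<dots> = (\<integral>\<^sup>+\<omega>. (\<integral>\<^sup>+\<omega>'. f (psum \<omega> k + maxval \<omega>') \<partial>S) * indicator {\<omega>. asc_at \<omega> k} \<omega> \<partial>S)"
      by (intro nn_integral_cong nn_integral_multc) auto
    also have "\<dots> = (\<integral>\<^sup>+\<omega>. (\<integral>\<^sup>+z. f (psum \<omega> k + z) \<partial>max_law) * indicator {\<omega>. asc_at \<omega> k} \<omega> \<partial>S)"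
      by (subst nn_integral_max_law) auto
    finally show ?thesis .
  qed
  have "(\<integral>\<^sup>+z. f z \<partial>max_law) = (\<integral>\<^sup>+\<omega>. f (maxval \<omega>) \<partial>S)" by (simp add: nn_integral_max_law)
  also have "\<dots> = (\<integral>\<^sup>+\<omega>. f 0 * indicator {\<omega>. ascending_time coord \<omega> = \<infinity>} \<omega> +
      (\<Sum>k. f (maxval \<omega>) * indicator {\<omega>. asc_at \<omega> k} \<omega>) \<partial>S)"
  proof (rule nn_integral_cong_AE)
    show "AE \<omega> in S. f (maxval \<omega>) = f 0 * indicator {\<omega>. ascending_time coord \<omega> = \<infinity>} \<omega> +
      (\<Sum>k. f (maxval \<omega>) * indicator {\<omega>. asc_at \<omega> k} \<omega>)"
      using AE_maxval
    proof eventually_elim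
      case (elim \<omega>)
      show ?case
      proof (cases "ascending_time coord \<omega> = \<infinity>")
        case True
        then have "maxval \<omega> \<le> 0" using elim by (simp flip: walk_max_le_0_iff)
        then have "maxval \<omega> = 0" using maxval_nonneg[of \<omega>] by simp
        then show ?thesis using True by (simp add: never_eq)
      next
        case False
        then obtain k where k: "asc_at \<omega> k" by (auto simp: never_eq)
        then have "(\<Sum>k. f (maxval \<omega>) * indicator {\<omega>. asc_at \<omega> k} \<omega>) = f (maxval \<omega>)"
          using asc_at_unique by (subst suminf_finite[of "{k}"]) (auto split: split_indicator)
        then show ?thesis using False by simp
      qed
    qed
  qed
  also have "\<dots> = f 0 * never_prob + (\<Sum>k. \<integral>\<^sup>+\<omega>. f (maxval \<omega>) * indicator {\<omega>. asc_at \<omega> k} \<omega> \<partial>S)"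
    by (subst nn_integral_add, measurable, subst nn_integral_suminf, measurable)
      (simp add: nn_integral_cmult_indicator emeasure_never)
  also have "\<dots> = f 0 * never_prob + (\<integral>\<^sup>+y. \<integral>\<^sup>+z. f (y + z) \<partial>max_law \<partial>asc_law)"
    by (subst nn_integral_asc_law) (auto simp: part)
  finally show ?thesis by (simp add: mult.commute)
qed

end

section \<open>The maximum and the walk killed outside the positive half-line\<close>

locale random_walk_negative_drift = random_walk_finite_max +
  assumes integrable_step: "integrable N (\<lambda>y. y)"
    and negative_mean: "(\<integral>y. y \<partial>N) < 0"
begin

text \<open>The transition operator of the walk that is killed when it leaves \<open>(0, \<infinity>)\<close>; \<open>visits n\<close> is the law of
the position of that walk, started at 0, after \<open>n\<close> steps.\<close>

definition kill_op :: "(real \<Rightarrow> ennreal) \<Rightarrow> real \<Rightarrow> ennreal" where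
  "kill_op f z = (\<integral>\<^sup>+y. f (z + y) * indicator {0<..} (z + y) \<partial>N)"

definition visits :: "nat \<Rightarrow> (real \<Rightarrow> ennreal) \<Rightarrow> ennreal" where
  "visits n f = (\<integral>\<^sup>+\<omega>. f (psum \<omega> n) * indicator {\<omega>. positive_upto \<omega> n} \<omega> \<partial>S)"

lemma emeasure_step_UNIV [simp]: "emeasure N UNIV = 1"
  using N.emeasure_space_1 by simp

lemma measurable_kill_op [measurable]:
  assumes [measurable]: "f \<in> borel_measurable borel"
  shows "kill_op f \<in> borel_measurable borel"
  unfolding kill_op_def by measurable

lemma measurable_kill_op_power [measurable]:
  "f \<in> borel_measurable borel \<Longrightarrow> (kill_op ^^ n) f \<in> borel_measurable borel"
  by (induction n) auto

lemma kill_op_mono: "(\<And>z. 0 < z \<Longrightarrow> f z \<le> g z) \<Longrightarrow> kill_op f z \<le> kill_op g z"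
  unfolding kill_op_def by (intro nn_integral_mono) (auto split: split_indicator)

lemma last_step:
  fixes g :: "real \<Rightarrow> ennreal"
  assumes [measurable]: "g \<in> borel_measurable borel"
  shows "(\<integral>\<^sup>+\<omega>. g (psum \<omega> (Suc n)) * indicator {\<omega>. positive_upto \<omega> n} \<omega> \<partial>S) =
    visits n (\<lambda>z. \<integral>\<^sup>+y. g (z + y) \<partial>N)"
proof -
  have [measurable]: "{\<omega>. positive_upto \<omega> n} \<in> sets S" by (intro sets_Collect_pred) measurable
  have "(\<integral>\<^sup>+\<omega>. g (psum \<omega> (Suc n)) * indicator {\<omega>. positive_upto \<omega> n} \<omega> \<partial>S) =
     (\<integral>\<^sup>+\<omega>. \<integral>\<^sup>+\<omega>'. g (psum (comb_seq n \<omega> \<omega>') (Suc n)) * indicator {\<omega>. positive_upto \<omega> n} (comb_seq n \<omega> \<omega>') \<partial>S \<partial>S)"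
    by (rule nn_integral_split_at) measurable
  also have "\<dots> = (\<integral>\<^sup>+\<omega>. \<integral>\<^sup>+\<omega>'. g (psum \<omega> n + \<omega>' 0) * indicator {\<omega>. positive_upto \<omega> n} \<omega> \<partial>S \<partial>S)"
  proof (intro nn_integral_cong)
    fix \<omega> \<omega>'
    have "psum (comb_seq n \<omega> \<omega>') (Suc n) = psum \<omega> n + \<omega>' 0"
      using psum_comb_seq(2)[of n \<omega> \<omega>' 1] by (simp del: psum_simps(2) add: psum_simps(2)[of \<omega>' 0])
    then show "g (psum (comb_seq n \<omega> \<omega>') (Suc n)) * indicator {\<omega>. positive_upto \<omega> n} (comb_seq n \<omega> \<omega>') =
      g (psum \<omega> n + \<omega>' 0) * indicator {\<omega>. positive_upto \<omega> n} \<omega>"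
      by (simp add: indicator_def positive_upto_comb_seq del: psum_simps)
  qed
  also have "\<dots> = (\<integral>\<^sup>+\<omega>. (\<integral>\<^sup>+\<omega>'. g (psum \<omega> n + \<omega>' 0) \<partial>S) * indicator {\<omega>. positive_upto \<omega> n} \<omega> \<partial>S)"
    by (intro nn_integral_cong nn_integral_multc) auto
  also have "\<dots> = visits n (\<lambda>z. \<integral>\<^sup>+y. g (z + y) \<partial>N)"
    unfolding visits_def
    by (intro nn_integral_cong arg_cong2[where f="(*)"] refl nn_integral_component) measurable
  finally show ?thesis .
qed

lemma visits_0: "visits 0 f = f 0"
  unfolding visits_def by (simp add: positive_upto_def P.emeasure_space_1[simplified])

lemma visits_Suc:
  assumes [measurable]: "f \<in> borel_measurable borel"
  shows "visits (Suc n) f = visits n (kill_op f)"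
proof -
  have "visits (Suc n) f = (\<integral>\<^sup>+\<omega>. (f (psum \<omega> (Suc n)) * indicator {0<..} (psum \<omega> (Suc n))) * indicator {\<omega>. positive_upto \<omega> n} \<omega> \<partial>S)"
    unfolding visits_def
    by (intro nn_integral_cong) (auto simp: positive_upto_Suc simp del: psum_simps split: split_indicator)
  also have "\<dots> = visits n (kill_op f)"
    unfolding kill_op_def by (rule last_step) measurable
  finally show ?thesis .
qed

text \<open>Iteration of Lindley's equation; the last term is what is left after \<open>n\<close> rounds.\<close>

lemma max_law_expand:
  assumes "f \<in> borel_measurable borel"
  shows "(\<integral>\<^sup>+z. f z \<partial>max_law) = never_prob * (\<Sum>j<n. visits j f) + (\<integral>\<^sup>+z. (kill_op ^^ n) f z \<partial>max_law)"
  using assms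
proof (induction n arbitrary: f)
  case (Suc n)
  have [measurable]: "f \<in> borel_measurable borel" by fact
  have "(\<integral>\<^sup>+z. f z \<partial>max_law) = never_prob * f 0 + (\<integral>\<^sup>+z. kill_op f z \<partial>max_law)"
    unfolding kill_op_def by (rule nn_integral_Lindley_split) fact
  also have "(\<integral>\<^sup>+z. kill_op f z \<partial>max_law) = never_prob * (\<Sum>j<n. visits j (kill_op f)) + (\<integral>\<^sup>+z. (kill_op ^^ n) (kill_op f) z \<partial>max_law)"
    by (rule Suc.IH) measurable
  also have "(\<Sum>j<n. visits j (kill_op f)) = (\<Sum>j<n. visits (Suc j) f)"
    by (simp add: visits_Suc)
  finally show ?case
    by (simp only: sum.lessThan_Suc_shift visits_0 funpow_Suc_right comp_def distrib_left add.assoc)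
qed simp

text \<open>Cutting the steps off from below keeps the drift negative and makes \<open>z + c\<close> nonnegative one step after
leaving the half-line, which is needed for a nonnegative potential.\<close>

lemma truncated_mean: "\<exists>c e. 0 < c \<and> 0 < e \<and> (\<integral>y. max y (- c) \<partial>N) \<le> - e"
proof -
  have "(\<lambda>n. \<integral>y. max y (- real n) \<partial>N) \<longlonglongrightarrow> (\<integral>y. y \<partial>N)"
  proof (rule integral_dominated_convergence[where w="\<lambda>y. \<bar>y\<bar>"])
    show "AE y in N. (\<lambda>n. max y (- real n)) \<longlonglongrightarrow> y"
    proof (rule AE_I2)
      fix y :: real
      obtain k where k: "- y \<le> real k" using real_arch_simple by blast
      have "max y (- real n) = y" if "k \<le> n" for n
        using k that by (intro max_absorb1) (meson le_minus_iff minus_le_iff of_nat_le_iff order_trans)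
      then show "(\<lambda>n. max y (- real n)) \<longlonglongrightarrow> y"
        by (intro tendsto_eventually eventually_sequentiallyI[of k]) auto
    qed
    show "integrable N (\<lambda>y. \<bar>y\<bar>)" using integrable_step by simp
  qed auto
  then have "\<forall>\<^sub>F n in sequentially. (\<integral>y. max y (- real n) \<partial>N) < (\<integral>y. y \<partial>N) / 2"
    using negative_mean by (intro order_tendstoD(2)) auto
  then have "\<forall>\<^sub>F n in sequentially. (\<integral>y. max y (- real n) \<partial>N) < (\<integral>y. y \<partial>N) / 2 \<and> 0 < n"
    using eventually_gt_at_top[of 0] by eventually_elim simp
  then obtain n :: nat where "0 < n" "(\<integral>y. max y (- real n) \<partial>N) < (\<integral>y. y \<partial>N) / 2"
    by (auto simp: eventually_sequentially)
  then show ?thesis using negative_mean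
    by (intro exI[of _ "real n"] exI[of _ "- (\<integral>y. y \<partial>N) / 2"]) auto
qed

lemma kill_op_power_le_1: "(kill_op ^^ n) (\<lambda>_. 1) z \<le> 1"
proof (induction n arbitrary: z)
  case (Suc n)
  have "kill_op ((kill_op ^^ n) (\<lambda>_. 1)) z \<le> (\<integral>\<^sup>+y. 1 \<partial>N)"
    unfolding kill_op_def[of "(kill_op ^^ n) (\<lambda>_. 1)"] using Suc by (intro nn_integral_mono) (auto split: split_indicator)
  then show ?case by simp
qed simp

text \<open>The killed walk dies out: the potential \<open>z + c\<close> decreases by at least \<open>e\<close> in mean at each step, so that
survival for \<open>n\<close> steps has probability at most \<open>(z + c) / (n * e)\<close>.\<close>

lemma kill_op_power_tendsto_0:
  assumes "0 \<le> z"
  shows "(\<lambda>n. (kill_op ^^ n) (\<lambda>_. 1) z) \<longlonglongrightarrow> 0"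
proof -
  obtain c e where ce: "0 < c" "0 < e" "(\<integral>y. max y (- c) \<partial>N) \<le> - e"
    using truncated_mean by blast
  have [simp]: "integrable N (\<lambda>y. max y (- c))"
    using integrable_step by (intro integrable_max) auto
  have drift: "kill_op (\<lambda>z. ennreal (z + c)) z + ennreal e \<le> ennreal (z + c)" if "0 \<le> z" for z
  proof -
    have "kill_op (\<lambda>z. ennreal (z + c)) z \<le> (\<integral>\<^sup>+y. ennreal (z + c + max y (- c)) \<partial>N)"
      unfolding kill_op_def by (intro nn_integral_mono) (auto split: split_indicator intro!: ennreal_leI)
    also have "\<dots> = ennreal (\<integral>y. z + c + max y (- c) \<partial>N)"
      using that ce by (intro nn_integral_eq_integral) auto
    also have "(\<integral>y. z + c + max y (- c) \<partial>N) = z + c + (\<integral>y. max y (- c) \<partial>N)"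
      by (simp add: N.prob_space[simplified])
    finally have 1: "kill_op (\<lambda>z. ennreal (z + c)) z \<le> ennreal (z + c + (\<integral>y. max y (- c) \<partial>N))" .
    have "0 \<le> (\<integral>y. z + c + max y (- c) \<partial>N)"
      using that ce by (intro integral_nonneg_AE) auto
    then have "0 \<le> z + c + (\<integral>y. max y (- c) \<partial>N)"
      by (simp add: N.prob_space[simplified])
    then have "ennreal (z + c + (\<integral>y. max y (- c) \<partial>N)) + ennreal e = ennreal (z + c + (\<integral>y. max y (- c) \<partial>N) + e)"
      using ce by (intro ennreal_plus[symmetric]) auto
    also have "\<dots> \<le> ennreal (z + c)"
      using ce by (intro ennreal_leI) auto
    finally have "ennreal (z + c + (\<integral>y. max y (- c) \<partial>N)) + ennreal e \<le> ennreal (z + c)" .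
    then show ?thesis using 1 by (meson add_right_mono order_trans)
  qed
  have bound: "ennreal (real n * e) * (kill_op ^^ n) (\<lambda>_. 1) z \<le> ennreal (z + c)" if "0 \<le> z" for z n
    using that
  proof (induction n arbitrary: z)
    case (Suc n)
    let ?f = "(kill_op ^^ n) (\<lambda>_. 1)"
    have [measurable]: "?f \<in> borel_measurable borel" by (rule measurable_kill_op_power) simp
    have "ennreal (real (Suc n) * e) * kill_op ?f z = ennreal (real n * e) * kill_op ?f z + ennreal e * kill_op ?f z"
      using ce by (simp add: distrib_right ennreal_plus flip: ennreal_plus)
        (simp add: ennreal_plus distrib_right)
    also have "ennreal (real n * e) * kill_op ?f z = kill_op (\<lambda>z. ennreal (real n * e) * ?f z) z"
      unfolding kill_op_def[of ?f] kill_op_def[of "\<lambda>z. ennreal (real n * e) * ?f z"]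
      by (subst nn_integral_cmult[symmetric]) (auto simp: mult.assoc)
    also have "\<dots> \<le> kill_op (\<lambda>z. ennreal (z + c)) z"
      by (rule kill_op_mono) (use Suc.IH in auto)
    also have "ennreal e * kill_op ?f z \<le> ennreal e * 1"
      using kill_op_power_le_1[of "Suc n" z] by (intro mult_left_mono) auto
    also have "kill_op (\<lambda>z. ennreal (z + c)) z + ennreal e * 1 \<le> ennreal (z + c)"
      using drift Suc.prems by simp
    finally show ?case by (auto intro: add_mono)
  qed simp
  have "(kill_op ^^ n) (\<lambda>_. 1) z \<le> ennreal ((z + c) / e / real n)" if "0 < n" for n
  proof -
    have fin: "(kill_op ^^ n) (\<lambda>_. 1) z = ennreal (enn2real ((kill_op ^^ n) (\<lambda>_. 1) z))"
      using kill_op_power_le_1[of n z] by (intro ennreal_enn2real[symmetric]) (auto simp: order_le_less_trans)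
    have "ennreal (real n * e * enn2real ((kill_op ^^ n) (\<lambda>_. 1) z)) \<le> ennreal (z + c)"
      using bound[OF assms, of n] ce by (subst ennreal_mult) (auto simp flip: fin)
    then have "real n * e * enn2real ((kill_op ^^ n) (\<lambda>_. 1) z) \<le> z + c"
      using assms ce by (subst (asm) ennreal_le_iff) auto
    then have "enn2real ((kill_op ^^ n) (\<lambda>_. 1) z) \<le> (z + c) / e / real n"
      using ce that by (simp add: field_simps)
    then show ?thesis by (subst fin) (rule ennreal_leI)
  qed
  then have le: "\<forall>\<^sub>F n in sequentially. (kill_op ^^ n) (\<lambda>_. 1) z \<le> ennreal ((z + c) / e / real n)"
    by (intro eventually_sequentiallyI[of 1]) auto
  have "(\<lambda>n. (z + c) / e / real n) \<longlonglongrightarrow> 0"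
    by (rule lim_const_over_n)
  then have "(\<lambda>n. ennreal ((z + c) / e / real n)) \<longlonglongrightarrow> ennreal 0"
    by (rule tendsto_ennrealI)
  then show ?thesis
    by (intro tendsto_sandwich[OF _ le tendsto_const]) auto
qed

text \<open>Since the killed walk dies out, the remainder in \<open>max_law_expand\<close> vanishes, and Lindley's equation has
only one solution. This plays the part of the duality between the maximum and the minimum of the
walk.\<close>

lemma max_law_eq_visits:
  assumes [measurable]: "f \<in> borel_measurable borel" and f: "\<And>z. f z \<le> 1"
  shows "(\<integral>\<^sup>+z. f z \<partial>max_law) = never_prob * (\<Sum>j. visits j f)"
proof -
  have "(\<lambda>n. \<integral>\<^sup>+z. (kill_op ^^ n) (\<lambda>_. 1) z \<partial>max_law) \<longlonglongrightarrow> (\<integral>\<^sup>+z. 0 \<partial>max_law)"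
  proof (rule nn_integral_dominated_convergence[where w="\<lambda>_. 1"])
    show "AE z in max_law. (\<lambda>n. (kill_op ^^ n) (\<lambda>_. 1) z) \<longlonglongrightarrow> 0"
      using AE_max_law_nonneg by eventually_elim (rule kill_op_power_tendsto_0)
    show "(kill_op ^^ j) (\<lambda>_. 1) \<in> borel_measurable max_law" for j
      using measurable_kill_op_power[of "\<lambda>_. 1" j] by (simp cong: measurable_cong_sets)
  qed (auto simp: kill_op_power_le_1 max_law.emeasure_space_1[simplified])
  then have lim1: "(\<lambda>n. \<integral>\<^sup>+z. (kill_op ^^ n) (\<lambda>_. 1) z \<partial>max_law) \<longlonglongrightarrow> 0" by simp
  have mono: "(kill_op ^^ n) f z \<le> (kill_op ^^ n) (\<lambda>_. 1) z" for n z
    by (induction n arbitrary: z) (auto simp: f intro!: kill_op_mono)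
  have lim: "(\<lambda>n. \<integral>\<^sup>+z. (kill_op ^^ n) f z \<partial>max_law) \<longlonglongrightarrow> 0"
    by (rule tendsto_sandwich[OF _ _ tendsto_const lim1]) (intro always_eventually allI zero_le nn_integral_mono mono)+
  have "(\<lambda>n. never_prob * (\<Sum>j<n. visits j f) + (\<integral>\<^sup>+z. (kill_op ^^ n) f z \<partial>max_law)) \<longlonglongrightarrow> never_prob * (\<Sum>j. visits j f) + 0"
    by (intro tendsto_add lim ennreal_tendsto_cmult summable_LIMSEQ) auto
  moreover have "(\<lambda>n. never_prob * (\<Sum>j<n. visits j f) + (\<integral>\<^sup>+z. (kill_op ^^ n) f z \<partial>max_law)) = (\<lambda>n. \<integral>\<^sup>+z. f z \<partial>max_law)"
    using max_law_expand[of f] by simp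
  ultimately show ?thesis
    by (simp add: LIMSEQ_const_iff)
qed

lemma never_prob_pos: "0 < never_prob"
proof -
  have "(\<integral>\<^sup>+z. 1 \<partial>max_law) = never_prob * (\<Sum>j. visits j (\<lambda>_. 1))"
    by (rule max_law_eq_visits) auto
  then have "never_prob \<noteq> 0" using max_law.emeasure_space_1 by auto
  then show ?thesis unfolding never_prob_def by (simp add: order_less_le)
qed

text \<open>The first descending ladder height is the step by which the killed walk leaves \<open>(0, \<infinity>)\<close>. Summing over
the time of that step and inserting \<open>max_law_eq_visits\<close>, its law times \<open>never_prob\<close> is the law of
\<open>M + X\<close> on \<open>(-\<infinity>, 0]\<close>. The identity is first proved for sets, as \<open>max_law_eq_visits\<close> asks for
bounded functions.\<close>

lemma nn_integral_never_prob_desc_law: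
  fixes f :: "real \<Rightarrow> ennreal"
  assumes [measurable]: "f \<in> borel_measurable borel" 
  shows "never_prob * (\<integral>\<^sup>+x. f x \<partial>desc_law) = (\<integral>\<^sup>+z. \<integral>\<^sup>+y. f (z + y) * indicator {..0} (z + y) \<partial>N \<partial>max_law)"
proof -
  define R where "R = distr (density (max_law \<Otimes>\<^sub>M N) (\<lambda>(z, y). indicator {..0} (z + y))) borel (\<lambda>(z, y). z + y)"
  have R: "(\<integral>\<^sup>+x. g x \<partial>R) = (\<integral>\<^sup>+z. \<integral>\<^sup>+y. g (z + y) * indicator {..0} (z + y) \<partial>N \<partial>max_law)"
    if [measurable]: "g \<in> borel_measurable borel" for g :: "real \<Rightarrow> ennreal"
  proof -
    have "(\<integral>\<^sup>+x. g x \<partial>R) = (\<integral>\<^sup>+x. (case x of (z, y) \<Rightarrow> g (z + y) * indicator {..0} (z + y)) \<partial>(max_law \<Otimes>\<^sub>M N))"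
      unfolding R_def by (simp add: nn_integral_distr nn_integral_density split_beta' mult.commute)
    also have "\<dots> = (\<integral>\<^sup>+z. \<integral>\<^sup>+y. g (z + y) * indicator {..0} (z + y) \<partial>N \<partial>max_law)"
      by (subst N.nn_integral_fst[symmetric]) (auto simp: split_beta')
    finally show ?thesis .
  qed
  have "scale_measure never_prob desc_law = R"
  proof (rule measure_eqI)
    show "sets (scale_measure never_prob desc_law) = sets R" by (simp add: R_def)
    fix A assume "A \<in> sets (scale_measure never_prob desc_law)"
    then have [measurable]: "A \<in> sets borel" by simp
    define J where "J z = (\<integral>\<^sup>+y. indicator A (z + y) * indicator {..0} (z + y) \<partial>N :: ennreal)" for z :: real
    have [measurable]: "J \<in> borel_measurable borel" unfolding J_def by measurable
    have "J z \<le> (\<integral>\<^sup>+y. 1 \<partial>N)" for z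
      unfolding J_def by (intro nn_integral_mono) (auto split: split_indicator)
    then have J1: "J z \<le> 1" for z by simp
    have "emeasure desc_law A = (\<integral>\<^sup>+x. indicator A x \<partial>desc_law)" by simp
    also have "\<dots> = (\<Sum>k. \<integral>\<^sup>+\<omega>. indicator A (psum \<omega> k) * indicator {\<omega>. desc_at \<omega> k} \<omega> \<partial>S)"
      by (rule nn_integral_desc_law) measurable
    also have "\<dots> = (\<Sum>k. \<integral>\<^sup>+\<omega>. indicator A (psum \<omega> (Suc k)) * indicator {\<omega>. desc_at \<omega> (Suc k)} \<omega> \<partial>S)"
    proof -
      have "(\<integral>\<^sup>+\<omega>. indicator A (psum \<omega> 0) * indicator {\<omega>. desc_at \<omega> 0} \<omega> \<partial>S) = 0" by (simp add: desc_at_def)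
      then show ?thesis
        using suminf_offset[of "\<lambda>k. \<integral>\<^sup>+\<omega>. indicator A (psum \<omega> k) * indicator {\<omega>. desc_at \<omega> k} \<omega> \<partial>S" 1]
        by (simp del: psum_simps)
    qed
    also have "\<dots> = (\<Sum>k. \<integral>\<^sup>+\<omega>. (indicator A (psum \<omega> (Suc k)) * indicator {..0} (psum \<omega> (Suc k))) * indicator {\<omega>. positive_upto \<omega> k} \<omega> \<partial>S)"
      by (intro suminf_cong nn_integral_cong)
        (auto simp: desc_at_Suc simp del: psum_simps split: split_indicator)
    also have "\<dots> = (\<Sum>k. visits k J)"
      unfolding J_def by (intro suminf_cong last_step) measurable
    finally have "never_prob * emeasure desc_law A = (\<integral>\<^sup>+z. J z \<partial>max_law)"
      using max_law_eq_visits[of J] J1 by simp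
    also have "\<dots> = emeasure R A"
      unfolding J_def by (subst R[symmetric]) (auto simp: R_def)
    finally show "emeasure (scale_measure never_prob desc_law) A = emeasure R A"
      by simp
  qed
  then have "(\<integral>\<^sup>+x. f x \<partial>scale_measure never_prob desc_law) = (\<integral>\<^sup>+x. f x \<partial>R)" by simp
  moreover have "f \<in> borel_measurable desc_law"
    using assms by (simp cong: measurable_cong_sets)
  ultimately show ?thesis by (simp add: R nn_integral_scale_measure)
qed

end

section \<open>Moments of the maximum and of the ladder heights\<close>

lemma abs_power_diff_le:
  fixes a b c :: real
  assumes "\<bar>a\<bar> \<le> c" "\<bar>b\<bar> \<le> c"
  shows "\<bar>a ^ Suc j - b ^ Suc j\<bar> \<le> real (Suc j) * \<bar>a - b\<bar> * c ^ j"
proof (induction j)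
  case (Suc j)
  have c: "0 \<le> c" using assms by linarith
  have "\<bar>a ^ Suc (Suc j) - b ^ Suc (Suc j)\<bar> = \<bar>a * (a ^ Suc j - b ^ Suc j) + (a - b) * b ^ Suc j\<bar>"
    by (simp add: algebra_simps)
  also have "\<dots> \<le> \<bar>a\<bar> * \<bar>a ^ Suc j - b ^ Suc j\<bar> + \<bar>a - b\<bar> * \<bar>b\<bar> ^ Suc j"
    by (metis abs_mult abs_triangle_ineq power_abs)
  also have "\<dots> \<le> c * (real (Suc j) * \<bar>a - b\<bar> * c ^ j) + \<bar>a - b\<bar> * c ^ Suc j"
    using Suc assms c by (intro add_mono mult_mono mult_left_mono power_mono) auto
  also have "\<dots> = real (Suc (Suc j)) * \<bar>a - b\<bar> * c ^ Suc j" by (simp add: algebra_simps)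
  finally show ?case .
qed simp

lemma (in pair_sigma_finite) product_integral:
  fixes f g :: "_ \<Rightarrow> real"
  assumes "integrable M1 f" "integrable M2 g"
  shows "integrable (M1 \<Otimes>\<^sub>M M2) (\<lambda>(x, y). f x * g y)"
    and "(\<integral>(x, y). f x * g y \<partial>(M1 \<Otimes>\<^sub>M M2)) = (\<integral>x. f x \<partial>M1) * (\<integral>y. g y \<partial>M2)"
proof -
  have [measurable]: "f \<in> borel_measurable M1" "g \<in> borel_measurable M2"
    using assms by auto
  show *: "integrable (M1 \<Otimes>\<^sub>M M2) (\<lambda>(x, y). f x * g y)"
    by (rule Fubini_integrable) (use assms in \<open>auto simp: abs_mult split_beta'\<close>)
  show "(\<integral>(x, y). f x * g y \<partial>(M1 \<Otimes>\<^sub>M M2)) = (\<integral>x. f x \<partial>M1) * (\<integral>y. g y \<partial>M2)"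
    by (subst integral_fst[symmetric, OF *]) simp
qed

context random_walk_negative_drift
begin

abbreviation "step_pair \<equiv> max_law \<Otimes>\<^sub>M N"

sublocale step_pair: pair_prob_space max_law N ..

sublocale asc_law: finite_measure asc_law
  by (rule finite_borel_measure.axioms(1)[OF finite_borel_measure_asc_law])
sublocale desc_law: finite_measure desc_law
  by (rule finite_borel_measure.axioms(1)[OF finite_borel_measure_desc_law])

lemma AE_asc_law_pos: "AE y in asc_law. 0 < y"
proof -
  have "emeasure asc_law {..0} = emeasure S {\<omega>. \<exists>k. asc_at \<omega> k \<and> psum \<omega> k \<in> {..0}}"
    by (rule emeasure_asc_law) simp
  also have "{\<omega>. \<exists>k. asc_at \<omega> k \<and> psum \<omega> k \<in> {..0}} = {}"
    by (intro equals0I) (auto simp: asc_at_def)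
  finally have "emeasure asc_law {..0} = 0" by simp
  then have "{..0} \<in> null_sets asc_law" by auto
  then show ?thesis by (rule AE_I') auto
qed

lemma AE_desc_law_nonpos: "AE y in desc_law. y \<le> 0"
proof -
  have "emeasure desc_law {0<..} = emeasure S {\<omega>. \<exists>k. desc_at \<omega> k \<and> psum \<omega> k \<in> {0<..}}"
    by (rule emeasure_desc_law) simp
  also have "{\<omega>. \<exists>k. desc_at \<omega> k \<and> psum \<omega> k \<in> {0<..}} = {}"
    by (intro equals0I) (auto simp: desc_at_def)
  finally have "emeasure desc_law {0<..} = 0" by simp
  then have "{0<..} \<in> null_sets desc_law" by auto
  then show ?thesis by (rule AE_I') auto
qed

text \<open>Whenever the walk reaches a ladder height, \<open>M\<close> is at least that large; so the moments of \<open>M\<close> control it.\<close>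

lemma integrable_asc_law_power:
  assumes "integrable max_law (\<lambda>z. z ^ j)"
  shows "integrable asc_law (\<lambda>y. y ^ j)"
proof (rule integrableI_bounded)
  show "(\<lambda>y. y ^ j) \<in> borel_measurable asc_law" by measurable
  have "(\<integral>\<^sup>+y. ennreal (norm (y ^ j)) \<partial>asc_law) \<le> (\<integral>\<^sup>+y. \<integral>\<^sup>+z. ennreal \<bar>(y + z) ^ j\<bar> \<partial>max_law \<partial>asc_law)"
  proof (rule nn_integral_mono_AE)
    show "AE y in asc_law. ennreal (norm (y ^ j)) \<le> (\<integral>\<^sup>+z. ennreal \<bar>(y + z) ^ j\<bar> \<partial>max_law)"
      using AE_asc_law_pos
    proof eventually_elim
      case (elim y)
      have "ennreal (norm (y ^ j)) = (\<integral>\<^sup>+z. ennreal (norm (y ^ j)) \<partial>max_law)"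
        using max_law.emeasure_space_1 by simp
      also have "\<dots> \<le> (\<integral>\<^sup>+z. ennreal \<bar>(y + z) ^ j\<bar> \<partial>max_law)"
        by (rule nn_integral_mono_AE, rule AE_mp[OF AE_max_law_nonneg])
          (use elim in \<open>auto simp: power_abs intro!: ennreal_leI power_mono\<close>)
      finally show ?case .
    qed
  qed
  also have "\<dots> \<le> (\<integral>\<^sup>+z. ennreal \<bar>z ^ j\<bar> \<partial>max_law)"
    by (subst ladder_decomposition[of "\<lambda>z. ennreal \<bar>z ^ j\<bar>"]) auto
  also have "\<dots> < \<infinity>" using assms by (simp add: integrable_iff_bounded)
  finally show "(\<integral>\<^sup>+y. ennreal (norm (y ^ j)) \<partial>asc_law) < \<infinity>" .
qed

lemma max_law_moment_ladder:
  assumes "\<And>i. i \<le> j \<Longrightarrow> integrable max_law (\<lambda>z. z ^ i)"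
  shows "(\<integral>z. z ^ j \<partial>max_law) = never_prob * 0 ^ j +
    (\<Sum>i\<le>j. real (j choose i) * (\<integral>y. y ^ i \<partial>asc_law) * (\<integral>z. z ^ (j - i) \<partial>max_law))"
proof -
  have a: "integrable asc_law (\<lambda>y. y ^ i)" if "i \<le> j" for i
    using assms that by (intro integrable_asc_law_power) auto
  have nn: "0 \<le> (\<integral>z. z ^ i \<partial>max_law)" for i
    using AE_max_law_nonneg by (intro integral_nonneg_AE) auto
  have nna: "0 \<le> (\<integral>z. z ^ i \<partial>asc_law)" for i
    using AE_asc_law_pos by (intro integral_nonneg_AE) auto
  let ?I = "\<lambda>y. \<Sum>i\<le>j. real (j choose i) * y ^ i * (\<integral>z. z ^ (j - i) \<partial>max_law)"
  have "ennreal (\<integral>z. z ^ j \<partial>max_law) = (\<integral>\<^sup>+z. ennreal (z ^ j) \<partial>max_law)"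
    by (intro nn_integral_eq_integral[symmetric] assms order_refl) (use AE_max_law_nonneg in auto)
  also have "\<dots> = never_prob * ennreal (0 ^ j) + (\<integral>\<^sup>+y. \<integral>\<^sup>+z. ennreal ((y + z) ^ j) \<partial>max_law \<partial>asc_law)"
    by (rule ladder_decomposition) measurable
  also have "(\<integral>\<^sup>+y. \<integral>\<^sup>+z. ennreal ((y + z) ^ j) \<partial>max_law \<partial>asc_law) = (\<integral>\<^sup>+y. ennreal (?I y) \<partial>asc_law)"
  proof (rule nn_integral_cong_AE)
    show "AE y in asc_law. (\<integral>\<^sup>+z. ennreal ((y + z) ^ j) \<partial>max_law) = ennreal (?I y)"
      using AE_asc_law_pos
    proof eventually_elim
      case (elim y)
      have "(\<integral>\<^sup>+z. ennreal ((y + z) ^ j) \<partial>max_law) = ennreal (\<integral>z. (y + z) ^ j \<partial>max_law)"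
        by (intro nn_integral_eq_integral)
          (use elim AE_max_law_nonneg assms in
            \<open>auto simp: binomial_ring intro!: integrable_sum sum_nonneg elim!: AE_mp\<close>)
      also have "(\<integral>z. (y + z) ^ j \<partial>max_law) = ?I y"
        unfolding binomial_ring using assms
        by (subst Bochner_Integration.integral_sum) auto
      finally show ?case .
    qed
  qed
  also have "\<dots> = ennreal (\<integral>y. ?I y \<partial>asc_law)"
    by (intro nn_integral_eq_integral)
      (use AE_asc_law_pos a nn in \<open>auto intro!: integrable_sum sum_nonneg elim!: AE_mp\<close>)
  also have "(\<integral>y. ?I y \<partial>asc_law) = (\<Sum>i\<le>j. real (j choose i) * (\<integral>y. y ^ i \<partial>asc_law) * (\<integral>z. z ^ (j - i) \<partial>max_law))"
    using a by (subst Bochner_Integration.integral_sum) auto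
  finally have "ennreal (\<integral>z. z ^ j \<partial>max_law) = ennreal (never_prob * 0 ^ j +
    (\<Sum>i\<le>j. real (j choose i) * (\<integral>y. y ^ i \<partial>asc_law) * (\<integral>z. z ^ (j - i) \<partial>max_law)))"
    using never_prob_pos nn nna
    by (subst ennreal_plus) (auto simp: ennreal_mult intro!: sum_nonneg mult_nonneg_nonneg)
  then show ?thesis using nn nna never_prob_pos
    by (subst (asm) ennreal_inj) (auto intro!: add_nonneg_nonneg sum_nonneg mult_nonneg_nonneg)
qed

text \<open>An overshoot \<open>M + X \<le> 0\<close> with \<open>M \<ge> 0\<close> is at most \<open>\<bar>X\<bar>\<close> in absolute value.\<close>

lemma integrable_desc_law_power:
  assumes "integrable N (\<lambda>y. y ^ j)"
  shows "integrable desc_law (\<lambda>y. y ^ j)"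
proof (rule integrableI_bounded)
  show "(\<lambda>y. y ^ j) \<in> borel_measurable desc_law" by measurable
  have "never_prob * (\<integral>\<^sup>+y. ennreal (norm (y ^ j)) \<partial>desc_law) =
     (\<integral>\<^sup>+z. \<integral>\<^sup>+y. ennreal (norm ((z + y) ^ j)) * indicator {..0} (z + y) \<partial>N \<partial>max_law)"
    by (rule nn_integral_never_prob_desc_law) measurable
  also have "\<dots> \<le> (\<integral>\<^sup>+z. \<integral>\<^sup>+y. ennreal (norm (y ^ j)) \<partial>N \<partial>max_law)"
    by (rule nn_integral_mono_AE, rule AE_mp[OF AE_max_law_nonneg], rule AE_I2, rule impI, rule nn_integral_mono)
      (auto simp: power_abs split: split_indicator intro!: ennreal_leI power_mono)
  also have "\<dots> = (\<integral>\<^sup>+y. ennreal (norm (y ^ j)) \<partial>N)"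
    using max_law.emeasure_space_1 by simp
  also have "\<dots> < \<infinity>" using assms by (simp add: integrable_iff_bounded)
  finally show "(\<integral>\<^sup>+y. ennreal (norm (y ^ j)) \<partial>desc_law) < \<infinity>"
    using never_prob_pos by (auto simp: ennreal_mult_less_top)
qed

lemma max_law_eq_distr: "max_law = distr step_pair borel (\<lambda>(z, y). max 0 (z + y))"
proof (rule measure_eqI)
  fix A assume "A \<in> sets max_law"
  then have [measurable]: "A \<in> sets borel" by simp
  have "emeasure max_law A = (\<integral>\<^sup>+z. indicator A z \<partial>max_law)" by simp
  also have "\<dots> = (\<integral>\<^sup>+y. \<integral>\<^sup>+z. indicator A (max 0 (y + z)) \<partial>max_law \<partial>N)"
    by (rule Lindley) measurable
  also have "\<dots> = (\<integral>\<^sup>+z. \<integral>\<^sup>+y. indicator A (max 0 (y + z)) \<partial>N \<partial>max_law)"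
    by (rule step_pair.Fubini') measurable
  also have "\<dots> = (\<integral>\<^sup>+x. indicator A (case x of (z, y) \<Rightarrow> max 0 (z + y)) \<partial>step_pair)"
    by (subst N.nn_integral_fst[symmetric]) (auto simp: split_beta' add.commute)
  also have "\<dots> = (\<integral>\<^sup>+x. indicator A x \<partial>distr step_pair borel (\<lambda>(z, y). max 0 (z + y)))"
    by (rule nn_integral_distr[symmetric]) measurable
  also have "\<dots> = emeasure (distr step_pair borel (\<lambda>(z, y). max 0 (z + y))) A" by simp
  finally show "emeasure max_law A = emeasure (distr step_pair borel (\<lambda>(z, y). max 0 (z + y))) A" .
qed simp

lemma step_pair_AE_nonneg: "AE x in step_pair. 0 \<le> fst x"
proof -
  have "AE z in max_law. AE y in N. 0 \<le> fst (z, y)"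
    using AE_max_law_nonneg by eventually_elim simp
  then show ?thesis by (intro step_pair.AE_pair_measure) measurable
qed

lemma integral_overshoot:
  fixes l :: nat
  defines "j \<equiv> Suc l"
  assumes N: "\<And>i. i \<le> j \<Longrightarrow> integrable N (\<lambda>y. y ^ i)"
  shows "integrable step_pair (\<lambda>(z, y). (z + y) ^ j * indicat_real {..0} (z + y))"
    and "never_prob * (\<integral>y. y ^ j \<partial>desc_law) = (\<integral>(z, y). (z + y) ^ j * indicat_real {..0} (z + y) \<partial>step_pair)"
proof -
  define g :: "real \<Rightarrow> real" where "g x = (- x) ^ j * indicat_real {..0} x" for x
  have [measurable]: "g \<in> borel_measurable borel" unfolding g_def by measurable
  have g0: "0 \<le> g x" for x unfolding g_def by (auto split: split_indicator)
  have gpow: "(x::real) ^ j * indicat_real {..0} x = (-1) ^ j * g x" for x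
    unfolding g_def by (simp flip: power_mult_distrib mult.assoc)
  have gd: "integrable desc_law g"
  proof (rule Bochner_Integration.integrable_bound)
    show "integrable desc_law (\<lambda>y. y ^ j)" by (intro integrable_desc_law_power N) simp
  qed (auto simp: g_def power_abs split: split_indicator)
  have gN: "integrable step_pair (\<lambda>(z, y). g (z + y))"
  proof (rule Bochner_Integration.integrable_bound)
    show "integrable step_pair (\<lambda>(z, y). (\<lambda>_. 1) z * y ^ j)"
      by (rule step_pair.product_integral) (auto intro: N)
    show "AE x in step_pair. norm (case x of (z, y) \<Rightarrow> g (z + y)) \<le> norm (case x of (z, y) \<Rightarrow> (\<lambda>_. 1) z * y ^ j)"
      using step_pair_AE_nonneg
      by eventually_elim (auto simp: g_def power_abs split: split_indicator intro!: power_mono)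
  qed auto
  have "ennreal (never_prob * (\<integral>y. g y \<partial>desc_law)) = never_prob * (\<integral>\<^sup>+y. ennreal (g y) \<partial>desc_law)"
    using never_prob_pos g0 gd
    by (simp add: nn_integral_eq_integral ennreal_mult integral_nonneg_AE)
  also have "\<dots> = (\<integral>\<^sup>+z. \<integral>\<^sup>+y. ennreal (g (z + y)) * indicator {..0} (z + y) \<partial>N \<partial>max_law)"
    by (rule nn_integral_never_prob_desc_law) measurable
  also have "\<dots> = (\<integral>\<^sup>+z. \<integral>\<^sup>+y. ennreal (g (z + y)) \<partial>N \<partial>max_law)"
    by (intro nn_integral_cong) (auto simp: g_def split: split_indicator)
  also have "\<dots> = (\<integral>\<^sup>+x. ennreal (case x of (z, y) \<Rightarrow> g (z + y)) \<partial>step_pair)"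
    by (subst N.nn_integral_fst[symmetric]) (auto simp: split_beta')
  also have "\<dots> = ennreal (\<integral>(z, y). g (z + y) \<partial>step_pair)"
    using gN g0 by (intro nn_integral_eq_integral) (auto simp: split_beta')
  finally have eq: "never_prob * (\<integral>y. g y \<partial>desc_law) = (\<integral>(z, y). g (z + y) \<partial>step_pair)"
    using never_prob_pos g0
    by (subst (asm) ennreal_inj) (auto intro!: mult_nonneg_nonneg integral_nonneg_AE simp: split_beta')
  show "integrable step_pair (\<lambda>(z, y). (z + y) ^ j * indicat_real {..0} (z + y))"
    using integrable_mult_right[OF gN, of "(-1)^j"] unfolding gpow by (simp add: split_beta')
  have "(\<integral>y. y ^ j \<partial>desc_law) = (\<integral>y. (-1) ^ j * g y \<partial>desc_law)"
    by (rule integral_cong_AE) (use AE_desc_law_nonpos in \<open>auto simp: gpow[symmetric]\<close>)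
  then have "never_prob * (\<integral>y. y ^ j \<partial>desc_law) = (-1)^j * (never_prob * (\<integral>y. g y \<partial>desc_law))"
    by simp
  also have "\<dots> = (\<integral>(z, y). (z + y) ^ j * indicat_real {..0} (z + y) \<partial>step_pair)"
    unfolding eq gpow by (simp add: split_beta')
  finally show "never_prob * (\<integral>y. y ^ j \<partial>desc_law) = (\<integral>(z, y). (z + y) ^ j * indicat_real {..0} (z + y) \<partial>step_pair)" .
qed

text \<open>Formally this is \<open>E[(M + X) ^ j; M + X \<le> 0] = E[(M + X) ^ j] - E[M ^ j]\<close>, as \<open>M\<close> and \<open>max 0 (M + X)\<close> have
the same law. But \<open>M ^ j\<close> need not be integrable, only its lower powers are. So the identity is proved
with \<open>min _ K\<close> in place of the argument; the difference of the two truncated powers is dominated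
by \<open>j * \<bar>X\<bar> * (\<bar>M\<bar> + \<bar>X\<bar>) ^ l\<close>, which is integrable, and \<open>K\<close> tends to infinity.\<close>

lemma desc_law_moment:
  fixes l :: nat
  defines "j \<equiv> Suc l"
  assumes N: "\<And>i. i \<le> j \<Longrightarrow> integrable N (\<lambda>y. y ^ i)"
    and W: "\<And>i. i \<le> l \<Longrightarrow> integrable max_law (\<lambda>z. z ^ i)"
  shows "never_prob * (\<integral>y. y ^ j \<partial>desc_law) =
    (\<Sum>i\<le>l. real (j choose i) * (\<integral>z. z ^ i \<partial>max_law) * (\<integral>y. y ^ (j - i) \<partial>N))"
proof -
  let ?o = "\<lambda>(z, y). (z + y) ^ j * indicat_real {..0} (z + y)"
  have j: "j = Suc l" by (simp add: j_def)
  note ov = integral_overshoot[of l, folded j_def, OF N]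
  let ?f = "\<lambda>K x. (min x K) ^ j :: real"
  have trunc: "(\<integral>(z, y). ?f K (z + y) - ?f K z \<partial>step_pair) = (\<integral>x. ?o x \<partial>step_pair)" if "0 \<le> K" for K
  proof -
    have b: "\<bar>?f K (max 0 w)\<bar> \<le> K ^ j" for w
      using that by (subst power_abs) (intro power_mono, auto)
    have i1: "integrable step_pair (\<lambda>(z, y). ?f K (max 0 (z + y)))"
      by (rule step_pair.integrable_const_bound[of _ "K ^ j"]) (use b in auto)
    have iW: "integrable max_law (\<lambda>z. ?f K (max 0 z))"
      by (rule max_law.integrable_const_bound[of _ "K ^ j"]) (use b in auto)
    have "AE z in max_law. ?f K (max 0 z) = ?f K z" using AE_max_law_nonneg by eventually_elim simp
    then have iW': "integrable max_law (\<lambda>z. ?f K z)"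
      using iW by (subst (asm) integrable_cong_AE) auto
    have i2: "integrable step_pair (\<lambda>(z, y). ?f K z * 1)"
      and e2: "(\<integral>(z, y). ?f K z * 1 \<partial>step_pair) = (\<integral>z. ?f K z \<partial>max_law) * (\<integral>y. 1 \<partial>N)"
      by (rule step_pair.product_integral; use iW' in simp)+
    have sp: "?f K w = ?f K (max 0 w) + w ^ j * indicat_real {..0} w" for w
      using that by (auto simp: j max_def split: split_indicator)
    have "(\<integral>(z, y). ?f K (z + y) - ?f K z \<partial>step_pair) =
       (\<integral>x. (case x of (z, y) \<Rightarrow> ?f K (max 0 (z + y))) + ?o x - (case x of (z, y) \<Rightarrow> ?f K z * 1) \<partial>step_pair)"
    proof (rule Bochner_Integration.integral_cong[OF refl])
      fix x :: "real \<times> real"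
      obtain z y where x: "x = (z, y)" by (cases x)
      show "(case x of (z, y) \<Rightarrow> ?f K (z + y) - ?f K z) =
          (case x of (z, y) \<Rightarrow> ?f K (max 0 (z + y))) + ?o x - (case x of (z, y) \<Rightarrow> ?f K z * 1)"
        using sp[of "z + y"] unfolding x prod.case by linarith
    qed
    also have "\<dots> = (\<integral>(z, y). ?f K (max 0 (z + y)) \<partial>step_pair) + (\<integral>x. ?o x \<partial>step_pair) - (\<integral>(z, y). ?f K z * 1 \<partial>step_pair)"
      using i1 i2 ov(1) by (subst Bochner_Integration.integral_diff) auto
    also have "(\<integral>(z, y). ?f K (max 0 (z + y)) \<partial>step_pair) = (\<integral>z. ?f K z \<partial>max_law)"
      by (subst (2) max_law_eq_distr, subst integral_distr) (auto simp: split_beta')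
    finally show ?thesis unfolding e2 using N.prob_space by simp
  qed
  have "(\<lambda>n. \<integral>(z, y). ?f (real n) (z + y) - ?f (real n) z \<partial>step_pair) \<longlonglongrightarrow> (\<integral>(z, y). (z + y) ^ j - z ^ j \<partial>step_pair)"
  proof (rule integral_dominated_convergence[where w="\<lambda>(z, y). \<Sum>i\<le>l. (real j * real (l choose i)) * (\<bar>z\<bar> ^ i * \<bar>y\<bar> ^ (l - i + 1))"])
    show "integrable step_pair (\<lambda>(z, y). \<Sum>i\<le>l. (real j * real (l choose i)) * (\<bar>z\<bar> ^ i * \<bar>y\<bar> ^ (l - i + 1)))"
      unfolding split_beta'
    proof (intro Bochner_Integration.integrable_sum integrable_mult_right)
      fix i assume i: "i \<in> {..l}"
      have "integrable max_law (\<lambda>z. \<bar>z\<bar> ^ i)" "integrable N (\<lambda>y. \<bar>y\<bar> ^ (l - i + 1))"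
        using integrable_abs[OF W[of i]] integrable_abs[OF N[of "l - i + 1"]] i
        by (auto simp: power_abs j simp del: power_Suc)
      then show "integrable step_pair (\<lambda>x. \<bar>fst x\<bar> ^ i * \<bar>snd x\<bar> ^ (l - i + 1))"
        by (rule step_pair.product_integral(1)[unfolded split_beta'])
    qed
    have ev: "\<forall>\<^sub>F n in sequentially. min w (real n) = w" for w :: real
    proof -
      obtain k where "w \<le> real k" using real_arch_simple by blast
      then show ?thesis by (intro eventually_sequentiallyI[of k] min_absorb1) (meson of_nat_mono order_trans)
    qed
    have lm: "(\<lambda>n. ?f (real n) (z + y) - ?f (real n) z) \<longlonglongrightarrow> (z + y) ^ j - z ^ j" for z y
      by (rule tendsto_eventually) (use ev[of "z + y"] ev[of z] in \<open>eventually_elim, simp\<close>)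
    show "AE x in step_pair. (\<lambda>n. case x of (z, y) \<Rightarrow> ?f (real n) (z + y) - ?f (real n) z) \<longlonglongrightarrow> (case x of (z, y) \<Rightarrow> (z + y) ^ j - z ^ j)"
    proof (rule AE_I2)
      fix x show "(\<lambda>n. case x of (z, y) \<Rightarrow> ?f (real n) (z + y) - ?f (real n) z) \<longlonglongrightarrow> (case x of (z, y) \<Rightarrow> (z + y) ^ j - z ^ j)"
        by (cases x) (simp only: prod.case lm)
    qed
    have bd: "\<bar>?f (real n) (z + y) - ?f (real n) z\<bar> \<le> (\<Sum>i\<le>l. (real j * real (l choose i)) * (\<bar>z\<bar> ^ i * \<bar>y\<bar> ^ (l - i + 1)))" for n z y
    proof -
      have "\<bar>?f (real n) (z + y) - ?f (real n) z\<bar> \<le> real j * \<bar>min (z + y) (real n) - min z (real n)\<bar> * (\<bar>z\<bar> + \<bar>y\<bar>) ^ l"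
        unfolding j by (rule abs_power_diff_le) auto
      also have "\<dots> \<le> real j * \<bar>y\<bar> * (\<bar>z\<bar> + \<bar>y\<bar>) ^ l"
        by (intro mult_right_mono mult_left_mono) auto
      also have "\<dots> = (\<Sum>i\<le>l. (real j * real (l choose i)) * (\<bar>z\<bar> ^ i * \<bar>y\<bar> ^ (l - i + 1)))"
        unfolding binomial_ring sum_distrib_left by (intro sum.cong refl) simp
      finally show ?thesis .
    qed
    show "AE x in step_pair. norm (case x of (z, y) \<Rightarrow> ?f (real n) (z + y) - ?f (real n) z) \<le>
        (case x of (z, y) \<Rightarrow> \<Sum>i\<le>l. (real j * real (l choose i)) * (\<bar>z\<bar> ^ i * \<bar>y\<bar> ^ (l - i + 1)))" for n
    proof (rule AE_I2)
      fix x show "norm (case x of (z, y) \<Rightarrow> ?f (real n) (z + y) - ?f (real n) z) \<le>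
        (case x of (z, y) \<Rightarrow> \<Sum>i\<le>l. (real j * real (l choose i)) * (\<bar>z\<bar> ^ i * \<bar>y\<bar> ^ (l - i + 1)))"
        by (cases x) (simp only: prod.case real_norm_def bd)
    qed
  qed auto
  then have "(\<lambda>n::nat. \<integral>x. ?o x \<partial>step_pair) \<longlonglongrightarrow> (\<integral>(z, y). (z + y) ^ j - z ^ j \<partial>step_pair)"
    by (simp only: trunc of_nat_0_le_iff)
  then have "(\<integral>x. ?o x \<partial>step_pair) = (\<integral>(z, y). (z + y) ^ j - z ^ j \<partial>step_pair)"
    by (rule LIMSEQ_unique[OF tendsto_const])
  also have "\<dots> = (\<integral>x. (\<Sum>i\<le>l. real (j choose i) * (case x of (z, y) \<Rightarrow> z ^ i * y ^ (j - i))) \<partial>step_pair)"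
  proof (rule Bochner_Integration.integral_cong[OF refl])
    fix x :: "real \<times> real"
    have "(z + y) ^ j - z ^ j = (\<Sum>i\<le>l. real (j choose i) * (z ^ i * y ^ (j - i)))" for z y :: real
      unfolding binomial_ring unfolding j by (simp add: mult.assoc)
    then show "(case x of (z, y) \<Rightarrow> (z + y) ^ j - z ^ j) =
        (\<Sum>i\<le>l. real (j choose i) * (case x of (z, y) \<Rightarrow> z ^ i * y ^ (j - i)))"
      by (cases x) (simp only: prod.case)
  qed
  also have "\<dots> = (\<Sum>i\<le>l. real (j choose i) * (\<integral>(z, y). z ^ i * y ^ (j - i) \<partial>step_pair))"
    using N W by (subst Bochner_Integration.integral_sum) (auto intro!: integrable_mult_right step_pair.product_integral(1) simp: j)
  also have "\<dots> = (\<Sum>i\<le>l. real (j choose i) * (\<integral>z. z ^ i \<partial>max_law) * (\<integral>y. y ^ (j - i) \<partial>N))"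
    using N W by (intro sum.cong refl) (subst step_pair.product_integral(2), auto)
  finally show ?thesis using ov(2) by simp
qed

end

section \<open>Asymptotic solution of Lindley's equation\<close>

text \<open>Dyadic decomposition: a tail of order \<open>x powr (-s)\<close> gives a geometric series of ratio \<open>2 powr (n - s)\<close>.\<close>

lemma nn_integral_power_finite:
  fixes \<mu> :: "real measure"
  assumes fin: "finite_measure \<mu>" and sets [measurable_cong]: "sets \<mu> = sets borel"
    and tail: "\<And>x. b \<le> x \<Longrightarrow> measure \<mu> {x<..} \<le> K * x powr (- s)"
    and b: "1 \<le> b" and n: "real n < s"
  shows "(\<integral>\<^sup>+z. ennreal (max 0 z ^ n) \<partial>\<mu>) < \<infinity>"
proof -
  interpret \<mu>: finite_measure \<mu> by (rule fin)
  let ?r = "2 powr (real n - s)"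
  have pw: "max 0 z ^ n \<le> b ^ n + (\<Sum>j<k. (b * 2 ^ Suc j) ^ n * indicat_real {b * 2 ^ j<..} z)"
    if "z \<le> b * 2 ^ k" for z k
    using that
  proof (induction k)
    case 0
    then have "max 0 z ^ n \<le> b ^ n" using b by (intro power_mono) auto
    then show ?case by simp
  next
    case (Suc k)
    show ?case
    proof (cases "z \<le> b * 2 ^ k")
      case True
      have "0 \<le> (b * 2 ^ Suc k) ^ n * indicat_real {b * 2 ^ k<..} z" using b by simp
      then show ?thesis using Suc.IH[OF True] by simp
    next
      case False
      have "max 0 z ^ n \<le> (b * 2 ^ Suc k) ^ n" using Suc.prems b by (intro power_mono) auto
      also have "\<dots> = (b * 2 ^ Suc k) ^ n * indicat_real {b * 2 ^ k<..} z" using False by simp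
      also have "\<dots> \<le> (\<Sum>j<Suc k. (b * 2 ^ Suc j) ^ n * indicat_real {b * 2 ^ j<..} z)"
        using b by (intro member_le_sum) auto
      finally show ?thesis using b by (simp add: add_increasing)
    qed
  qed
  have "(\<integral>\<^sup>+z. ennreal (max 0 z ^ n) \<partial>\<mu>) \<le>
     (\<integral>\<^sup>+z. ennreal (b ^ n) + (\<Sum>j. ennreal ((b * 2 ^ Suc j) ^ n * indicat_real {b * 2 ^ j<..} z)) \<partial>\<mu>)"
  proof (rule nn_integral_mono)
    fix z :: real
    obtain k where "z / b < 2 ^ k" using real_arch_pow[of 2 "z / b"] by auto
    then have k: "z \<le> b * 2 ^ k" using b by (simp add: field_simps)
    have "ennreal (max 0 z ^ n) \<le> ennreal (b ^ n + (\<Sum>j<k. (b * 2 ^ Suc j) ^ n * indicat_real {b * 2 ^ j<..} z))"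
      using pw[OF k] by (intro ennreal_leI) simp
    also have "\<dots> = ennreal (b ^ n) + (\<Sum>j<k. ennreal ((b * 2 ^ Suc j) ^ n * indicat_real {b * 2 ^ j<..} z))"
      using b by (subst ennreal_plus) (auto intro!: sum_nonneg simp: sum_ennreal)
    also have "\<dots> \<le> ennreal (b ^ n) + (\<Sum>j. ennreal ((b * 2 ^ Suc j) ^ n * indicat_real {b * 2 ^ j<..} z))"
      by (intro add_left_mono sum_le_suminf) auto
    finally show "ennreal (max 0 z ^ n) \<le> ennreal (b ^ n) + (\<Sum>j. ennreal ((b * 2 ^ Suc j) ^ n * indicat_real {b * 2 ^ j<..} z))" .
  qed
  also have "\<dots> = ennreal (b ^ n) * emeasure \<mu> (space \<mu>) + (\<Sum>j. \<integral>\<^sup>+z. ennreal ((b * 2 ^ Suc j) ^ n * indicat_real {b * 2 ^ j<..} z) \<partial>\<mu>)"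
    by (subst nn_integral_add) (auto simp: nn_integral_suminf)
  also have "(\<Sum>j. \<integral>\<^sup>+z. ennreal ((b * 2 ^ Suc j) ^ n * indicat_real {b * 2 ^ j<..} z) \<partial>\<mu>) \<le> (\<Sum>j. ennreal ((b * 2) ^ n * \<bar>K\<bar> * b powr (- s) * ?r ^ j))"
  proof (intro suminf_le summableI)
    fix j
    have "(\<integral>\<^sup>+z. ennreal ((b * 2 ^ Suc j) ^ n * indicat_real {b * 2 ^ j<..} z) \<partial>\<mu>) =
        (\<integral>\<^sup>+z. ennreal ((b * 2 ^ Suc j) ^ n) * indicator {b * 2 ^ j<..} z \<partial>\<mu>)"
      using b by (intro nn_integral_cong) (auto split: split_indicator)
    also have "\<dots> = ennreal ((b * 2 ^ Suc j) ^ n) * emeasure \<mu> {b * 2 ^ j<..}"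
      by (subst nn_integral_cmult_indicator) auto
    also have "\<dots> = ennreal ((b * 2 ^ Suc j) ^ n * measure \<mu> {b * 2 ^ j<..})"
      using b by (simp add: \<mu>.emeasure_eq_measure ennreal_mult)
    also have "\<dots> \<le> ennreal ((b * 2 ^ Suc j) ^ n * (\<bar>K\<bar> * (b * 2 ^ j) powr (- s)))"
    proof (intro ennreal_leI mult_left_mono)
      have "b * 1 \<le> b * 2 ^ j" using b by (intro mult_left_mono) auto
      then have "measure \<mu> {b * 2 ^ j<..} \<le> K * (b * 2 ^ j) powr (- s)" by (intro tail) simp
      also have "\<dots> \<le> \<bar>K\<bar> * (b * 2 ^ j) powr (- s)" by (intro mult_right_mono) auto
      finally show "measure \<mu> {b * 2 ^ j<..} \<le> \<bar>K\<bar> * (b * 2 ^ j) powr (- s)" .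
    qed (use b in simp)
    also have "(b * 2 ^ Suc j) ^ n * (\<bar>K\<bar> * (b * 2 ^ j) powr (- s)) = (b * 2) ^ n * \<bar>K\<bar> * b powr (- s) * ?r ^ j"
    proof -
      have "(2 ^ j) powr (- s) = (2 powr (- s)) ^ j"
        by (simp add: powr_powr powr_realpow[symmetric] mult.commute)
      moreover have "?r = 2 ^ n * 2 powr (- s)"
        by (simp add: powr_diff powr_minus divide_inverse powr_realpow)
      ultimately show ?thesis using b
        by (simp add: powr_mult power_mult_distrib mult_ac flip: power_mult)
    qed
    finally show "(\<integral>\<^sup>+z. ennreal ((b * 2 ^ Suc j) ^ n * indicat_real {b * 2 ^ j<..} z) \<partial>\<mu>) \<le> ennreal ((b * 2) ^ n * \<bar>K\<bar> * b powr (- s) * ?r ^ j)" .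
  qed
  also have "(\<Sum>j. ennreal ((b * 2) ^ n * \<bar>K\<bar> * b powr (- s) * ?r ^ j)) = ennreal (\<Sum>j. (b * 2) ^ n * \<bar>K\<bar> * b powr (- s) * ?r ^ j)"
    using b n by (intro suminf_ennreal2 summable_mult summable_geometric) (auto simp: powr_less_one)
  also have "ennreal (b ^ n) * emeasure \<mu> (space \<mu>) + ennreal (\<Sum>j. (b * 2) ^ n * \<bar>K\<bar> * b powr (- s) * ?r ^ j) < \<infinity>"
    by (simp add: \<mu>.emeasure_eq_measure ennreal_mult_less_top)
  finally show ?thesis by simp
qed

text \<open>In the application the exponent \<open>s\<close> lies between \<open>m - 1\<close> and \<open>\<alpha> - 1\<close>; the decay of \<open>x * h x\<close> transfers to the tail of the
maximum and makes its first \<open>m - 1\<close> moments finite.\<close>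

locale smooth_random_walk = random_walk N + tail_derivatives h g m b C
  for N :: "real measure" and h g m b C +
  fixes s :: real
  assumes h_eq: "\<And>x. h x = measure N {x<..}"
    and step_moments: "\<And>i. i \<le> m \<Longrightarrow> integrable N (\<lambda>y. y ^ i)"
    and step_mean: "(\<integral>y. y \<partial>N) < 0"
    and s: "real (m - 1) < s"
    and decay: "\<And>x. b \<le> x \<Longrightarrow> x * h x \<le> C * x powr (- s)"
begin

lemma prob_N: "prob_space N" and sets_N: "sets N = sets borel"
  by unfold_locales simp

lemma step_integrable: "integrable N (\<lambda>y. y)"
  using step_moments[of 1] m by simp

lemma walk_max_tail_bound:
  "\<exists>a K. b \<le> a \<and> (\<forall>x\<ge>a. emeasure S {\<omega>. ereal x < walk_max coord \<omega>} \<le> ennreal (K * (x * h x)))"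
proof -
  obtain a \<Psi> K where a: "b \<le> a" and \<Psi>: "\<Psi> \<in> borel_measurable borel"
    "\<And>x. a / 2 \<le> x \<Longrightarrow> x \<le> a \<Longrightarrow> 1 \<le> \<Psi> x"
    "\<And>x. a \<le> x \<Longrightarrow> (\<integral>\<^sup>+y\<in>{..x/2}. \<Psi> (x - y) \<partial>N) + ennreal (h (x / 2)) \<le> \<Psi> x"
    "\<And>x. a \<le> x \<Longrightarrow> \<Psi> x \<le> ennreal (K * (x * h x))"
    using finite_maximum_barrier[OF prob_N sets_N step_integrable step_mean] by blast
  have a0: "0 < a" using a b by simp
  have "emeasure S {\<omega>. ereal x < walk_max coord \<omega>} \<le> ennreal (K * (x * h x))" if "a \<le> x" for x
  proof -
    have "emeasure S {\<omega>. ereal x < walk_max coord \<omega>} \<le> \<Psi> x"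
      by (rule emeasure_walk_max_le[OF a0 \<Psi>(2,1)])
        (use \<Psi>(3) that a0 in \<open>auto simp: h_eq N.emeasure_eq_measure\<close>)
    then show ?thesis using \<Psi>(4)[OF that] by (rule order_trans)
  qed
  then show ?thesis using a by blast
qed

lemma tail_scale_tendsto_0: "((\<lambda>x. x ^ (m - 1) * (x * h x)) \<longlongrightarrow> 0) at_top"
proof (rule Lim_null_comparison)
  show "\<forall>\<^sub>F x in at_top. norm (x ^ (m - 1) * (x * h x)) \<le> C * x powr (real (m - 1) - s)"
    using eventually_ge_at_top[of b]
  proof eventually_elim
    case (elim x)
    then have x: "0 < x" using b by simp
    have "norm (x ^ (m - 1) * (x * h x)) = x ^ (m - 1) * (x * h x)" using x pos[of x] by simp
    also have "\<dots> \<le> x ^ (m - 1) * (C * x powr (- s))" using x decay[OF elim] by (intro mult_left_mono) auto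
    also have "\<dots> = C * x powr (real (m - 1) - s)"
      using x by (simp add: powr_diff powr_minus divide_inverse powr_realpow)
    finally show ?case .
  qed
  show "((\<lambda>x. C * x powr (real (m - 1) - s)) \<longlongrightarrow> 0) at_top"
    by (rule tendsto_mult_right_zero[OF tendsto_neg_powr[OF _ filterlim_ident]]) (use s in simp)
qed

lemma tail_scale_tendsto_0': "((\<lambda>x. x * h x) \<longlongrightarrow> 0) at_top"
proof (rule Lim_null_comparison[OF _ tail_scale_tendsto_0])
  show "\<forall>\<^sub>F x in at_top. norm (x * h x) \<le> x ^ (m - 1) * (x * h x)"
    using eventually_ge_at_top[of 1]
  proof eventually_elim
    case (elim x)
    then have "1 * (x * h x) \<le> x ^ (m - 1) * (x * h x)"
      using pos[of x] by (intro mult_right_mono one_le_power) auto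
    then show ?case using elim pos[of x] by simp
  qed
qed

lemma walk_max_finite: "AE \<omega> in S. walk_max coord \<omega> < \<infinity>"
proof -
  obtain a K where aK: "b \<le> a" "\<And>x. a \<le> x \<Longrightarrow> emeasure S {\<omega>. ereal x < walk_max coord \<omega>} \<le> ennreal (K * (x * h x))"
    using walk_max_tail_bound by blast
  have M: "{\<omega>. walk_max coord \<omega> = \<infinity>} \<in> sets S" "\<And>x. {\<omega>. ereal x < walk_max coord \<omega>} \<in> sets S"
  proof -
    have "Measurable.pred S (\<lambda>\<omega>. walk_max coord \<omega> = \<infinity>)" "\<And>x. Measurable.pred S (\<lambda>\<omega>. ereal x < walk_max coord \<omega>)" by measurable
    then show "{\<omega>. walk_max coord \<omega> = \<infinity>} \<in> sets S" "\<And>x. {\<omega>. ereal x < walk_max coord \<omega>} \<in> sets S"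
      by (simp_all add: pred_def)
  qed
  have "((\<lambda>x. ennreal (K * (x * h x))) \<longlongrightarrow> ennreal 0) at_top"
    by (intro tendsto_ennrealI tendsto_mult_right_zero tail_scale_tendsto_0')
  then have "emeasure S {\<omega>. walk_max coord \<omega> = \<infinity>} \<le> ennreal 0"
  proof (rule tendsto_lowerbound)
    show "\<forall>\<^sub>F x in at_top. emeasure S {\<omega>. walk_max coord \<omega> = \<infinity>} \<le> ennreal (K * (x * h x))"
      using eventually_ge_at_top[of a]
    proof eventually_elim
      case (elim x)
      have "emeasure S {\<omega>. walk_max coord \<omega> = \<infinity>} \<le> emeasure S {\<omega>. ereal x < walk_max coord \<omega>}"
        by (rule emeasure_mono[OF _ M(2)]) auto
      then show ?case using aK(2)[OF elim] by (rule order_trans)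
    qed
  qed simp
  then have "{\<omega>. walk_max coord \<omega> = \<infinity>} \<in> null_sets S" using M(1) by auto
  then show ?thesis by (rule AE_I') (auto simp: less_top[symmetric] top_ereal_def)
qed

sublocale random_walk_negative_drift N
  by unfold_locales (use walk_max_finite step_integrable step_mean in auto)

definition T :: "real \<Rightarrow> real" where "T x = measure max_law {x<..}"

lemma T_bound: "\<exists>a K. b \<le> a \<and> 0 \<le> K \<and> (\<forall>x\<ge>a. T x \<le> K * (x * h x))"
proof -
  obtain a K where aK: "b \<le> a" "\<And>x. a \<le> x \<Longrightarrow> emeasure S {\<omega>. ereal x < walk_max coord \<omega>} \<le> ennreal (K * (x * h x))"
    using walk_max_tail_bound by blast
  have "T x \<le> \<bar>K\<bar> * (x * h x)" if "a \<le> x" for x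
  proof -
    have p: "0 \<le> x * h x" using that aK b pos[of x] by simp
    have "ennreal (T x) \<le> ennreal (K * (x * h x))"
      using aK(2)[OF that] by (simp add: T_def emeasure_max_law_tail[symmetric] max_law.emeasure_eq_measure)
    also have "\<dots> \<le> ennreal (\<bar>K\<bar> * (x * h x))" using p by (intro ennreal_leI mult_right_mono) auto
    finally show ?thesis using p by (subst (asm) ennreal_le_iff) auto
  qed
  then show ?thesis using aK(1) by (intro exI[of _ a] exI[of _ "\<bar>K\<bar>"]) auto
qed

lemma max_law_moments: "integrable max_law (\<lambda>z. z ^ i)" if "i \<le> m - 1"
proof (rule integrableI_bounded)
  obtain a K where aK: "b \<le> a" "0 \<le> K" "\<And>x. a \<le> x \<Longrightarrow> T x \<le> K * (x * h x)" using T_bound by blast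
  have "(\<integral>\<^sup>+z. ennreal (max 0 z ^ i) \<partial>max_law) < \<infinity>"
  proof (rule nn_integral_power_finite[where b=a and K="K * C" and s=s])
    show "measure max_law {x<..} \<le> K * C * x powr (- s)" if "a \<le> x" for x
    proof -
      have "T x \<le> K * (C * x powr (- s))"
        using decay[of x] aK(1,2) that by (intro order_trans[OF aK(3)[OF that] mult_left_mono]) auto
      then show ?thesis by (simp add: T_def mult.assoc)
    qed
  qed (use aK b s that in \<open>auto intro: max_law.finite_measure_axioms\<close>)
  also have "(\<integral>\<^sup>+z. ennreal (max 0 z ^ i) \<partial>max_law) = (\<integral>\<^sup>+z. ennreal (norm (z ^ i)) \<partial>max_law)"
    by (intro nn_integral_cong_AE, rule AE_mp[OF AE_max_law_nonneg]) (auto simp: max_def)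
  finally show "(\<integral>\<^sup>+z. ennreal (norm (z ^ i)) \<partial>max_law) < \<infinity>" .
qed measurable

lemma T_antimono: "antimono T"
  unfolding T_def by (intro antimonoI max_law.finite_measure_mono) auto

lemma T_nonneg: "0 \<le> T x" and T_le_1: "T x \<le> 1"
  by (simp_all add: T_def max_law.prob_le_1)

lemma measurable_T [measurable]: "T \<in> borel_measurable borel"
  by (rule borel_measurable_antimono[OF T_antimono])

lemma measurable_h [measurable]: "h \<in> borel_measurable borel"
  by (rule borel_measurable_antimono[OF anti])

lemma T_integrable: "set_integrable N A (\<lambda>y. T (x - y))" if [measurable]: "A \<in> sets borel"
  unfolding set_integrable_def
  by (rule N.integrable_const_bound[of _ 1]) (auto simp: T_nonneg T_le_1 split: split_indicator)

text \<open>The event \<open>X + M > x\<close> is the disjoint union of its parts \<open>X \<le> x/2\<close> and \<open>M \<le> x/2\<close>, which exclude each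
other, and of the rectangle where both summands exceed \<open>x / 2\<close>.\<close>

lemma Lindley_tail:
  assumes x: "0 \<le> x"
  shows "T x = (LINT y:{..x/2}|N. T (x - y)) + (LINT z:{..x/2}|max_law. h (x - z)) + T (x / 2) * h (x / 2)"
proof -
  let ?A = "\<lambda>(z, y). indicat_real {..x/2} y * indicat_real {x<..} (z + y)"
  let ?B = "\<lambda>(z, y). indicat_real {..x/2} z * indicat_real {x<..} (z + y)"
  let ?C = "\<lambda>(z, y). indicat_real {x/2<..} z * indicat_real {x/2<..} y"
  have iA: "integrable step_pair ?A" and iB: "integrable step_pair ?B" and iC: "integrable step_pair ?C"
    by (rule step_pair.integrable_const_bound[of _ 1], auto split: split_indicator)+
  have "T x = measure step_pair ((\<lambda>(z, y). max 0 (z + y)) -` {x<..} \<inter> space step_pair)"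
    unfolding T_def by (subst max_law_eq_distr, subst measure_distr) auto
  also have "\<dots> = (\<integral>p. indicator ((\<lambda>(z, y). max 0 (z + y)) -` {x<..} \<inter> space step_pair) p \<partial>step_pair)"
    by simp
  also have "\<dots> = (\<integral>p. ?A p + ?B p + ?C p \<partial>step_pair)"
    by (rule Bochner_Integration.integral_cong[OF refl])
      (use x in \<open>auto simp: space_pair_measure max_def split: split_indicator if_splits\<close>)
  also have "\<dots> = (\<integral>p. ?A p \<partial>step_pair) + (\<integral>p. ?B p \<partial>step_pair) + (\<integral>p. ?C p \<partial>step_pair)"
    using iA iB iC by (simp add: Bochner_Integration.integral_add)
  also have "(\<integral>p. ?A p \<partial>step_pair) = (LINT y:{..x/2}|N. T (x - y))"
  proof -
    have "(\<integral>p. ?A p \<partial>step_pair) = (\<integral>y. \<integral>z. indicat_real {..x/2} y * indicat_real {x<..} (z + y) \<partial>max_law \<partial>N)"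
      using iA by (rule step_pair.integral_snd[symmetric])
    also have "\<dots> = (\<integral>y. indicat_real {..x/2} y * T (x - y) \<partial>N)"
    proof (rule Bochner_Integration.integral_cong[OF refl])
      fix y
      have "(\<integral>z. indicat_real {x<..} (z + y) \<partial>max_law) = (\<integral>z. indicat_real {x - y<..} z \<partial>max_law)"
        by (rule Bochner_Integration.integral_cong) (auto split: split_indicator)
      then show "(\<integral>z. indicat_real {..x/2} y * indicat_real {x<..} (z + y) \<partial>max_law) = indicat_real {..x/2} y * T (x - y)"
        by (simp add: T_def)
    qed
    finally show ?thesis by (simp add: set_lebesgue_integral_def)
  qed
  also have "(\<integral>p. ?B p \<partial>step_pair) = (LINT z:{..x/2}|max_law. h (x - z))"
  proof -
    have "(\<integral>p. ?B p \<partial>step_pair) = (\<integral>z. \<integral>y. indicat_real {..x/2} z * indicat_real {x<..} (z + y) \<partial>N \<partial>max_law)"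
      using iB by (rule step_pair.integral_fst[symmetric])
    also have "\<dots> = (\<integral>z. indicat_real {..x/2} z * h (x - z) \<partial>max_law)"
    proof (rule Bochner_Integration.integral_cong[OF refl])
      fix z
      have "(\<integral>y. indicat_real {x<..} (z + y) \<partial>N) = (\<integral>y. indicat_real {x - z<..} y \<partial>N)"
        by (rule Bochner_Integration.integral_cong) (auto split: split_indicator)
      then show "(\<integral>y. indicat_real {..x/2} z * indicat_real {x<..} (z + y) \<partial>N) = indicat_real {..x/2} z * h (x - z)"
        by (simp add: h_eq)
    qed
    finally show ?thesis by (simp add: set_lebesgue_integral_def)
  qed
  also have "(\<integral>p. ?C p \<partial>step_pair) = T (x / 2) * h (x / 2)"
    by (subst step_pair.product_integral(2))
      (auto simp: T_def h_eq max_law.emeasure_eq_measure N.emeasure_eq_measure intro!: integrable_real_indicator)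
  finally show ?thesis .
qed

lemma T_tendsto_0: "(T \<longlongrightarrow> 0) at_top"
proof -
  obtain a1 K where K: "b \<le> a1" "0 \<le> K" "\<And>x. a1 \<le> x \<Longrightarrow> T x \<le> K * (x * h x)" using T_bound by blast
  show ?thesis
  proof (rule Lim_null_comparison[OF _ tendsto_mult_right_zero[OF tail_scale_tendsto_0']])
    show "\<forall>\<^sub>F x in at_top. norm (T x) \<le> K * (x * h x)"
      using eventually_ge_at_top[of a1] by eventually_elim (use K(3) T_nonneg in simp)
  qed
qed

lemma g_tendsto_0:
  assumes "k \<le> m" shows "(g k \<longlongrightarrow> 0) at_top"
proof (rule Lim_null_comparison)
  show "((\<lambda>x. C * (x * h x)) \<longlongrightarrow> 0) at_top" by (rule tendsto_mult_right_zero[OF tail_scale_tendsto_0'])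
  show "\<forall>\<^sub>F x in at_top. norm (g k x) \<le> C * (x * h x)"
    using eventually_ge_at_top[of b]
  proof eventually_elim
    case (elim x)
    have "\<bar>g k x\<bar> \<le> C * (x * h x / x ^ k)" using scale[of k x] elim assms b by simp
    also have "\<dots> \<le> C * (x * h x / 1)"
      using C elim b pos[of x] by (intro mult_left_mono divide_left_mono one_le_power) auto
    finally show ?case by simp
  qed
qed

lemma g_bounded:
  assumes "k \<le> m" "b \<le> 2 * x" shows "\<bar>g k x\<bar> \<le> C * (C * barrier 0 (b / 2)) * 2 ^ k"
proof -
  have x: "1/2 \<le> x" using assms b by simp
  have "\<bar>g k x\<bar> \<le> C * (x * h x / x ^ k)" using assms by (intro scale) auto
  also have "\<dots> \<le> C * (C * barrier 0 (b / 2) * 2 ^ k)"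
  proof (rule mult_left_mono)
    have "x * h x \<le> C * barrier 0 x" using lower[OF assms(2)] by (simp add: barrier_def)
    also have "\<dots> \<le> C * barrier 0 (b / 2)" using C assms by (intro mult_left_mono barrier_antimono) auto
    finally have 1: "x * h x \<le> C * barrier 0 (b / 2)" .
    have "1 / x ^ k \<le> 1 / (1/2) ^ k" using x by (intro divide_left_mono power_mono) auto
    then have 2: "1 / x ^ k \<le> 2 ^ k" by (simp add: power_divide)
    have "x * h x * (1 / x ^ k) \<le> C * barrier 0 (b / 2) * 2 ^ k"
      by (rule mult_mono[OF 1 2]) (use C x barrier_pos[of "b / 2" 0] in auto)
    then show "x * h x / x ^ k \<le> C * barrier 0 (b / 2) * 2 ^ k" by simp
  qed (use C in simp)
  finally show ?thesis by (simp add: mult.assoc)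
qed

text \<open>The hypothesis says that \<open>p * S L\<^sub>F = L\<^sub>W\<close> modulo \<open>D\<^sup>m\<close> for the polynomial \<open>p\<close> with coefficients \<open>a\<close>.
Since \<open>L\<^sub>F = Id - D * S L\<^sub>F\<close>, the expansion of \<open>E[v (x - X)]\<close> for \<open>v = p(D) D\<^sup>-\<^sup>1 h\<close> is then
\<open>v - L\<^sub>W(D) h\<close>, and \<open>L\<^sub>W(D) h\<close> is the expansion of \<open>E[h (x - M)]\<close>; this is the fact \<open>conv\<close> below.\<close>

lemma tail_expansion:
  fixes a :: "nat \<Rightarrow> real"
  assumes coeffs: "\<And>l. l < m \<Longrightarrow> (\<Sum>k\<le>l. a k * ((- 1) ^ (l - k) / fact (Suc (l - k)) * (\<integral>y. y ^ Suc (l - k) \<partial>N))) =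
      (- 1) ^ l / fact l * (\<integral>z. z ^ l \<partial>max_law)"
  shows "((\<lambda>x. (T x - (\<Sum>k<m. a k * g k x)) / (x * h x / x ^ (m - 1))) \<longlongrightarrow> 0) at_top"
proof -
  define cF where "cF j = (- 1) ^ j / fact j * (\<integral>y. y ^ j \<partial>N)" for j
  define cW where "cW j = (- 1) ^ j / fact j * (\<integral>z. z ^ j \<partial>max_law)" for j
  define v where "v x = (\<Sum>k<m. a k * g k x)" for x
  define u where "u x = T x - v x" for x
  define w where "w x = h x / x ^ (m - 1)" for x
  define rF where "rF k x = (LINT y:{..x/2}|N. g k (x - y)) - (\<Sum>j\<le>m - k. cF j * g (k + j) x)" for k x
  define rW where "rW x = (LINT z:{..x/2}|max_law. g 1 (x - z)) - (\<Sum>j\<le>m - 1. cW j * g (1 + j) x)" for x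
  define err where "err x = rW x + T (x / 2) * h (x / 2) + (\<Sum>k<m. a k * rF k x)" for x
  have absint: "integrable N (\<lambda>y. \<bar>y\<bar> ^ i)" if "i \<le> m" for i
    using integrable_abs[OF step_moments[OF that]] by (simp add: power_abs)
  have gint: "set_integrable N {..x/2} (\<lambda>y. g k (x - y))" if "b \<le> x" "k < m" for x k
    by (rule Taylor_g(1)[OF prob_N sets_N]) (use that absint in auto)
  have limF: "((\<lambda>x. rF k x / w x) \<longlongrightarrow> 0) at_top" if "k < m" for k
    unfolding rF_def w_def cF_def by (rule Taylor_g(2)[OF prob_N sets_N]) (use that absint in auto)
  have limW: "((\<lambda>x. rW x / w x) \<longlongrightarrow> 0) at_top"
    unfolding rW_def w_def cW_def
  proof (rule Taylor_g(2))
    show "prob_space max_law" by unfold_locales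
    show "integrable max_law (\<lambda>y. \<bar>y\<bar> ^ (m - 1))"
      using integrable_abs[OF max_law_moments[of "m - 1"]] by (simp add: power_abs)
  qed (use m in auto)
  have limP: "((\<lambda>x. T (x / 2) * h (x / 2) / w x) \<longlongrightarrow> 0) at_top"
  proof -
    obtain a1 K where K: "b \<le> a1" "0 \<le> K" "\<And>x. a1 \<le> x \<Longrightarrow> T x \<le> K * (x * h x)" using T_bound by blast
    have half_lim: "filterlim (\<lambda>x::real. x / 2) at_top at_top"
      using filterlim_tendsto_pos_mult_at_top[OF tendsto_const[of "1/2"] _ filterlim_ident] by simp
    have "((\<lambda>x. K * 2 ^ (m - 1) * C * ((x / 2) ^ (m - 1) * (x / 2 * h (x / 2)))) \<longlongrightarrow> 0) at_top"
      by (rule tendsto_mult_right_zero[OF filterlim_compose[OF tail_scale_tendsto_0 half_lim]])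
    moreover have "\<forall>\<^sub>F x in at_top. norm (T (x / 2) * h (x / 2) / w x) \<le> K * 2 ^ (m - 1) * C * ((x / 2) ^ (m - 1) * (x / 2 * h (x / 2)))"
      using eventually_ge_at_top[of "2 * a1"]
    proof eventually_elim
      case (elim x)
      have x: "a1 \<le> x / 2" "0 < x" "b \<le> x" using elim K b by auto
      have hw: "h (x / 2) / w x \<le> C * x ^ (m - 1)"
        using half[OF x(3)] pos[of x] x by (simp add: w_def field_simps)
      have "norm (T (x / 2) * h (x / 2) / w x) = T (x / 2) * (h (x / 2) / w x)"
        using T_nonneg pos[of x] pos[of "x / 2"] x by (simp add: w_def abs_mult)
      also have "\<dots> \<le> K * (x / 2 * h (x / 2)) * (C * x ^ (m - 1))"
        using K(3)[OF x(1)] hw K(2) pos[of "x / 2"] pos[of x] x by (intro mult_mono) (auto simp: w_def)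
      also have "\<dots> = K * 2 ^ (m - 1) * C * ((x / 2) ^ (m - 1) * (x / 2 * h (x / 2)))"
        by (simp add: power_divide)
      finally show ?case .
    qed
    ultimately show ?thesis by (rule Lim_null_comparison[rotated])
  qed
  have limE: "((\<lambda>x. err x / w x) \<longlongrightarrow> 0) at_top"
  proof -
    have "((\<lambda>x. rW x / w x + T (x / 2) * h (x / 2) / w x + (\<Sum>k<m. a k * (rF k x / w x))) \<longlongrightarrow> 0 + 0 + (\<Sum>k<m. a k * 0)) at_top"
      by (intro tendsto_add limW limP tendsto_sum tendsto_mult tendsto_const limF) auto
    then show ?thesis by (simp add: err_def add_divide_distrib sum_divide_distrib)
  qed
  have vint: "set_integrable N {..x/2} (\<lambda>y. v (x - y))" if "b \<le> x" for x
  proof -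
    have "integrable N (\<lambda>y. \<Sum>k<m. a k * (indicat_real {..x/2} y * g k (x - y)))"
      using gint[OF that] by (intro Bochner_Integration.integrable_sum) (auto simp: set_integrable_def)
    then show ?thesis by (simp add: v_def set_integrable_def sum_distrib_left mult.left_commute)
  qed
  have vexp: "(LINT y:{..x/2}|N. v (x - y)) = (\<Sum>k<m. a k * (LINT y:{..x/2}|N. g k (x - y)))" if "b \<le> x" for x
  proof -
    have "(LINT y:{..x/2}|N. v (x - y)) = (\<integral>y. (\<Sum>k<m. a k * (indicat_real {..x/2} y * g k (x - y))) \<partial>N)"
      unfolding v_def set_lebesgue_integral_def by (simp add: sum_distrib_left mult.left_commute)
    also have "\<dots> = (\<Sum>k<m. \<integral>y. a k * (indicat_real {..x/2} y * g k (x - y)) \<partial>N)"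
      using gint[OF that] by (intro Bochner_Integration.integral_sum) (auto simp: set_integrable_def)
    finally show ?thesis by (simp add: set_lebesgue_integral_def)
  qed
  have conv: "(\<Sum>k<m. a k * (\<Sum>j\<le>m - k. cF j * g (k + j) x)) = v x - (\<Sum>j\<le>m - 1. cW j * g (1 + j) x)" for x
  proof -
    have c0: "cF 0 = 1" using N.prob_space by (simp add: cF_def)
    have inner: "(\<Sum>j\<le>m - k. cF j * g (k + j) x) = g k x + (\<Sum>i<m - k. cF (Suc i) * g (Suc (k + i)) x)" if "k < m" for k
    proof -
      have "{..m - k} = {..<Suc (m - k)}" by auto
      then have "(\<Sum>j\<le>m - k. cF j * g (k + j) x) = (\<Sum>j<Suc (m - k). cF j * g (k + j) x)" by simp
      also have "\<dots> = cF 0 * g (k + 0) x + (\<Sum>i<m - k. cF (Suc i) * g (k + Suc i) x)"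
        by (rule sum.lessThan_Suc_shift)
      finally show ?thesis by (simp add: c0)
    qed
    have "(\<Sum>k<m. a k * (\<Sum>j\<le>m - k. cF j * g (k + j) x)) = (\<Sum>k<m. a k * g k x + a k * (\<Sum>i<m - k. cF (Suc i) * g (Suc (k + i)) x))"
      by (intro sum.cong refl) (simp add: inner distrib_left)
    also have "\<dots> = v x + (\<Sum>k<m. \<Sum>i<m - k. a k * cF (Suc i) * g (Suc (k + i)) x)"
      by (simp add: v_def sum.distrib sum_distrib_left mult.assoc)
    also have "(\<Sum>k<m. \<Sum>i<m - k. a k * cF (Suc i) * g (Suc (k + i)) x) = (\<Sum>(k, i)\<in>{(k, i). k + i < m}. a k * cF (Suc i) * g (Suc (k + i)) x)"
      by (subst sum.Sigma) (auto intro!: sum.cong)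
    also have "\<dots> = (\<Sum>l<m. \<Sum>k\<le>l. a k * cF (Suc (l - k)) * g (Suc (k + (l - k))) x)"
      by (rule sum.triangle_reindex)
    also have "\<dots> = (\<Sum>l<m. - (cW l * g (Suc l) x))"
    proof (rule sum.cong[OF refl])
      fix l assume "l \<in> {..<m}"
      then have l: "l < m" by simp
      have "(\<Sum>k\<le>l. a k * cF (Suc (l - k)) * g (Suc (k + (l - k))) x) =
          (\<Sum>k\<le>l. - (a k * ((- 1) ^ (l - k) / fact (Suc (l - k)) * (\<integral>y. y ^ Suc (l - k) \<partial>N))) * g (Suc l) x)"
        by (intro sum.cong refl) (simp add: cF_def)
      also have "\<dots> = - (\<Sum>k\<le>l. a k * ((- 1) ^ (l - k) / fact (Suc (l - k)) * (\<integral>y. y ^ Suc (l - k) \<partial>N))) * g (Suc l) x"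
        by (simp add: sum_distrib_right sum_negf)
      also have "\<dots> = - (cW l * g (Suc l) x)" unfolding coeffs[OF l] cW_def by simp
      finally show "(\<Sum>k\<le>l. a k * cF (Suc (l - k)) * g (Suc (k + (l - k))) x) = - (cW l * g (Suc l) x)" .
    qed
    also have "\<dots> = - (\<Sum>j\<le>m - 1. cW j * g (1 + j) x)"
    proof -
      have "{..<m} = {..m - 1}" using m by auto
      then show ?thesis by (simp add: sum_negf)
    qed
    finally show ?thesis by simp
  qed
  have uint: "set_integrable N {..x/2} (\<lambda>y. u (x - y))" if "b \<le> x" for x
    unfolding u_def by (intro set_integral_diff T_integrable vint that) auto
  have key: "u x = (LINT y:{..x/2}|N. u (x - y)) + err x" if x: "b \<le> x" for x
  proof -
    have "(LINT z:{..x/2}|max_law. h (x - z)) = (LINT z:{..x/2}|max_law. g 1 (x - z))"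
      by (rule set_lebesgue_integral_cong) (use x g_1 in auto)
    then have "T x = (LINT y:{..x/2}|N. T (x - y)) + (rW x + (\<Sum>j\<le>m - 1. cW j * g (1 + j) x)) + T (x / 2) * h (x / 2)"
      using Lindley_tail[of x] x b by (simp add: rW_def)
    moreover have "(LINT y:{..x/2}|N. v (x - y)) = (\<Sum>k<m. a k * rF k x) + (v x - (\<Sum>j\<le>m - 1. cW j * g (1 + j) x))"
      unfolding vexp[OF x] conv[symmetric] rF_def by (simp add: right_diff_distrib sum_subtractf)
    moreover have "(LINT y:{..x/2}|N. u (x - y)) = (LINT y:{..x/2}|N. T (x - y)) - (LINT y:{..x/2}|N. v (x - y))"
      unfolding u_def by (intro set_integral_diff T_integrable vint x) auto
    ultimately show ?thesis unfolding u_def err_def by simp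
  qed
  have "((\<lambda>x. u x / (x * h x / x ^ (m - 1))) \<longlongrightarrow> 0) at_top"
  proof (rule small_solution[OF prob_N sets_N step_integrable step_mean, where e="\<lambda>x. \<bar>err x\<bar>"])
    show "\<forall>\<^sub>F x in at_top. \<bar>u x\<bar> \<le> (LINT y:{..x/2}|N. \<bar>u (x - y)\<bar>) + \<bar>err x\<bar>"
      using eventually_ge_at_top[of b]
    proof eventually_elim
      case (elim x)
      have "\<bar>LINT y:{..x/2}|N. u (x - y)\<bar> \<le> (LINT y:{..x/2}|N. \<bar>u (x - y)\<bar>)"
        using set_integral_norm_bound[OF uint[OF elim]] by simp
      then show ?case using key[OF elim] by linarith
    qed
    show "set_integrable N {..x/2} (\<lambda>y. \<bar>u (x - y)\<bar>)" if "b \<le> x" for x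
      using uint[OF that] by (rule set_integrable_abs)
    show "((\<lambda>x. \<bar>err x\<bar> / (h x / x ^ (m - 1))) \<longlongrightarrow> 0) at_top"
    proof (rule Lim_null_comparison[OF _ tendsto_norm_zero[OF limE]])
      show "\<forall>\<^sub>F x in at_top. norm (\<bar>err x\<bar> / (h x / x ^ (m - 1))) \<le> norm (err x / w x)"
        by (simp only: real_norm_def abs_divide abs_abs w_def order_refl eventually_True)
    qed
    show "(u \<longlongrightarrow> 0) at_top"
    proof -
      note T_tendsto_0
      moreover have "((\<lambda>x. \<Sum>k<m. a k * g k x) \<longlongrightarrow> (\<Sum>k<m. a k * 0)) at_top"
        by (intro tendsto_sum tendsto_mult tendsto_const g_tendsto_0) auto
      ultimately have "((\<lambda>x. T x - (\<Sum>k<m. a k * g k x)) \<longlongrightarrow> 0 - (\<Sum>k<m. a k * 0)) at_top"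
        by (rule tendsto_diff)
      then show ?thesis by (simp add: u_def[abs_def] v_def)
    qed
    show "\<bar>u x\<bar> \<le> 1 + (\<Sum>k<m. \<bar>a k\<bar> * (C * (C * barrier 0 (b / 2)) * 2 ^ k))" if "b \<le> 2 * x" for x
    proof -
      have "\<bar>v x\<bar> \<le> (\<Sum>k<m. \<bar>a k * g k x\<bar>)" unfolding v_def by (rule sum_abs)
      also have "\<dots> \<le> (\<Sum>k<m. \<bar>a k\<bar> * (C * (C * barrier 0 (b / 2)) * 2 ^ k))"
        using g_bounded[OF _ that] by (intro sum_mono) (auto simp: abs_mult intro!: mult_left_mono)
      finally show ?thesis using T_nonneg[of x] T_le_1[of x] unfolding u_def by linarith
    qed
  qed
  then show ?thesis unfolding u_def v_def .
qed

end

section \<open>Truncated differential operators\<close>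

lemma coeff_mod_monom: "coeff (p mod monom 1 (Suc n)) k = (if k \<le> n then coeff p k else 0)" for p :: "real poly"
proof (cases "k \<le> n")
  case True
  have "p = monom 1 (Suc n) * (p div monom 1 (Suc n)) + p mod monom 1 (Suc n)" by simp
  then have "coeff p k = coeff (monom 1 (Suc n) * (p div monom 1 (Suc n))) k + coeff (p mod monom 1 (Suc n)) k"
    by (metis coeff_add)
  then show ?thesis using True by (simp add: coeff_monom_mult)
next
  case False
  have "degree (p mod monom 1 (Suc n)) \<le> n" by (rule degree_mod_monom)
  then show ?thesis using False by (simp add: coeff_eq_0)
qed

lemma D_ring_simps:
  "carrier (D_ring n) = {p. degree p \<le> n}" "\<one>\<^bsub>D_ring n\<^esub> = 1" "\<zero>\<^bsub>D_ring n\<^esub> = 0"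
  "p \<otimes>\<^bsub>D_ring n\<^esub> q = (p * q) mod monom 1 (Suc n)" "p \<oplus>\<^bsub>D_ring n\<^esub> q = p + q"
  by (simp_all add: D_ring_def)

lemma D_ring_minus:
  assumes "degree p \<le> n" "degree q \<le> n"
  shows "p \<ominus>\<^bsub>D_ring n\<^esub> q = p - q"
proof -
  interpret cring "D_ring n" by (rule cring_D_ring)
  have "\<ominus>\<^bsub>D_ring n\<^esub> q = - q"
    by (rule minus_equality) (use assms in \<open>simp_all add: D_ring_simps\<close>)
  then show ?thesis by (simp add: a_minus_def D_ring_simps)
qed

text \<open>The truncation of the inverse power series is an inverse in the truncated ring.\<close>

lemma D_ring_unit:
  assumes deg: "degree p \<le> n" and c: "coeff p 0 \<noteq> 0"
  shows "p \<in> Units (D_ring n)"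
proof -
  interpret cring "D_ring n" by (rule cring_D_ring)
  define q where "q = (\<Sum>k\<le>n. monom (fps_nth (inverse (fps_of_poly p)) k) k)"
  have cq: "coeff q k = (if k \<le> n then fps_nth (inverse (fps_of_poly p)) k else 0)" for k
    by (simp add: q_def coeff_sum)
  have dq: "degree q \<le> n" by (rule degree_le) (simp add: cq)
  have "(p * q) mod monom 1 (Suc n) = 1"
  proof (rule poly_eqI)
    fix k
    show "coeff ((p * q) mod monom 1 (Suc n)) k = coeff 1 k"
    proof (cases "k \<le> n")
      case True
      have "coeff (p * q) k = (\<Sum>i\<le>k. fps_nth (fps_of_poly p) i * fps_nth (inverse (fps_of_poly p)) (k - i))"
        unfolding coeff_mult using True by (intro sum.cong refl) (simp add: cq)
      also have "\<dots> = fps_nth (fps_of_poly p * inverse (fps_of_poly p)) k"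
        by (simp add: fps_mult_nth atMost_atLeast0)
      also have "fps_of_poly p * inverse (fps_of_poly p) = 1"
        using c by (subst mult.commute) (simp add: inverse_mult_eq_1)
      finally show ?thesis using True
        by (simp add: coeff_mod_monom one_pCons coeff_pCons split: nat.splits)
    qed (simp add: coeff_mod_monom one_pCons coeff_pCons split: nat.splits)
  qed
  then show ?thesis
    using deg dq unfolding Units_def by (auto simp: D_ring_simps mult.commute intro!: bexI[of _ q])
qed

lemma D_ring_inverse_square_product:
  assumes E: "E \<in> Units (D_ring n)" and Q: "Q \<in> Units (D_ring n)"
  defines "P \<equiv> E [^]\<^bsub>D_ring n\<^esub> (-2 :: int) \<otimes>\<^bsub>D_ring n\<^esub> inv\<^bsub>D_ring n\<^esub> Q"
  shows "degree P \<le> n" and "monom 1 (Suc n) dvd 1 - E * E * Q * P"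
proof -
  interpret cring "D_ring n" by (rule cring_D_ring)
  let ?R = "D_ring n"
  have P: "P = inv\<^bsub>?R\<^esub> (E \<otimes>\<^bsub>?R\<^esub> E) \<otimes>\<^bsub>?R\<^esub> inv\<^bsub>?R\<^esub> Q"
    unfolding P_def using E Units_closed[OF E] by (simp add: int_pow_def2 numeral_2_eq_2 nat_pow_Suc)
  have EE: "E \<otimes>\<^bsub>?R\<^esub> E \<in> Units ?R" using E by simp
  have Pc: "P \<in> carrier ?R" unfolding P using EE Q by simp
  then show "degree P \<le> n" by (simp add: D_ring_simps)
  have c: "E \<in> carrier ?R" "Q \<in> carrier ?R" "inv\<^bsub>?R\<^esub> Q \<in> carrier ?R" "inv\<^bsub>?R\<^esub> (E \<otimes>\<^bsub>?R\<^esub> E) \<in> carrier ?R"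
    using E Q EE by auto
  have "(E \<otimes>\<^bsub>?R\<^esub> E) \<otimes>\<^bsub>?R\<^esub> Q \<otimes>\<^bsub>?R\<^esub> P =
      ((E \<otimes>\<^bsub>?R\<^esub> E) \<otimes>\<^bsub>?R\<^esub> inv\<^bsub>?R\<^esub> (E \<otimes>\<^bsub>?R\<^esub> E)) \<otimes>\<^bsub>?R\<^esub> (Q \<otimes>\<^bsub>?R\<^esub> inv\<^bsub>?R\<^esub> Q)"
    unfolding P using c by (simp add: m_ac)
  also have "\<dots> = \<one>\<^bsub>?R\<^esub>" using EE Q by simp
  finally have "(E * E * Q * P) mod monom 1 (Suc n) = 1"
    by (simp add: D_ring_simps mod_mult_left_eq mod_mult_right_eq mult.assoc)
  then have "(E * E * Q * P) mod monom 1 (Suc n) = 1 mod monom 1 (Suc n)"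
    by (simp add: mod_monom_eq_iff_degree)
  then show "monom 1 (Suc n) dvd 1 - E * E * Q * P"
    by (subst (asm) mod_eq_dvd_iff) (metis dvd_minus_iff minus_diff_eq)
qed

text \<open>The elimination of \<open>SF\<close>: the hypotheses say that \<open>LW = c / E\<close>, that \<open>SF = c * Q / LW = Q * E\<close>, and
that \<open>P = 1 / (E * E * Q)\<close>, so that \<open>c * P * SF = c / E = LW\<close>. Written as an identity of polynomials it
avoids divisions in the quotient ring.\<close>

lemma truncated_solution:
  fixes LW SF E Q P :: "real poly" and c :: real and X :: "real poly"
  assumes 1: "X dvd LW * E - [:c:]" and 2: "X dvd LW * SF - [:c:] * Q" and 3: "X dvd 1 - E * E * Q * P"
  shows "X dvd LW - [:c:] * P * SF"
proof -
  have "LW - k * P * SF = LW * (1 - E * E * Q * P) + (LW * E - k) * (E * Q * P)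
      + (P * SF) * (LW * E - k) - (P * E) * (LW * SF - k * Q)" for k
    by (simp add: algebra_simps)
  from this[of "[:c:]"]
  have "LW - [:c:] * P * SF = LW * (1 - E * E * Q * P) + (LW * E - [:c:]) * (E * Q * P)
      + (P * SF) * (LW * E - [:c:]) - (P * E) * (LW * SF - [:c:] * Q)" .
  then show ?thesis using assms by (simp only: dvd_add dvd_diff dvd_mult dvd_mult2)
qed

lemma coeff_laplace_character: 
  "coeff (laplace_character G n) k = (if k \<le> n then (- 1) ^ k / fact k * moment G k else 0)"
  by (simp add: laplace_character_def coeff_sum)

lemma degree_laplace_character: "degree (laplace_character G n) \<le> n"
  by (rule degree_le) (simp add: coeff_laplace_character)

lemma coeff_signed_shift: "coeff (signed_shift p) k = - coeff p (Suc k)"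
  by (simp add: signed_shift_def coeff_poly_shift)

lemma D_act_eq_sum: "degree p \<le> n \<Longrightarrow> D_act p f x = (\<Sum>k\<le>n. coeff p k * (deriv ^^ k) f x)"
  unfolding D_act_def by (rule sum.mono_neutral_left) (auto simp: coeff_eq_0)

section \<open>The antiderivative of a smoothly varying tail\<close>

lemma interval_measure_cdf:
  assumes "finite_borel_measure M"
  shows "interval_measure (cdf M) = M"
proof -
  interpret finite_borel_measure M by fact
  have A: "\<And>x y. x \<le> y \<Longrightarrow> cdf M x \<le> cdf M y" "\<And>a. continuous (at_right a) (cdf M)"
    "(cdf M \<longlongrightarrow> 0) at_bot" "(cdf M \<longlongrightarrow> measure M (space M)) at_top"
    by (rule cdf_nondecreasing cdf_is_right_cont cdf_lim_at_bot cdf_lim_at_top; assumption)+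
  show ?thesis
    by (rule cdf_unique'[OF finite_borel_measure_interval_measure[OF A] assms cdf_interval_measure[OF A(1-3)]]) auto
qed

lemma D_inv_has_derivative:
  assumes int: "set_integrable lborel {a..} h" and cont: "continuous_on {a..} h" and t: "a < t"
  shows "(D_inv h has_real_derivative h t) (at t)"
proof -
  have eq: "D_inv h x = D_inv h a + integral {a..x} h" if "a \<le> x" for x
  proof -
    have "(LBINT y:{a..<x} \<union> {x..}. h y) = (LBINT y:{a..<x}. h y) + (LBINT y:{x..}. h y)"
      by (rule set_integral_Un) (use that in \<open>auto intro!: set_integrable_subset[OF int]\<close>)
    moreover have "{a..<x} \<union> {x..} = {a..}" using that by auto
    moreover have "(LBINT y:{a..<x}. h y) = (LBINT y:{a..x}. h y)"
    proof (rule set_integral_cong_set)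
      have mb: "set_borel_measurable lborel A h" if "A \<subseteq> {a..}" "A \<in> sets borel" for A
      proof -
        have "set_integrable lborel A h" by (rule set_integrable_subset[OF int]) (use that in auto)
        then show ?thesis unfolding set_integrable_def set_borel_measurable_def by (rule borel_measurable_integrable)
      qed
      show "set_borel_measurable lborel {a..<x} h" "set_borel_measurable lborel {a..x} h"
        by (rule mb; force)+
      show "AE y in lborel. (y \<in> {a..x}) = (y \<in> {a..<x})"
        using AE_lborel_singleton[of x] by eventually_elim (use that in auto)
    qed
    moreover have "(LBINT y:{a..x}. h y) = integral {a..x} h"
      by (rule set_borel_integral_eq_integral(2)) (rule set_integrable_subset[OF int], auto)
    ultimately show ?thesis by (simp add: D_inv_def)
  qed
  have "((\<lambda>x. integral {a..x} h) has_real_derivative h t) (at t within {a..t + 1})"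
    by (rule integral_has_real_derivative) (use t in \<open>auto intro: continuous_on_subset[OF cont]\<close>)
  then have "((\<lambda>x. integral {a..x} h) has_real_derivative h t) (at t)"
    using t by (subst (asm) at_within_interior) auto
  then have "((\<lambda>x. D_inv h a + integral {a..x} h) has_real_derivative h t) (at t)"
    by (auto intro!: derivative_eq_intros)
  then show ?thesis
  proof (rule has_field_derivative_transform_within_open[of _ _ _ "{a<..}"])
    show "D_inv h a + integral {a..x} h = D_inv h x" if "x \<in> {a<..}" for x
      by (rule eq[symmetric]) (use that in simp)
  qed (use t in auto)
qed

text \<open>Higher derivatives at a point depend only on the function near it; \<open>D_inv h\<close> has derivative \<open>h\<close> only on
a half-line.\<close>

lemma higher_deriv_cong_open:
  assumes "open U" "\<And>x. x \<in> U \<Longrightarrow> f x = g x" "x \<in> U"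
  shows "(deriv ^^ k) f x = (deriv ^^ k) g x"
  using assms(3)
proof (induction k arbitrary: x)
  case (Suc k)
  have "deriv ((deriv ^^ k) f) x = deriv ((deriv ^^ k) g) x"
  proof (rule deriv_cong_ev[OF _ refl])
    show "\<forall>\<^sub>F y in nhds x. (deriv ^^ k) f y = (deriv ^^ k) g y"
      using eventually_nhds_in_open[OF assms(1) Suc.prems] by eventually_elim (rule Suc.IH)
  qed
  then show ?case by simp
qed (use assms in simp)

lemma D_inv_derivatives:
  assumes int: "\<And>a. t0 < a \<Longrightarrow> set_integrable lborel {a..} h"
    and diff: "\<And>k t. k < M \<Longrightarrow> t0 < t \<Longrightarrow> (deriv ^^ k) h differentiable (at t)" and M: "0 < M"
  shows "\<And>k t. t0 < t \<Longrightarrow> (deriv ^^ Suc k) (D_inv h) t = (deriv ^^ k) h t"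
    and "\<And>i t. i \<le> M \<Longrightarrow> t0 < t \<Longrightarrow> ((deriv ^^ i) (D_inv h) has_real_derivative (deriv ^^ Suc i) (D_inv h) t) (at t)"
proof -
  have cont: "continuous_on {a..} h" if "t0 < a" for a
    using diff[of 0] M that
    by (intro continuous_at_imp_continuous_on ballI differentiable_imp_continuous_within) auto
  have d0: "(D_inv h has_real_derivative h t) (at t)" if t: "t0 < t" for t
    by (rule D_inv_has_derivative[of "(t0 + t) / 2"]) (use t in \<open>auto intro!: int cont\<close>)
  show eq: "(deriv ^^ Suc k) (D_inv h) t = (deriv ^^ k) h t" if "t0 < t" for k t
  proof -
    have "(deriv ^^ Suc k) (D_inv h) t = (deriv ^^ k) (deriv (D_inv h)) t" by (simp only: funpow_Suc_right comp_def)
    also have "\<dots> = (deriv ^^ k) h t"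
      by (rule higher_deriv_cong_open[of "{t0<..}"]) (use that d0 in \<open>auto intro: DERIV_imp_deriv\<close>)
    finally show ?thesis .
  qed
  show "((deriv ^^ i) (D_inv h) has_real_derivative (deriv ^^ Suc i) (D_inv h) t) (at t)" if "i \<le> M" "t0 < t" for i t
  proof (cases i)
    case 0
    then show ?thesis using d0[OF that(2)] eq[of t 0] that by simp
  next
    case (Suc k)
    have "((deriv ^^ k) h has_real_derivative (deriv ^^ Suc k) h t) (at t)"
      using diff[of k t] that Suc by (simp add: DERIV_deriv_iff_real_differentiable)
    then have "((deriv ^^ Suc k) (D_inv h) has_real_derivative (deriv ^^ Suc k) h t) (at t)"
      by (rule has_field_derivative_transform_within_open[of _ _ _ "{t0<..}"]) (use that eq in auto)
    then show ?thesis using eq[OF that(2), of "Suc k"] Suc by simp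
  qed
qed

text \<open>All bounds of the locale hold ultimately; the constants \<open>b\<close> and \<open>C\<close> are common thresholds for the
finitely many of them. The exponent \<open>\<gamma>\<close>, halfway between \<open>m\<close> and \<open>\<alpha>\<close>, gives the right moments of order
\<open>m\<close>, and the exponent \<open>r\<close> gives the left ones.\<close>

lemma smooth_random_walkI:
  fixes N :: "real measure" and \<alpha> \<rho> :: real and m M :: nat
  defines "h \<equiv> \<lambda>x. measure N {x<..}"
  assumes N: "real_distribution N" and mean: "(\<integral>y. y \<partial>N) < 0"
    and rv: "regularly_varying h (- \<alpha>)" and SR: "h \<in> SR \<rho> M"
    and m: "1 \<le> m" "m \<le> M" "real m < \<alpha>"
    and left: "real m < r" "(\<integral>\<^sup>+x\<in>{..0}. ennreal (\<bar>x\<bar> powr r) \<partial>N) < \<infinity>"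
  shows "\<exists>b C s. smooth_random_walk N h (\<lambda>k. (deriv ^^ k) (D_inv h)) m b C s"
proof -
  interpret N: real_distribution N by (rule N)
  have anti: "antimono h" unfolding h_def by (intro antimonoI N.finite_measure_mono) auto
  have [measurable]: "h \<in> borel_measurable borel" by (rule borel_measurable_antimono[OF anti])
  have pos: "0 < h x" for x
  proof -
    have nn: "0 \<le> h t" for t by (simp add: h_def)
    have "\<not> (\<forall>\<^sub>F t in at_top. h t < 0)"
    proof
      assume "\<forall>\<^sub>F t in at_top. h t < 0"
      then obtain t where "h t < 0" using eventually_happens'[OF trivial_limit_at_top_linorder] by blast
      then show False using nn[of t] by simp
    qed
    then have "\<forall>\<^sub>F t in at_top. 0 < h t" using rv by (simp add: regularly_varying_def)
    then have "\<forall>\<^sub>F t in at_top. 0 < h t \<and> x \<le> t" using eventually_ge_at_top[of x] by (rule eventually_conj)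
    then obtain t where "0 < h t" "x \<le> t" using eventually_happens'[OF trivial_limit_at_top_linorder] by blast
    then show ?thesis using antimonoD[OF anti, of x t] by simp
  qed
  obtain C1 where C1: "1 \<le> C1" "\<forall>\<^sub>F x in at_top. h (x / 2) \<le> C1 * h x"
    using regularly_varying_half[OF rv pos] by blast
  define \<gamma> where "\<gamma> = (real m + \<alpha>) / 2"
  have \<gamma>: "real m < \<gamma>" "\<gamma> < \<alpha>" "1 < \<gamma>" "0 < \<gamma>" using m by (auto simp: \<gamma>_def)
  obtain b1 where b1: "1 \<le> b1" "\<And>x t. b1 \<le> x \<Longrightarrow> x \<le> t \<Longrightarrow> h t \<le> 2 powr \<gamma> * (x / t) powr \<gamma> * h x"
    using regularly_varying_power_bound[OF rv pos anti \<gamma>(2,4)] by blast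
  have tib: "set_integrable lborel {x..} h" "(LBINT t:{x..}. h t) \<le> 2 powr \<gamma> / (\<gamma> - 1) * x * h x"
      "x * h (2 * x) \<le> (LBINT t:{x..}. h t)" if "b1 \<le> x" for x
    by (rule tail_integral_bounds[OF anti pos \<gamma>(3) b1(1) _ that], rule b1(2), assumption+)+
  have h_int: "set_integrable lborel {x..} h" for x
  proof (cases "b1 \<le> x")
    case False
    have "set_integrable lborel {x..b1} h"
      unfolding set_integrable_def
    proof (rule Bochner_Integration.integrable_bound[where f="indicat_real {x..b1}"])
      show "integrable lborel (indicat_real {x..b1})" using False by (intro integrable_real_indicator) auto
      show "AE y in lborel. norm (indicat_real {x..b1} y *\<^sub>R h y) \<le> norm (indicat_real {x..b1} y)"
        using pos N.prob_le_1 by (auto simp: h_def split: split_indicator)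
    qed measurable
    then have "set_integrable lborel ({x..b1} \<union> {b1..}) h" using tib(1)[of b1] by (intro set_integrable_Un) auto
    moreover have "{x..b1} \<union> {b1..} = {x..}" using False by auto
    ultimately show ?thesis by simp
  qed (rule tib(1))
  define c2 where "c2 = 2 powr \<gamma> / (\<gamma> - 1)"
  define c3 where "c3 = 2 powr \<gamma> * b1 powr \<gamma> * h b1"
  have hdec: "h t \<le> c3 * t powr (- \<gamma>)" if "b1 \<le> t" for t
    using b1(2)[OF order_refl that] b1(1) that by (simp add: c3_def powr_divide powr_minus field_simps)
  from SR obtain t0 where diff0: "\<And>k t. k < M \<Longrightarrow> t0 < t \<Longrightarrow> (deriv ^^ k) h differentiable (at t)"
    unfolding SR_def ultimately_C_def by blast
  define t1 where "t1 = max t0 b1"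
  let ?g = "\<lambda>k. (deriv ^^ k) (D_inv h)"
  have M: "0 < M" using m by simp
  have D: "?g (Suc k) t = (deriv ^^ k) h t" if "t1 < t" for k t
    by (rule D_inv_derivatives(1)[of t1, OF _ _ M]) (use diff0 tib(1) that in \<open>auto simp: t1_def\<close>)
  have Dd: "(?g i has_real_derivative ?g (Suc i) t) (at t)" if "i \<le> M" "t1 < t" for i t
    by (rule D_inv_derivatives(2)[of t1, OF _ _ M that]) (use diff0 tib(1) that in \<open>auto simp: t1_def\<close>)
  have "\<exists>K. \<forall>\<^sub>F x in at_top. \<bar>?g k x\<bar> \<le> K * (x * h x / x ^ k)" if "k \<le> Suc m" for k
  proof (cases k)
    case 0
    have "\<forall>\<^sub>F x in at_top. \<bar>?g k x\<bar> \<le> c2 * (x * h x / x ^ k)"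
      using eventually_ge_at_top[of b1]
    proof eventually_elim
      case (elim x)
      have "0 \<le> x * h (2 * x)" using elim b1(1) pos[of "2 * x"] by simp
      then have "0 \<le> (LBINT t:{x..}. h t)" using tib(3)[OF elim] by linarith
      then show ?case using tib(2)[OF elim] 0 by (simp add: D_inv_def c2_def)
    qed
    then show ?thesis by blast
  next
    case (Suc j)
    then have "j \<le> M" using that m by simp
    then obtain K where "\<forall>\<^sub>F x in at_top. \<bar>(deriv ^^ j) h x\<bar> \<le> K * h x / x ^ j"
      using smoothly_varying_derivative_bounds[OF anti pos C1(2) SR] by blast
    then have "\<forall>\<^sub>F x in at_top. \<bar>?g k x\<bar> \<le> K * (x * h x / x ^ k)"
      using eventually_gt_at_top[of "max 1 t1"]
    proof eventually_elim
      case (elim x)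
      then show ?case using D[of x j] Suc by simp
    qed
    then show ?thesis by blast
  qed
  then have "\<forall>k. \<exists>K. k \<le> Suc m \<longrightarrow> (\<forall>\<^sub>F x in at_top. \<bar>?g k x\<bar> \<le> K * (x * h x / x ^ k))"
    by blast
  from choice[OF this] obtain K where
    K: "\<forall>k. k \<le> Suc m \<longrightarrow> (\<forall>\<^sub>F x in at_top. \<bar>?g k x\<bar> \<le> K k * (x * h x / x ^ k))" ..
  have "\<forall>\<^sub>F x in at_top. \<forall>k\<in>{..Suc m}. \<bar>?g k x\<bar> \<le> K k * (x * h x / x ^ k)"
  proof (rule eventually_ball_finite[OF finite_atMost ballI])
    fix k assume "k \<in> {..Suc m}"
    then have "k \<le> Suc m" by (rule atMost_iff[THEN iffD1])
    then show "\<forall>\<^sub>F x in at_top. \<bar>?g k x\<bar> \<le> K k * (x * h x / x ^ k)" by (rule K[rule_format])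
  qed
  then obtain b2 where b2': "\<forall>x\<ge>b2. \<forall>k\<in>{..Suc m}. \<bar>?g k x\<bar> \<le> K k * (x * h x / x ^ k)"
    unfolding eventually_at_top_linorder ..
  have b2: "\<bar>?g k x\<bar> \<le> K k * (x * h x / x ^ k)" if "b2 \<le> x" "k \<le> Suc m" for x k
    using b2'[rule_format, OF that(1) atMost_iff[THEN iffD2, OF that(2)]] .
  obtain b3 where b3: "\<And>x. b3 \<le> x \<Longrightarrow> h (x / 2) \<le> C1 * h x"
    using C1(2) unfolding eventually_at_top_linorder by blast
  define b where "b = 2 * max 1 (max b1 (max b2 (max b3 (t1 + 1))))"
  have bb: "1 \<le> b / 2" "b1 \<le> b / 2" "b2 \<le> b / 2" "b3 \<le> b / 2" "t1 < b / 2"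
    by (simp_all add: b_def le_max_iff_disj less_max_iff_disj)
  define C where "C = 1 + C1 + (\<Sum>k\<le>Suc m. \<bar>K k\<bar>) + \<bar>c3\<bar>"
  have Kn: "0 \<le> (\<Sum>k\<le>Suc m. \<bar>K k\<bar>)" by (intro sum_nonneg) auto
  have C: "1 \<le> C" "C1 \<le> C" "\<bar>c3\<bar> \<le> C" using C1 Kn by (auto simp: C_def)
  have KC: "K k \<le> C" if "k \<le> Suc m" for k
  proof -
    have "\<bar>K k\<bar> \<le> (\<Sum>k\<le>Suc m. \<bar>K k\<bar>)" using that by (intro member_le_sum) auto
    then show ?thesis using C1 by (simp add: C_def)
  qed
  have bx: "1 \<le> x" "b1 \<le> x" "b2 \<le> x" "b3 \<le> 2 * x" "t1 < x" if "b \<le> 2 * x" for x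
    using that bb by linarith+
  have mom: "integrable N (\<lambda>y. \<bar>y\<bar> ^ m)"
  proof (rule integrableI_bounded)
    have 1: "(\<integral>\<^sup>+z. ennreal (max 0 z ^ m) \<partial>N) < \<infinity>"
    proof (rule nn_integral_power_finite[where b=b1 and K=c3 and s=\<gamma>])
      show "measure N {x<..} \<le> c3 * x powr - \<gamma>" if "b1 \<le> x" for x using hdec[OF that] by (simp add: h_def)
    qed (use b1(1) \<gamma> in \<open>simp_all add: N.finite_measure_axioms\<close>)
    have "(\<integral>\<^sup>+y. ennreal (norm (\<bar>y\<bar> ^ m)) \<partial>N) \<le>
       (\<integral>\<^sup>+y. ennreal (max 0 y ^ m) + (ennreal (\<bar>y\<bar> powr r) * indicator {..0} y + 1) \<partial>N)"
    proof (rule nn_integral_mono)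
      fix y :: real
      show "ennreal (norm (\<bar>y\<bar> ^ m)) \<le> ennreal (max 0 y ^ m) + (ennreal (\<bar>y\<bar> powr r) * indicator {..0} y + 1)"
      proof (cases "0 \<le> y")
        case True
        then show ?thesis by (simp add: max_def add_increasing2)
      next
        case y: False
        have "\<bar>y\<bar> ^ m \<le> \<bar>y\<bar> powr r + 1"
        proof (cases "\<bar>y\<bar> \<le> 1")
          case True
          then have "\<bar>y\<bar> ^ m \<le> 1" by (intro power_le_one) auto
          then show ?thesis using powr_ge_zero[of "\<bar>y\<bar>" r] by linarith
        next
          case False
          then have "\<bar>y\<bar> powr real m \<le> \<bar>y\<bar> powr r" using left by (intro powr_mono) auto
          then show ?thesis using y by (simp add: powr_realpow)
        qed
        then have "ennreal (norm (\<bar>y\<bar> ^ m)) \<le> ennreal (\<bar>y\<bar> powr r + 1)" by (intro ennreal_leI) simp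
        also have "\<dots> = ennreal (\<bar>y\<bar> powr r) + 1" by (subst ennreal_plus) auto
        also have "\<dots> \<le> ennreal (max 0 y ^ m) + (ennreal (\<bar>y\<bar> powr r) + 1)"
          by (rule add_increasing[OF zero_le order_refl])
        finally show ?thesis using y by simp
      qed
    qed
    also have "\<dots> = (\<integral>\<^sup>+y. ennreal (max 0 y ^ m) \<partial>N) + ((\<integral>\<^sup>+y\<in>{..0}. ennreal (\<bar>y\<bar> powr r) \<partial>N) + 1)"
      by (subst nn_integral_add, measurable, subst nn_integral_add) (auto simp: N.emeasure_space_1[simplified])
    also have "\<dots> < \<infinity>" using 1 left(2) by simp
    finally show "(\<integral>\<^sup>+y. ennreal (norm (\<bar>y\<bar> ^ m)) \<partial>N) < \<infinity>" .
  qed measurable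
  have g0: "?g 0 = D_inv h" by simp
  have D_meas: "D_inv h \<in> borel_measurable borel"
  proof (rule borel_measurable_mono, rule monoI)
    fix x y :: real assume "x \<le> y"
    then have "(LBINT t:{y..}. h t) \<le> (LBINT t:{x..}. h t)"
      using h_int[of x] h_int[of y] pos unfolding set_lebesgue_integral_def set_integrable_def
      by (intro integral_mono) (auto split: split_indicator simp: less_imp_le)
    then show "D_inv h x \<le> D_inv h y" by (simp add: D_inv_def)
  qed
  have "smooth_random_walk N h ?g m b C (\<gamma> - 1)"
  proof unfold_locales
    show "1 \<le> m" by fact
    show "1 \<le> b" using bb by linarith
    show "1 \<le> C" by (rule C)
    show "antimono h" by (rule anti)
    show "0 < h x" for x by (rule pos)
    show "h (x / 2) \<le> C * h x" if "b \<le> x" for x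
    proof -
      have "b3 \<le> x" using that bb by linarith
      then show ?thesis
        by (rule order_trans[OF b3 mult_right_mono[OF C(2) less_imp_le[OF pos]]])
    qed
    show "?g 1 x = h x" if "b \<le> 2 * x" for x using D[of x 0] bx[OF that] by simp
    show "(?g i has_real_derivative ?g (Suc i) x) (at x)" if "i \<le> m" "b \<le> 2 * x" for i x
      using Dd[of i x] that bx[OF that(2)] m by simp
    show "\<bar>?g i x\<bar> \<le> C * (x * h x / x ^ i)" if "i \<le> Suc m" "b \<le> 2 * x" for i x
    proof (rule order_trans[OF b2])
      show "K i * (x * h x / x ^ i) \<le> C * (x * h x / x ^ i)"
        using KC[OF that(1)] pos[of x] bx(1)[OF that(2)] by (intro mult_right_mono) auto
    qed (use that bx[OF that(2)] in auto)
    show "x * h x \<le> C * - ?g 0 x" if "b \<le> 2 * x" for x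
    proof -
      note B = bx[OF that]
      define L where "L = (LBINT t:{x..}. h t)"
      have L: "x * h (2 * x) \<le> L" unfolding L_def by (rule tib(3)[OF B(2)])
      have L0: "0 \<le> L" using L B(1) mult_nonneg_nonneg[of x "h (2 * x)"] pos[of "2 * x"] by linarith
      have "x * h x \<le> x * (C1 * h (2 * x))" using b3[of "2 * x"] B by (intro mult_left_mono) auto
      moreover have "x * (C1 * h (2 * x)) = C1 * (x * h (2 * x))" by simp
      moreover have "C1 * (x * h (2 * x)) \<le> C1 * L" using L C1(1) by (intro mult_left_mono) auto
      moreover have "C1 * L \<le> C * L" using C(2) L0 by (rule mult_right_mono)
      ultimately have "x * h x \<le> C * L" by linarith
      moreover have "- ?g 0 x = L" by (simp add: D_inv_def L_def)
      ultimately show ?thesis by simp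
    qed
    show "?g 0 \<in> borel_measurable borel" unfolding g0 by (rule D_meas)
    show "h x = measure N {x<..}" for x by (simp add: h_def)
    show "integrable N (\<lambda>y. y ^ i)" if "i \<le> m" for i
      by (rule integrable_power_le[OF N.finite_measure_axioms _ mom that]) simp
    show "(\<integral>y. y \<partial>N) < 0" by (rule mean)
    show "real (m - 1) < \<gamma> - 1" using \<gamma> m by simp
    show "x * h x \<le> C * x powr (- (\<gamma> - 1))" if "b \<le> x" for x
    proof -
      have x: "b1 \<le> x" "0 < x" using that bb by linarith+
      have "x * h x \<le> x * (c3 * x powr (- \<gamma>))" using hdec[OF x(1)] x by (intro mult_left_mono) auto
      moreover have "x * (c3 * x powr (- \<gamma>)) = c3 * x powr (- (\<gamma> - 1))" using x by (simp add: powr_minus powr_diff field_simps)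
      moreover have "c3 * x powr (- (\<gamma> - 1)) \<le> C * x powr (- (\<gamma> - 1))" using C by (intro mult_right_mono) auto
      ultimately show ?thesis by linarith
    qed
  qed
  then show ?thesis by blast
qed

section \<open>The expansion in terms of ladder heights\<close>

text \<open>The steps are independent and identically distributed, so the sequence of steps has the product law
on the space of step sequences. Independence is given over the index set \<open>{1..}\<close>; hence the shift.\<close>

lemma distr_walk_steps:
  fixes P :: "'a measure" and X :: "nat \<Rightarrow> 'a \<Rightarrow> real"
  assumes P: "prob_space P" and ind: "prob_space.indep_vars P (\<lambda>_. borel) X {1..}"
    and N: "\<And>n. 1 \<le> n \<Longrightarrow> distr P borel (X n) = N"
  shows "(\<lambda>s i. X (Suc i) s) \<in> measurable P (\<Pi>\<^sub>M i\<in>UNIV. N)"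
    and "distr P (\<Pi>\<^sub>M i\<in>UNIV. N) (\<lambda>s i. X (Suc i) s) = (\<Pi>\<^sub>M i\<in>UNIV. N)"
proof -
  interpret prob_space P by (rule P)
  have rv: "random_variable borel (X i)" if "1 \<le> i" for i
    using ind that by (auto simp: indep_vars_def)
  have sN: "sets N = sets borel" using N[of 1] by auto
  have ps: "prob_space N" using N[of 1] prob_space_distr[OF rv[of 1]] by simp
  have sS: "sets (\<Pi>\<^sub>M i\<in>UNIV. N) = sets (\<Pi>\<^sub>M i\<in>UNIV::nat set. borel)" by (intro sets_PiM_cong) (auto simp: sN)
  show m: "(\<lambda>s i. X (Suc i) s) \<in> measurable P (\<Pi>\<^sub>M i\<in>UNIV. N)"
    unfolding measurable_cong_sets[OF refl sS] by (rule measurable_PiM_single') (use rv in auto)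
  have D: "distr P (\<Pi>\<^sub>M i\<in>{1..}. borel) (\<lambda>s. \<lambda>i\<in>{1..}. X i s) = (\<Pi>\<^sub>M i\<in>{1..}. N)"
  proof -
    have "distr P (\<Pi>\<^sub>M i\<in>{1..}. borel) (\<lambda>s. \<lambda>i\<in>{1..}. X i s) = (\<Pi>\<^sub>M i\<in>{1..}. distr P borel (X i))"
      using ind by (subst (asm) indep_vars_iff_distr_eq_PiM') (use rv in auto)
    also have "\<dots> = (\<Pi>\<^sub>M i\<in>{1..}. N)" by (intro PiM_cong) (use N in auto)
    finally show ?thesis .
  qed
  have mr: "(\<lambda>s. \<lambda>i\<in>{1..}. X i s) \<in> measurable P (\<Pi>\<^sub>M i\<in>{1::nat..}. borel)"
    by (intro measurable_restrict) (use rv in auto)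
  have "(\<Pi>\<^sub>M i\<in>UNIV::nat set. N) = distr (\<Pi>\<^sub>M i\<in>{1..}. N) (\<Pi>\<^sub>M i\<in>UNIV. N) (\<lambda>\<omega>. \<lambda>n\<in>UNIV. \<omega> (Suc n))"
    by (rule distr_PiM_reindex[symmetric, of "{1..}" "\<lambda>_. N" Suc UNIV]) (use ps in auto)
  also have "\<dots> = distr (distr P (\<Pi>\<^sub>M i\<in>{1..}. borel) (\<lambda>s. \<lambda>i\<in>{1..}. X i s)) (\<Pi>\<^sub>M i\<in>UNIV. N) (\<lambda>\<omega>. \<lambda>n\<in>UNIV. \<omega> (Suc n))"
    unfolding D ..
  also have "\<dots> = distr P (\<Pi>\<^sub>M i\<in>UNIV. N) ((\<lambda>\<omega>. \<lambda>n\<in>UNIV. \<omega> (Suc n)) \<circ> (\<lambda>s. \<lambda>i\<in>{1..}. X i s))"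
  proof (rule distr_distr[OF _ mr])
    show "(\<lambda>\<omega>. \<lambda>n\<in>UNIV. \<omega> (Suc n)) \<in> measurable (\<Pi>\<^sub>M i\<in>{1::nat..}. borel) (\<Pi>\<^sub>M i\<in>UNIV. N)"
      unfolding measurable_cong_sets[OF refl sS] by (intro measurable_restrict measurable_component_singleton) auto
  qed
  also have "((\<lambda>\<omega>. \<lambda>n\<in>UNIV. \<omega> (Suc n)) \<circ> (\<lambda>s. \<lambda>i\<in>{1..}. X i s)) = (\<lambda>s i. X (Suc i) s)"
    by (auto simp: fun_eq_iff)
  finally show "distr P (\<Pi>\<^sub>M i\<in>UNIV. N) (\<lambda>s i. X (Suc i) s) = (\<Pi>\<^sub>M i\<in>UNIV. N)" ..
qed

lemma walk_eq_coord: "walk X n s = walk coord n (\<lambda>i. X (Suc i) s)"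
  unfolding walk_def coord_def by (intro sum.cong) auto

lemma walk_functionals_eq_coord:
  "walk_max X s = walk_max coord (\<lambda>i. X (Suc i) s)"
  "ascending_time X s = ascending_time coord (\<lambda>i. X (Suc i) s)"
  "descending_time X s = descending_time coord (\<lambda>i. X (Suc i) s)"
  by (simp_all add: walk_max_def ascending_time_def descending_time_def walk_eq_coord[of X])

context smooth_random_walk
begin

lemma asc_law_mass: "(\<integral>y. y ^ 0 \<partial>asc_law) = 1 - never_prob"
proof -
  have "(\<integral>z. z ^ 0 \<partial>max_law) = never_prob * 0 ^ 0 +
      (\<Sum>i\<le>0. real (0 choose i) * (\<integral>y. y ^ i \<partial>asc_law) * (\<integral>z. z ^ (0 - i) \<partial>max_law))"
    by (rule max_law_moment_ladder) simp
  then show ?thesis using max_law.prob_space by simp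
qed

lemma desc_law_mean: "(\<integral>y. y \<partial>desc_law) \<noteq> 0"
proof -
  have "never_prob * (\<integral>y. y ^ Suc 0 \<partial>desc_law) = (\<Sum>i\<le>0. real (Suc 0 choose i) * (\<integral>z. z ^ i \<partial>max_law) * (\<integral>y. y ^ (Suc 0 - i) \<partial>N))"
    using m by (intro desc_law_moment step_moments max_law_moments) auto
  then have "never_prob * (\<integral>y. y \<partial>desc_law) = (\<integral>y. y \<partial>N)"
    using max_law.prob_space by simp
  then show ?thesis using step_mean by auto
qed

text \<open>Here \<open>E\<close> is \<open>Id - L\<^sub>F\<^sub>+\<close> and \<open>Q\<close> is \<open>S L\<^sub>F\<^sub>-\<close>, up to terms of order \<open>m\<close>. The binomial identities between the
moments become products of polynomials after division by the factorials, and the operator that solves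
\<open>p * S L\<^sub>F = L\<^sub>W\<close> is \<open>never_prob * P\<close>.\<close>

lemma ladder_operator_expansion:
  fixes E Q P :: "real poly"
  assumes E: "\<And>k. k < m \<Longrightarrow> coeff E k = (if k = 0 then 1 else 0) - (- 1) ^ k / fact k * (\<integral>y. y ^ k \<partial>asc_law)"
    and Q: "\<And>k. k < m \<Longrightarrow> coeff Q k = (- 1) ^ k / fact (Suc k) * (\<integral>y. y ^ Suc k \<partial>desc_law)"
    and P: "monom 1 m dvd 1 - E * E * Q * P"
  shows "((\<lambda>x. (T x - never_prob * (\<Sum>k<m. coeff P k * g k x)) / (x * h x / x ^ (m - 1))) \<longlongrightarrow> 0) at_top"
proof -
  define LW :: "real poly" where "LW = (\<Sum>k<m. monom ((- 1) ^ k / fact k * (\<integral>z. z ^ k \<partial>max_law)) k)"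
  define SF :: "real poly" where "SF = (\<Sum>k<m. monom ((- 1) ^ k / fact (Suc k) * (\<integral>y. y ^ Suc k \<partial>N)) k)"
  have cW: "coeff LW k = (- 1) ^ k / fact k * (\<integral>z. z ^ k \<partial>max_law)" if "k < m" for k
    using that by (simp add: LW_def coeff_sum)
  have cF: "coeff SF k = (- 1) ^ k / fact (Suc k) * (\<integral>y. y ^ Suc k \<partial>N)" if "k < m" for k
    using that by (simp add: SF_def coeff_sum del: fact_Suc)
  have bin: "(- 1) ^ i / fact i * A * ((- 1) ^ (j - i) / fact (j - i) * B) = (- 1) ^ j / fact j * (real (j choose i) * A * B)"
    if "i \<le> j" for i j and A B :: real
  proof -
    have "(- 1 :: real) ^ i * (- 1) ^ (j - i) = (- 1) ^ j" using that by (simp flip: power_add)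
    moreover have "real (j choose i) = fact j / (fact i * fact (j - i))" using that by (rule binomial_fact)
    ultimately show ?thesis by (simp add: field_simps)
  qed
  have 1: "monom 1 m dvd LW * E - [:never_prob:]"
    unfolding monom_1_dvd_iff'
  proof (intro allI impI)
    fix j assume j: "j < m"
    have "coeff (LW * E) j = (\<Sum>i\<le>j. coeff E i * coeff LW (j - i))" by (simp add: coeff_mult mult.commute[of LW])
    also have "\<dots> = (\<Sum>i\<le>j. (if i = 0 then 1 else 0) * coeff LW (j - i) - (- 1) ^ j / fact j * (real (j choose i) * (\<integral>y. y ^ i \<partial>asc_law) * (\<integral>z. z ^ (j - i) \<partial>max_law)))"
    proof (rule sum.cong[OF refl])
      fix i assume "i \<in> {..j}"
      then have i: "i \<le> j" by simp
      show "coeff E i * coeff LW (j - i) = (if i = 0 then 1 else 0) * coeff LW (j - i) - (- 1) ^ j / fact j * (real (j choose i) * (\<integral>y. y ^ i \<partial>asc_law) * (\<integral>z. z ^ (j - i) \<partial>max_law))"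
        unfolding bin[OF i, symmetric] using i j by (simp only: E cW le_less_trans left_diff_distrib less_imp_diff_less)
    qed
    also have "\<dots> = (\<Sum>i\<le>j. if i = 0 then coeff LW (j - i) else 0) - (- 1) ^ j / fact j * (\<Sum>i\<le>j. real (j choose i) * (\<integral>y. y ^ i \<partial>asc_law) * (\<integral>z. z ^ (j - i) \<partial>max_law))"
      by (simp add: sum_subtractf sum_distrib_left if_distrib[where f="\<lambda>u. u * _"] cong: if_cong)
    also have "(\<Sum>i\<le>j. if i = 0 then coeff LW (j - i) else 0) = coeff LW j" by simp
    also have "(\<Sum>i\<le>j. real (j choose i) * (\<integral>y. y ^ i \<partial>asc_law) * (\<integral>z. z ^ (j - i) \<partial>max_law)) = (\<integral>z. z ^ j \<partial>max_law) - never_prob * 0 ^ j"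
    proof -
      have "(\<integral>z. z ^ j \<partial>max_law) = never_prob * 0 ^ j +
          (\<Sum>i\<le>j. real (j choose i) * (\<integral>y. y ^ i \<partial>asc_law) * (\<integral>z. z ^ (j - i) \<partial>max_law))"
        by (intro max_law_moment_ladder max_law_moments) (use j in linarith)
      then show ?thesis by linarith
    qed
    finally have "coeff (LW * E) j = never_prob * ((- 1) ^ j / fact j * 0 ^ j)"
      using j by (simp add: cW right_diff_distrib)
    then show "coeff (LW * E - [:never_prob:]) j = 0" by (cases j) auto
  qed
  have 2: "monom 1 m dvd LW * SF - [:never_prob:] * Q"
    unfolding monom_1_dvd_iff'
  proof (intro allI impI)
    fix l assume l: "l < m"
    have "coeff (LW * SF) l = (\<Sum>i\<le>l. coeff LW i * coeff SF (l - i))" by (rule coeff_mult)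
    also have "\<dots> = (\<Sum>i\<le>l. - ((- 1) ^ Suc l / fact (Suc l) * (real (Suc l choose i) * (\<integral>z. z ^ i \<partial>max_law) * (\<integral>y. y ^ (Suc l - i) \<partial>N))))"
    proof (rule sum.cong[OF refl])
      fix i assume "i \<in> {..l}"
      then have i: "i \<le> l" "i \<le> Suc l" and s: "Suc l - i = Suc (l - i)" by auto
      show "coeff LW i * coeff SF (l - i) = - ((- 1) ^ Suc l / fact (Suc l) * (real (Suc l choose i) * (\<integral>z. z ^ i \<partial>max_law) * (\<integral>y. y ^ (Suc l - i) \<partial>N)))"
        unfolding bin[OF i(2), symmetric] unfolding s using i l by (simp add: cW cF del: fact_Suc)
    qed
    also have "\<dots> = - ((- 1) ^ Suc l / fact (Suc l) * (\<Sum>i\<le>l. real (Suc l choose i) * (\<integral>z. z ^ i \<partial>max_law) * (\<integral>y. y ^ (Suc l - i) \<partial>N)))"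
      by (simp only: sum_negf sum_distrib_left)
    also have "(\<Sum>i\<le>l. real (Suc l choose i) * (\<integral>z. z ^ i \<partial>max_law) * (\<integral>y. y ^ (Suc l - i) \<partial>N)) = never_prob * (\<integral>y. y ^ Suc l \<partial>desc_law)"
      using l by (intro desc_law_moment[symmetric] step_moments max_law_moments) auto
    finally have "coeff (LW * SF) l = never_prob * coeff Q l" using l by (simp add: Q del: fact_Suc)
    then show "coeff (LW * SF - [:never_prob:] * Q) l = 0" by simp
  qed
  have "monom 1 m dvd LW - [:never_prob:] * P * SF"
    by (rule truncated_solution[OF 1 2 P])
  then have sol: "coeff ([:never_prob:] * P * SF) l = coeff LW l" if "l < m" for l
    using that by (simp add: monom_1_dvd_iff')
  have "((\<lambda>x. (T x - (\<Sum>k<m. (never_prob * coeff P k) * g k x)) / (x * h x / x ^ (m - 1))) \<longlongrightarrow> 0) at_top"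
  proof (rule tail_expansion)
    fix l assume l: "l < m"
    have "(\<Sum>k\<le>l. never_prob * coeff P k * ((- 1) ^ (l - k) / fact (Suc (l - k)) * (\<integral>y. y ^ Suc (l - k) \<partial>N))) =
        (\<Sum>k\<le>l. coeff ([:never_prob:] * P) k * coeff SF (l - k))"
      using l by (intro sum.cong refl) (simp add: cF del: fact_Suc)
    also have "\<dots> = coeff ([:never_prob:] * P * SF) l" by (rule coeff_mult[symmetric])
    also have "\<dots> = coeff LW l" by (rule sol[OF l])
    finally show "(\<Sum>k\<le>l. never_prob * coeff P k * ((- 1) ^ (l - k) / fact (Suc (l - k)) * (\<integral>y. y ^ Suc (l - k) \<partial>N))) =
        (- 1) ^ l / fact l * (\<integral>z. z ^ l \<partial>max_law)" using cW[OF l] by simp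
  qed
  then show ?thesis by (simp add: sum_distrib_left mult.assoc)
qed

end

lemma moment_cdf:
  assumes "finite_borel_measure M"
  shows "moment (cdf M) k = (\<integral>x. x ^ k \<partial>M)" "finite_moment (cdf M) k \<longleftrightarrow> integrable M (\<lambda>x. x ^ k)"
  by (simp_all add: moment_def finite_moment_def interval_measure_cdf[OF assms])

lemma left_moment_index_obtain:
  assumes "ereal q < left_moment_index F"
  obtains r where "q < r" "(\<integral>\<^sup>+x\<in>{..0}. ennreal (\<bar>x\<bar> powr r) \<partial>interval_measure F) < \<infinity>"
  using assms unfolding left_moment_index_def less_Sup_iff by auto

theorem mainTheorem1:
  fixes P :: "'a measure" and X :: "nat \<Rightarrow> 'a \<Rightarrow> real"
    and F :: "real \<Rightarrow> real" and \<alpha> \<omega> :: real and m :: nat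
  defines "W \<equiv> max_cdf P X"
    and "Fp \<equiv> ascending_ladder_cdf P X"
    and "Fm \<equiv> descending_ladder_cdf P X"
    and "p \<equiv> ascending_prob P X"
    and "\<kappa> \<equiv> left_moment_index F"
    and "R \<equiv> D_ring (m - 1)"
  assumes "prob_space P"
    and "prob_space.indep_vars P (\<lambda>_. borel) X {1..}"
    and "\<And>n. 1 \<le> n \<Longrightarrow> cdf (distr P borel (X n)) = F"
    and "finite_moment F 1" and "moment F 1 < 0"
    and "regularly_varying (tail F) (- \<alpha>)"
    and "1 < \<kappa>"
    and "0 < \<omega>" and "smoothly_varying (tail F) (- \<alpha>) \<omega>"
    and "1 \<le> m" and "ereal (real m) < min (ereal \<omega>) (min (ereal \<alpha>) \<kappa>)"
  shows "finite_moment Fm m \<and> finite_moment Fp (m - 1) \<and>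
    \<one>\<^bsub>R\<^esub> \<ominus>\<^bsub>R\<^esub> laplace_character Fp (m - 1) \<in> Units R \<and>
    signed_shift (laplace_character Fm m) \<in> Units R \<and>
    (\<lambda>x. tail W x - (1 - p) *
        D_act ((\<one>\<^bsub>R\<^esub> \<ominus>\<^bsub>R\<^esub> laplace_character Fp (m - 1)) [^]\<^bsub>R\<^esub> (-2 :: int) \<otimes>\<^bsub>R\<^esub>
               inv\<^bsub>R\<^esub> (signed_shift (laplace_character Fm m)))
          (D_inv (tail F)) x)
      \<in> o[at_top](\<lambda>x. x powi (2 - int m) * tail F x)"
proof -
  interpret P: prob_space P by (rule assms(7))
  have rv: "P.random_variable borel (X i)" if "1 \<le> i" for i
    using assms(8) that by (auto simp: P.indep_vars_def)
  define N where "N = distr P borel (X 1)"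
  have N: "real_distribution N" unfolding N_def by (rule P.real_distribution_distr) (rule rv, simp)
  interpret N: real_distribution N by (rule N)
  have F: "F = cdf N" using assms(9)[of 1] by (simp add: N_def)
  have same: "distr P borel (X n) = N" if "1 \<le> n" for n
    by (rule cdf_unique[OF P.real_distribution_distr N]) (use rv that assms(9) F in auto)
  have fN: "finite_borel_measure N" by (rule N.finite_borel_measure_M)
  have im: "interval_measure F = N" unfolding F by (rule interval_measure_cdf[OF fN])
  have tailF: "tail F = (\<lambda>x. measure N {x<..})"
  proof
    fix x
    have "Lim at_top F = 1"
      unfolding F by (rule tendsto_Lim[OF _ N.cdf_lim_at_top_prob]) simp
    moreover have "measure N {x<..} = 1 - measure N {..x}"
      using N.prob_compl[of "{..x}"] by (simp add: Compl_eq_Diff_UNIV[symmetric])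
    ultimately show "tail F x = measure N {x<..}" by (simp add: tail_def F cdf_def)
  qed
  define M where "M = nat \<lfloor>\<omega>\<rfloor>"
  have SR: "tail F \<in> SR (- \<alpha>) M" using assms(15) by (simp add: smoothly_varying_def Let_def M_def)
  have mlt: "real m < \<omega>" "real m < \<alpha>" "ereal (real m) < left_moment_index F"
    using assms(17) by (auto simp: \<kappa>_def)
  have mM: "m \<le> M" using mlt(1) unfolding M_def by (simp add: le_nat_floor less_imp_le)
  obtain r where r: "real m < r" "(\<integral>\<^sup>+x\<in>{..0}. ennreal (\<bar>x\<bar> powr r) \<partial>N) < \<infinity>"
    using left_moment_index_obtain[OF mlt(3)] unfolding im by blast
  have mean: "(\<integral>y. y \<partial>N) < 0" using assms(11) by (simp add: moment_def im)
  obtain b C s where srw: "smooth_random_walk N (tail F) (\<lambda>k. (deriv ^^ k) (D_inv (tail F))) m b C s"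
    using smooth_random_walkI[OF N mean _ _ assms(16) mM mlt(2) r] assms(12) SR unfolding tailF by blast
  interpret W: smooth_random_walk N "tail F" "\<lambda>k. (deriv ^^ k) (D_inv (tail F))" m b C s by (rule srw)
  \<comment> \<open>the maximum and the ladder variables are functions of the step sequence \<open>Y\<close>, whose law is the product law\<close>
  define Y where "Y = (\<lambda>s i. X (Suc i) s)"
  have Ym [measurable]: "Y \<in> measurable P W.S" and YD: "distr P W.S Y = W.S"
    using distr_walk_steps[OF assms(7,8) same] unfolding Y_def by auto
  have transport: "measure P {s \<in> space P. \<Phi> (Y s)} = measure W.S {\<omega>. \<Phi> \<omega>}"
    if "Measurable.pred W.S \<Phi>" for \<Phi>
  proof -
    have "{\<omega>. \<Phi> \<omega>} \<in> sets W.S" using that by (rule W.sets_Collect_pred)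
    then have "measure (distr P W.S Y) {\<omega>. \<Phi> \<omega>} = measure P (Y -` {\<omega>. \<Phi> \<omega>} \<inter> space P)"
      by (rule measure_distr[OF Ym])
    then show ?thesis unfolding YD by (simp add: vimage_def Int_def conj_commute)
  qed
  note coord = walk_functionals_eq_coord[of X, folded Y_def] walk_eq_coord[of X, folded Y_def]
  have Fp: "Fp = cdf W.asc_law"
  proof
    fix x
    have "Measurable.pred W.S (\<lambda>\<omega>. ascending_time coord \<omega> < \<infinity> \<and> walk coord (the_enat (ascending_time coord \<omega>)) \<omega> \<le> x)"
      by (rule W.measurable_asc_event)
    from transport[OF this] show "Fp x = cdf W.asc_law x"
      unfolding Fp_def ascending_ladder_cdf_def W.asc_law_cdf coord Y_def .
  qed
  have Fm: "Fm = cdf W.desc_law"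
  proof
    fix x
    have "Measurable.pred W.S (\<lambda>\<omega>. descending_time coord \<omega> < \<infinity> \<and> walk coord (the_enat (descending_time coord \<omega>)) \<omega> \<le> x)"
      by (rule W.measurable_desc_event)
    from transport[OF this] show "Fm x = cdf W.desc_law x"
      unfolding Fm_def descending_ladder_cdf_def W.desc_law_cdf coord Y_def .
  qed
  have p: "1 - p = W.never_prob"
  proof -
    have "Measurable.pred W.S (\<lambda>\<omega>. \<not> ascending_time coord \<omega> = \<infinity>)" by measurable
    from transport[OF this] have "p = measure W.S {\<omega>. \<not> ascending_time coord \<omega> = \<infinity>}"
      unfolding p_def ascending_prob_def coord Y_def by (simp add: less_top[symmetric] top_enat_def)
    also have "\<dots> = 1 - W.never_prob"
      using W.P.prob_compl[OF W.sets_Collect_pred[OF W.measurable_never]]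
      unfolding W.never_prob_def by (simp add: set_diff_eq)
    finally show ?thesis by simp
  qed
  have W_eq: "W x = 1 - W.T x" for x
  proof -
    have "Measurable.pred W.S (\<lambda>\<omega>. walk_max coord \<omega> \<le> ereal x)" by measurable
    from transport[OF this] have "W x = measure W.S {\<omega>. walk_max coord \<omega> \<le> ereal x}"
      unfolding W_def max_cdf_def coord Y_def .
    also have "\<dots> = 1 - measure W.S {\<omega>. ereal x < walk_max coord \<omega>}"
    proof -
      have "{\<omega>. ereal x < walk_max coord \<omega>} \<in> sets W.S" by (rule W.sets_Collect_pred) measurable
      from W.P.prob_compl[OF this] show ?thesis by (simp add: set_diff_eq not_less)
    qed
    also have "measure W.S {\<omega>. ereal x < walk_max coord \<omega>} = W.T x"
      unfolding W.T_def measure_def W.emeasure_max_law_tail ..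
    finally show ?thesis .
  qed
  have tailW: "tail W x = W.T x" for x
  proof -
    have "((\<lambda>x. 1 - W.T x) \<longlongrightarrow> 1 - 0) at_top" by (intro tendsto_diff tendsto_const W.T_tendsto_0)
    then have "(W \<longlongrightarrow> 1) at_top" by (simp add: W_eq[abs_def])
    then have "Lim at_top W = 1" by (rule tendsto_Lim[rotated]) simp
    then show ?thesis by (simp add: tail_def W_eq)
  qed
  note mom = moment_cdf[OF W.finite_borel_measure_asc_law, folded Fp]
    moment_cdf[OF W.finite_borel_measure_desc_law, folded Fm]
  have 1: "finite_moment Fm m" unfolding mom by (intro W.integrable_desc_law_power W.step_moments order_refl)
  have 2: "finite_moment Fp (m - 1)" unfolding mom by (intro W.integrable_asc_law_power W.max_law_moments order_refl)
  define E where "E = \<one>\<^bsub>R\<^esub> \<ominus>\<^bsub>R\<^esub> laplace_character Fp (m - 1)"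
  define Q where "Q = signed_shift (laplace_character Fm m)"
  have sm: "Suc (m - 1) = m" using assms(16) by simp
  have E_eq: "E = 1 - laplace_character Fp (m - 1)"
    unfolding E_def R_def by (subst D_ring_minus) (simp_all add: D_ring_simps degree_laplace_character)
  have cE: "coeff E k = (if k = 0 then 1 else 0) - (- 1) ^ k / fact k * (\<integral>y. y ^ k \<partial>W.asc_law)" if "k < m" for k
    unfolding E_eq using that by (auto simp: coeff_laplace_character mom one_pCons coeff_pCons split: nat.splits)
  have cQ: "coeff Q k = (- 1) ^ k / fact (Suc k) * (\<integral>y. y ^ Suc k \<partial>W.desc_law)" if "k < m" for k
    unfolding Q_def coeff_signed_shift coeff_laplace_character using that by (simp add: mom del: fact_Suc)
  have dE: "degree E \<le> m - 1"
    unfolding E_eq by (intro degree_diff_le degree_laplace_character) simp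
  have dQ: "degree Q \<le> m - 1"
    by (rule degree_le) (auto simp: Q_def coeff_signed_shift coeff_laplace_character)
  have E: "E \<in> Units R" unfolding R_def
    by (rule D_ring_unit[OF dE]) (use cE[of 0] W.asc_law_mass W.never_prob_pos assms(16) in simp)
  have Q: "Q \<in> Units R" unfolding R_def
    by (rule D_ring_unit[OF dQ]) (use cQ[of 0] W.desc_law_mean assms(16) in simp)
  define V where "V = E [^]\<^bsub>R\<^esub> (-2 :: int) \<otimes>\<^bsub>R\<^esub> inv\<^bsub>R\<^esub> Q"
  note V = D_ring_inverse_square_product[OF E[unfolded R_def] Q[unfolded R_def], folded R_def, folded V_def, unfolded sm]
  have act: "D_act V (D_inv (tail F)) x = (\<Sum>k<m. coeff V k * (deriv ^^ k) (D_inv (tail F)) x)" for x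
  proof -
    have "{..m - 1} = {..<m}" using assms(16) by auto
    then show ?thesis using D_act_eq_sum[OF V(1)] by simp
  qed
  have lim: "((\<lambda>x. (tail W x - (1 - p) * D_act V (D_inv (tail F)) x) / (x * tail F x / x ^ (m - 1))) \<longlongrightarrow> 0) at_top"
    unfolding tailW p act by (rule W.ladder_operator_expansion[OF cE cQ V(2)])
  have scale: "\<forall>\<^sub>F x in at_top. x powi (2 - int m) * tail F x = x * tail F x / x ^ (m - 1)"
    using eventually_gt_at_top[of 0]
  proof eventually_elim
    case (elim x)
    have "x powi (2 - int m) = x powi (1 - int (m - 1))" using assms(16) by (simp add: of_nat_diff)
    also have "\<dots> = x / x ^ (m - 1)" using elim by (simp add: power_int_diff)
    finally show ?case by simp
  qed
  have 3: "(\<lambda>x. tail W x - (1 - p) * D_act V (D_inv (tail F)) x) \<in> o[at_top](\<lambda>x. x powi (2 - int m) * tail F x)"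
  proof (rule smalloI_tendsto)
    show "((\<lambda>x. (tail W x - (1 - p) * D_act V (D_inv (tail F)) x) / (x powi (2 - int m) * tail F x)) \<longlongrightarrow> 0) at_top"
      by (rule Lim_transform_eventually[OF lim]) (use scale in \<open>eventually_elim, simp\<close>)
    show "\<forall>\<^sub>F x in at_top. x powi (2 - int m) * tail F x \<noteq> 0"
      using scale eventually_gt_at_top[of 0]
    proof eventually_elim
      case (elim x)
      then show ?case using W.pos[of x] by simp
    qed
  qed
  from 1 2 E Q 3 show ?thesis unfolding E_def Q_def V_def by blast
qed

end
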